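(* Let $S$ be a non-abelian finite simple group, $G$ its universal covering group and $\ell$ a prime. Suppose that for every non-central radical $\ell$-subgroup $D$ of $G$ the relative inductive AM-condition holds for $S$ with respect to $D\,\mathrm{Z}(G)/\mathrm{Z}(G)$. Then $S$ satisfies the (projective-representation form of the) inductive AM-condition with respect to $\ell$.
   Context: Notation. For a finite group $H$, $\mathrm{Irr}(H)$ is the set of irreducible complex characters; blocks are $\ell$-blocks; $\mathrm{bl}(\chi)$ is the $\ell$-block containing $\chi$. For $K\le H$ and a block $b$ of $K$, $b^H$ is the Brauer-induced block (an equality involving it includes that it is defined). An $\ell$-subgroup $D\le H$ is radical if $D=\mathrm{O}_\ell(\mathrm{N}_H(D))$. $\mathrm{Irr}(H\mid D)$ is the set of irreducible characters of $H$ in $\ell$-blocks having $D$ as a defect group, and $\mathrm{Irr}_0(H\mid D)=\{\chi\in \mathrm{Irr}(H\mid D): \chi(1)_\ell=|H:D|_\ell\}$. For $N\lhd H$: if $\chi\in\mathrm{Irr}(H)$, $\mathrm{Irr}(N\mid\chi)$ is the set of irreducible constituents of $\mathrm{Res}^H_N\chi$; if $\nu\in\mathrm{Irr}(N)$, $\mathrm{Irr}(H\mid\nu)$ is the set of irreducible constituents of $\mathrm{Ind}_N^H\nu$. Subscripts denote stabilizers. $H_{\ell'}$ is the set of $\ell$-regular elements. $x\mapsto x^*$ is reduction from a suitable complete valuation ring $\mathcal O$ (of characteristic $0$, containing the needed roots of unity) to its residue field $\overline{\mathbb F}_\ell$. Definition (relative inductive AM-condition). Let $D$ be a non-central radical $\ell$-subgroup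 of $G$. The relative inductive AM-condition holds for $S$ with respect to $D\,\mathrm{Z}(G)/\mathrm{Z}(G)$ if: (a) there is an $\mathrm{Aut}(G)_D$-stable subgroup $M$ with $\mathrm{N}_G(D)\le M\lneq G$; (b) there is an $\mathrm{Aut}(G)_D$-equivariant bijection $\Omega_D:\mathrm{Irr}_0(G\mid D)\to\mathrm{Irr}_0(M\mid D)$ such that $\Omega_D(\mathrm{Irr}_0(G\mid D)\cap\mathrm{Irr}(G\mid\nu))\subseteq\mathrm{Irr}(M\mid\nu)$ for every $\nu\in\mathrm{Irr}(\mathrm{Z}(G))$, and $\mathrm{bl}(\chi)=\mathrm{bl}(\Omega_D(\chi))^G$ for every $\chi\in\mathrm{Irr}_0(G\mid D)$; (c) for every $\chi\in\mathrm{Irr}_0(G\mid D)$ there exist a finite group $A$ and characters $\widetilde\chi,\widetilde\chi'$ such that (i) for $Z:=\ker(\chi)\cap\mathrm{Z}(G)$ and $\overline G:=G/Z$ one has $\overline G\lhd A$, $\mathrm{C}_A(\overline G)=\mathrm{Z}(A)$ and $A/\mathrm{Z}(A)\cong\mathrm{Aut}(G)_\chi$ (canonically, via the conjugation action on $\overline G$); (ii) $\widetilde\chi\in\mathrm{Irr}(A)$ extends $\overline\chi$, where $\overline\chi\in\mathrm{Irr}(\overline G)$ lifts to $\chi$; (iii) for $\overline M:=MZ/Z$, $\overline D:=DZ/Z$, $\widetilde\chi'\in\mathrm{Irr}(\overline M\,\mathrm{N}_A(\overline D))$ extends $\overline\chi'$, where $\overline\chi'\in\mathrm{Irr}(\overline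 M)$ lifts to $\chi':=\Omega_D(\chi)$; (iv) $\mathrm{bl}(\mathrm{Res}^A_J(\widetilde\chi))=\mathrm{bl}\bigl(\mathrm{Res}^{\overline M\mathrm{N}_A(\overline D)}_{\overline M\mathrm{N}_J(\overline D)}(\widetilde\chi')\bigr)^J$ for every $J$ with $\overline G\le J\le A$; (v) $\mathrm{Irr}(\mathrm{Z}(A)\mid\widetilde\chi)=\mathrm{Irr}(\mathrm{Z}(A)\mid\widetilde\chi')$. Sections and projective representations. For $X_1\lhd X_2$, an $X_1$-section is a map $\mathrm{rep}:X_2/X_1\to X_2$ that is a set-theoretic section of the quotient map with $\mathrm{rep}(1)=1$. If $X_1$ is central in $X_2$ and $\chi\in\mathrm{Irr}(X_2)$, a projective representation $\mathcal Q$ of $X_2/X_1$ is obtained from $\chi$ using $\mathrm{rep}$ if $\mathcal Q=\mathcal D\circ\mathrm{rep}$ for some linear representation $\mathcal D$ of $X_2$ affording $\chi$. Subgroups of $G$ containing $\mathrm{Z}(G)$, modulo $\mathrm{Z}(G)$, are identified with subgroups of $\mathrm{Inn}(G)\le\mathrm{Aut}(G)$; in particular $S=G/\mathrm{Z}(G)\le\mathrm{Aut}(G)$. Definition (inductive AM-condition for $S$ and $\ell$, projective-representation form). For every non-central radical $\ell$-subgroup $D$ of $G$ there exist $M$ and $\Omega_D$ as in (a), (b) above such that, moreover, for every $\chi\in\mathrm{Irr}_0(G\mid D)$, with $\chi':=\Omega_D(\chi)$ and $\widehat M:=M/\mathrm{Z}(G)$, there exist a $\mathrm{Z}(G)$-section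 $\mathrm{rep}:S\to G$, a projective representation $\mathcal P$ of $\mathrm{Aut}(G)_\chi$ and a projective representation $\mathcal P'$ of $\widehat M\,\mathrm{Aut}(G)_{D,\chi}$ such that: $\mathrm{Res}_S(\mathcal P)$ is obtained from $\chi$ using $\mathrm{rep}$; $\mathrm{Res}_{\widehat M}(\mathcal P')$ is obtained from $\chi'$ using $\mathrm{rep}|_{\widehat M}$; the factor sets $\alpha$ of $\mathcal P$ and $\alpha'$ of $\mathcal P'$ agree on $\widehat M\,\mathrm{Aut}(G)_{D,\chi}$; and for every $x\in(\widehat M\,\mathrm{Aut}(G)_{D,\chi})_{\ell'}$ with $D\mathrm{Z}(G)/\mathrm{Z}(G)\in\mathrm{Syl}_\ell(\mathrm{C}_{G/\mathrm{Z}(G)}(x))$ one has $\epsilon_\chi^*\,\mathrm{tr}(\mathcal P(x))^*=\mathrm{tr}(\mathcal P'(x))^*$, where $\epsilon_\chi\in\{1,\dots,\ell-1\}$ is defined by $\epsilon_\chi\,\chi(1)_{\ell'}\equiv|G:M|_{\ell'}\,\chi'(1)_{\ell'}\pmod \ell$. *)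

theory Defs
  imports
    "HOL-Algebra.Algebra"
    "HOL-Algebra.SimpleGroups"
    "HOL-Algebra.Bij"
    "HOL-Computational_Algebra.Computational_Algebra"
    "Jordan_Normal_Form.Matrix"
begin

section \<open>Finite groups\<close>

text \<open>A subgroup \<open>K\<close> of \<open>H\<close> is a subset of the carrier; regarded as a group it is
  \<open>H\<lparr>carrier := K\<rparr>\<close>.\<close>

definition center :: "('a, 'b) monoid_scheme \<Rightarrow> 'a set" where
  "center H = {z \<in> carrier H. \<forall>x\<in>carrier H. z \<otimes>\<^bsub>H\<^esub> x = x \<otimes>\<^bsub>H\<^esub> z}"

definition centralizer :: "('a, 'b) monoid_scheme \<Rightarrow> 'a set \<Rightarrow> 'a set" where
  "centralizer H U = {z \<in> carrier H. \<forall>x\<in>U. z \<otimes>\<^bsub>H\<^esub> x = x \<otimes>\<^bsub>H\<^esub> z}"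

definition conj_class :: "('a, 'b) monoid_scheme \<Rightarrow> 'a \<Rightarrow> 'a set" where
  "conj_class H x = {h \<otimes>\<^bsub>H\<^esub> x \<otimes>\<^bsub>H\<^esub> inv\<^bsub>H\<^esub> h | h. h \<in> carrier H}"

definition conj_classes :: "('a, 'b) monoid_scheme \<Rightarrow> 'a set set" where
  "conj_classes H = conj_class H ` carrier H"

definition l_part :: "nat \<Rightarrow> nat \<Rightarrow> nat" where
  "l_part l n = l ^ multiplicity l n"

definition l'_part :: "nat \<Rightarrow> nat \<Rightarrow> nat" where
  "l'_part l n = n div l_part l n"

definition group_index :: "('a, 'b) monoid_scheme \<Rightarrow> 'a set \<Rightarrow> nat" where
  "group_index H K = card (rcosets\<^bsub>H\<^esub> K)"

definition l_subgroup :: "nat \<Rightarrow> ('a, 'b) monoid_scheme \<Rightarrow> 'a set \<Rightarrow> bool" where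
  "l_subgroup l H P \<longleftrightarrow> subgroup P H \<and> (\<exists>k. card P = l ^ k)"

definition sylow_subgroup :: "nat \<Rightarrow> ('a, 'b) monoid_scheme \<Rightarrow> 'a set \<Rightarrow> bool" where
  "sylow_subgroup l H P \<longleftrightarrow> subgroup P H \<and> card P = l_part l (Coset.order H)"

definition l_core :: "nat \<Rightarrow> ('a, 'b) monoid_scheme \<Rightarrow> 'a set" where
  "l_core l H = generate H (\<Union>{P. P \<lhd> H \<and> l_subgroup l H P})"

definition radical_subgroup :: "nat \<Rightarrow> ('a, 'b) monoid_scheme \<Rightarrow> 'a set \<Rightarrow> bool" where
  "radical_subgroup l H D \<longleftrightarrow>
     l_subgroup l H D \<and> D = l_core l (H\<lparr>carrier := normalizer H D\<rparr>)"

definition noncentral_radical :: "nat \<Rightarrow> ('a, 'b) monoid_scheme \<Rightarrow> 'a set \<Rightarrow> bool" where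
  "noncentral_radical l H D \<longleftrightarrow> radical_subgroup l H D \<and> \<not> D \<subseteq> center H"

definition l_regular :: "nat \<Rightarrow> ('a, 'b) monoid_scheme \<Rightarrow> 'a \<Rightarrow> bool" where
  "l_regular l H x \<longleftrightarrow> x \<in> carrier H \<and> \<not> l dvd group.ord H x"

definition central_extension ::
  "('e, 'b) monoid_scheme \<Rightarrow> ('e \<Rightarrow> 's) \<Rightarrow> ('s, 'c) monoid_scheme \<Rightarrow> bool" where
  "central_extension E q S \<longleftrightarrow> group E \<and> q \<in> epi E S \<and> kernel E S q \<subseteq> center E"

text \<open>The universal property is tested on central extensions whose underlying set consists of
  natural numbers. Up to isomorphism these are all the countable ones, in particular all finite
  ones, which determines the universal covering group of a finite perfect group. The finiteness
  of the latter is Schur's theorem.\<close>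

definition universal_covering_group ::
  "('a, 'b) monoid_scheme \<Rightarrow> ('a \<Rightarrow> 's) \<Rightarrow> ('s, 'c) monoid_scheme \<Rightarrow> bool" where
  "universal_covering_group G p S \<longleftrightarrow>
     finite (carrier G) \<and> central_extension G p S \<and> derived G (carrier G) = carrier G \<and>
     (\<forall>(E :: nat monoid) q. central_extension E q S \<longrightarrow>
        (\<exists>!f. f \<in> hom G E \<and> f \<in> extensional (carrier G) \<and> (\<forall>g\<in>carrier G. q (f g) = p g)))"

section \<open>Representations and characters\<close>

definition GL :: "nat \<Rightarrow> complex mat monoid" where
  "GL n = units_of (ring_mat TYPE(complex) n ())"

definition mat_trace :: "complex mat \<Rightarrow> complex" where
  "mat_trace A = (\<Sum>i<dim_row A. A $$ (i, i))"

definition invariant_subspace ::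
  "('a, 'b) monoid_scheme \<Rightarrow> nat \<Rightarrow> ('a \<Rightarrow> complex mat) \<Rightarrow> complex vec set \<Rightarrow> bool" where
  "invariant_subspace H n \<rho> W \<longleftrightarrow>
     W \<subseteq> carrier_vec n \<and> 0\<^sub>v n \<in> W \<and> (\<forall>v\<in>W. \<forall>w\<in>W. v + w \<in> W) \<and> (\<forall>c. \<forall>v\<in>W. c \<cdot>\<^sub>v v \<in> W) \<and>
     (\<forall>h\<in>carrier H. \<forall>v\<in>W. \<rho> h *\<^sub>v v \<in> W)"

definition irreducible_rep :: "('a, 'b) monoid_scheme \<Rightarrow> nat \<Rightarrow> ('a \<Rightarrow> complex mat) \<Rightarrow> bool" where
  "irreducible_rep H n \<rho> \<longleftrightarrow>
     0 < n \<and> \<rho> \<in> hom H (GL n) \<and>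
     (\<forall>W. invariant_subspace H n \<rho> W \<longrightarrow> W = {0\<^sub>v n} \<or> W = carrier_vec n)"

definition affords ::
  "('a, 'b) monoid_scheme \<Rightarrow> ('a \<Rightarrow> complex mat) \<Rightarrow> ('a \<Rightarrow> complex) \<Rightarrow> bool" where
  "affords H \<rho> \<chi> \<longleftrightarrow> \<chi> = (\<lambda>x\<in>carrier H. mat_trace (\<rho> x))"

text \<open>Characters are extensional functions, so that equality of characters of \<open>H\<close> is equality on
  the carrier, and \<^term>\<open>restrict \<chi> K\<close> is the restriction to a subgroup.\<close>

definition Irr :: "('a, 'b) monoid_scheme \<Rightarrow> ('a \<Rightarrow> complex) set" where
  "Irr H = {\<chi>. \<exists>n \<rho>. irreducible_rep H n \<rho> \<and> affords H \<rho> \<chi>}"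

definition char_degree :: "('a, 'b) monoid_scheme \<Rightarrow> ('a \<Rightarrow> complex) \<Rightarrow> nat" where
  "char_degree H \<chi> = (THE d. of_nat d = \<chi> \<one>\<^bsub>H\<^esub>)"

definition char_kernel :: "('a, 'b) monoid_scheme \<Rightarrow> ('a \<Rightarrow> complex) \<Rightarrow> 'a set" where
  "char_kernel H \<chi> = {x \<in> carrier H. \<chi> x = \<chi> \<one>\<^bsub>H\<^esub>}"

definition char_inner ::
  "('a, 'b) monoid_scheme \<Rightarrow> ('a \<Rightarrow> complex) \<Rightarrow> ('a \<Rightarrow> complex) \<Rightarrow> complex" where
  "char_inner H \<phi> \<psi> = (\<Sum>x\<in>carrier H. \<phi> x * cnj (\<psi> x)) / of_nat (Coset.order H)"

definition ind_char ::
  "('a, 'b) monoid_scheme \<Rightarrow> 'a set \<Rightarrow> ('a \<Rightarrow> complex) \<Rightarrow> 'a \<Rightarrow> complex" where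
  "ind_char H N \<nu> = (\<lambda>g\<in>carrier H.
     (\<Sum>x\<in>{x \<in> carrier H. x \<otimes>\<^bsub>H\<^esub> g \<otimes>\<^bsub>H\<^esub> inv\<^bsub>H\<^esub> x \<in> N}. \<nu> (x \<otimes>\<^bsub>H\<^esub> g \<otimes>\<^bsub>H\<^esub> inv\<^bsub>H\<^esub> x))
     / of_nat (card N))"

text \<open>\<open>Irr_under H N \<chi>\<close> is \<open>Irr(N | \<chi>)\<close> for a character \<open>\<chi>\<close> of \<open>H\<close>, and \<open>Irr_over H N \<nu>\<close> is
  \<open>Irr(H | \<nu>)\<close> for a character \<open>\<nu>\<close> of \<open>N\<close>.\<close>

definition Irr_under ::
  "('a, 'b) monoid_scheme \<Rightarrow> 'a set \<Rightarrow> ('a \<Rightarrow> complex) \<Rightarrow> ('a \<Rightarrow> complex) set" where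
  "Irr_under H N \<chi> =
     {\<nu> \<in> Irr (H\<lparr>carrier := N\<rparr>). char_inner (H\<lparr>carrier := N\<rparr>) (restrict \<chi> N) \<nu> \<noteq> 0}"

definition Irr_over ::
  "('a, 'b) monoid_scheme \<Rightarrow> 'a set \<Rightarrow> ('a \<Rightarrow> complex) \<Rightarrow> ('a \<Rightarrow> complex) set" where
  "Irr_over H N \<nu> = {\<chi> \<in> Irr H. char_inner H (ind_char H N \<nu>) \<chi> \<noteq> 0}"

definition projective_rep ::
  "('q, 'b) monoid_scheme \<Rightarrow> nat \<Rightarrow> ('q \<Rightarrow> complex mat) \<Rightarrow> ('q \<Rightarrow> 'q \<Rightarrow> complex) \<Rightarrow> bool" where
  "projective_rep Q n P \<alpha> \<longleftrightarrow>
     0 < n \<and> (\<forall>x\<in>carrier Q. P x \<in> carrier (GL n)) \<and>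
     (\<forall>x\<in>carrier Q. \<forall>y\<in>carrier Q. \<alpha> x y \<noteq> 0 \<and> P x * P y = \<alpha> x y \<cdot>\<^sub>m P (x \<otimes>\<^bsub>Q\<^esub> y))"

section \<open>Reduction modulo \<open>\<ell>\<close>\<close>

text \<open>\<open>R\<close> is the valuation ring of a subfield \<open>K\<close> of the complex numbers that is complete with
  respect to the non-archimedean absolute value \<open>\<nu>\<close>, and \<open>star\<close> is the reduction map from \<open>R\<close> to
  its residue field, an algebraic closure of the field with \<open>l\<close> elements. Since the groups \<open>A\<close>
  below are not bounded in advance, \<open>K\<close> is asked to contain all roots of unity (so \<open>\<nu>\<close> is not
  discrete); an instance is \<open>K\<close> the whole field of complex numbers, by transport from the
  completed algebraic closure of the \<open>l\<close>-adic numbers. Outside \<open>R\<close> the values of \<open>star\<close> carry no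
  information.\<close>

definition modular_reduction :: "nat \<Rightarrow> complex set \<Rightarrow> (complex \<Rightarrow> 'k::alg_closed_field) \<Rightarrow> bool" where
  "modular_reduction l R star \<longleftrightarrow>
     CHAR('k) = l \<and> (\<forall>y::'k. \<exists>n>0. y ^ (l ^ n) = y) \<and>
     (\<exists>(K :: complex set) (\<nu> :: complex \<Rightarrow> real).
        0 \<in> K \<and> 1 \<in> K \<and>
        (\<forall>x\<in>K. \<forall>y\<in>K. x + y \<in> K \<and> x - y \<in> K \<and> x * y \<in> K) \<and> (\<forall>x\<in>K. inverse x \<in> K) \<and>
        (\<forall>z n. 0 < n \<and> z ^ n = 1 \<longrightarrow> z \<in> K) \<and>
        (\<forall>x\<in>K. 0 \<le> \<nu> x \<and> (\<nu> x = 0 \<longleftrightarrow> x = 0)) \<and>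
        (\<forall>x\<in>K. \<forall>y\<in>K. \<nu> (x * y) = \<nu> x * \<nu> y \<and> \<nu> (x + y) \<le> max (\<nu> x) (\<nu> y)) \<and>
        (\<forall>u :: nat \<Rightarrow> complex. range u \<subseteq> K \<and>
             (\<forall>e>0. \<exists>N. \<forall>m\<ge>N. \<forall>n\<ge>N. \<nu> (u m - u n) < e) \<longrightarrow>
           (\<exists>L\<in>K. \<forall>e>0. \<exists>N. \<forall>n\<ge>N. \<nu> (u n - L) < e)) \<and>
        R = {x \<in> K. \<nu> x \<le> 1} \<and>
        star 1 = 1 \<and>
        (\<forall>x\<in>R. \<forall>y\<in>R. star (x + y) = star x + star y \<and> star (x * y) = star x * star y) \<and>
        star ` R = UNIV \<and>
        (\<forall>x\<in>R. star x = 0 \<longleftrightarrow> \<nu> x < 1))"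

section \<open>Blocks\<close>

text \<open>Blocks, defect groups and Brauer induction are introduced through central characters of the
  modular group algebra \<open>FH\<close>, as in Navarro, Characters and Blocks of Finite Groups, Chapters 3 and
  4. Elements of \<open>FH\<close> are represented by their coefficient functions; blocks are represented by the
  sets of their ordinary irreducible characters.\<close>

definition center_group_algebra :: "('a, 'b) monoid_scheme \<Rightarrow> ('a \<Rightarrow> 'k::field) set" where
  "center_group_algebra H =
     {z. (\<forall>x. x \<notin> carrier H \<longrightarrow> z x = 0) \<and>
         (\<forall>x\<in>carrier H. \<forall>h\<in>carrier H. z (h \<otimes>\<^bsub>H\<^esub> x \<otimes>\<^bsub>H\<^esub> inv\<^bsub>H\<^esub> h) = z x)}"

definition group_algebra_mult ::
  "('a, 'b) monoid_scheme \<Rightarrow> ('a \<Rightarrow> 'k::field) \<Rightarrow> ('a \<Rightarrow> 'k) \<Rightarrow> 'a \<Rightarrow> 'k" where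
  "group_algebra_mult H z w =
     (\<lambda>g. if g \<in> carrier H then \<Sum>h\<in>carrier H. z h * w (inv\<^bsub>H\<^esub> h \<otimes>\<^bsub>H\<^esub> g) else 0)"

definition center_algebra_hom :: "('a, 'b) monoid_scheme \<Rightarrow> (('a \<Rightarrow> 'k::field) \<Rightarrow> 'k) \<Rightarrow> bool" where
  "center_algebra_hom H L \<longleftrightarrow>
     L (\<lambda>x. if x = \<one>\<^bsub>H\<^esub> then 1 else 0) = 1 \<and>
     (\<forall>z\<in>center_group_algebra H. \<forall>c. L (\<lambda>x. c * z x) = c * L z) \<and>
     (\<forall>z\<in>center_group_algebra H. \<forall>w\<in>center_group_algebra H.
        L (\<lambda>x. z x + w x) = L z + L w \<and> L (group_algebra_mult H z w) = L z * L w)"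

text \<open>The scalar by which the class sum of \<open>C\<close> acts in a representation affording \<open>\<chi>\<close>.\<close>

definition omega :: "('a, 'b) monoid_scheme \<Rightarrow> ('a \<Rightarrow> complex) \<Rightarrow> 'a set \<Rightarrow> complex" where
  "omega H \<chi> C = (\<Sum>x\<in>C. \<chi> x) / \<chi> \<one>\<^bsub>H\<^esub>"

text \<open>The linear extension to the center of \<open>FH\<close> of the map sending the class sum of \<open>C\<close> to the
  reduction of \<^term>\<open>omega H \<chi> C\<close>.\<close>

definition central_char ::
  "(complex \<Rightarrow> 'k::field) \<Rightarrow> ('a, 'b) monoid_scheme \<Rightarrow> ('a \<Rightarrow> complex) \<Rightarrow> ('a \<Rightarrow> 'k) \<Rightarrow> 'k" where
  "central_char star H \<chi> z = (\<Sum>C\<in>conj_classes H. z (SOME x. x \<in> C) * star (omega H \<chi> C))"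

definition bl ::
  "(complex \<Rightarrow> 'k::field) \<Rightarrow> ('a, 'b) monoid_scheme \<Rightarrow> ('a \<Rightarrow> complex) \<Rightarrow> ('a \<Rightarrow> complex) set" where
  "bl star H \<chi> = {\<psi> \<in> Irr H. \<forall>z\<in>center_group_algebra H.
                     central_char star H \<psi> z = central_char star H \<chi> z}"

definition blocks ::
  "(complex \<Rightarrow> 'k::field) \<Rightarrow> ('a, 'b) monoid_scheme \<Rightarrow> ('a \<Rightarrow> complex) set set" where
  "blocks star H = bl star H ` Irr H"

definition block_central_char ::
  "(complex \<Rightarrow> 'k::field) \<Rightarrow> ('a, 'b) monoid_scheme \<Rightarrow> ('a \<Rightarrow> complex) set \<Rightarrow> ('a \<Rightarrow> 'k) \<Rightarrow> 'k" where
  "block_central_char star H B = central_char star H (SOME \<chi>. \<chi> \<in> B)"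

text \<open>The coefficient at \<open>x\<close> of the block idempotent of \<open>B\<close>.\<close>

definition block_idempotent ::
  "(complex \<Rightarrow> 'k::field) \<Rightarrow> ('a, 'b) monoid_scheme \<Rightarrow> ('a \<Rightarrow> complex) set \<Rightarrow> 'a \<Rightarrow> 'k" where
  "block_idempotent star H B x =
     star ((\<Sum>\<chi>\<in>B. \<chi> \<one>\<^bsub>H\<^esub> * \<chi> (inv\<^bsub>H\<^esub> x)) / of_nat (Coset.order H))"

text \<open>\<open>x\<close> lies in a defect class of \<open>B\<close>, and \<open>D\<close> is a defect group of that class.\<close>

definition defect_group ::
  "(complex \<Rightarrow> 'k::field) \<Rightarrow> nat \<Rightarrow> ('a, 'b) monoid_scheme \<Rightarrow> ('a \<Rightarrow> complex) set \<Rightarrow> 'a set \<Rightarrow> bool"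
  where
  "defect_group star l H B D \<longleftrightarrow>
     (\<exists>x\<in>carrier H.
        block_idempotent star H B x \<noteq> 0 \<and>
        block_central_char star H B (\<lambda>y. if y \<in> conj_class H x then 1 else 0) \<noteq> 0 \<and>
        sylow_subgroup l (H\<lparr>carrier := centralizer H {x}\<rparr>) D)"

definition induced_central_char ::
  "(complex \<Rightarrow> 'k::field) \<Rightarrow> ('a, 'b) monoid_scheme \<Rightarrow> 'a set \<Rightarrow> ('a \<Rightarrow> complex) set \<Rightarrow>
     ('a \<Rightarrow> 'k) \<Rightarrow> 'k" where
  "induced_central_char star H K b z =
     block_central_char star (H\<lparr>carrier := K\<rparr>) b (\<lambda>x. if x \<in> K then z x else 0)"

text \<open>\<open>is_induced_block star H K b B\<close>: the block \<open>b\<^sup>H\<close> of the block \<open>b\<close> of \<open>K\<close> is defined and equal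
  to \<open>B\<close>.\<close>

definition is_induced_block ::
  "(complex \<Rightarrow> 'k::field) \<Rightarrow> ('a, 'b) monoid_scheme \<Rightarrow> 'a set \<Rightarrow> ('a \<Rightarrow> complex) set \<Rightarrow>
     ('a \<Rightarrow> complex) set \<Rightarrow> bool" where
  "is_induced_block star H K b B \<longleftrightarrow>
     b \<in> blocks star (H\<lparr>carrier := K\<rparr>) \<and> B \<in> blocks star H \<and>
     center_algebra_hom H (induced_central_char star H K b) \<and>
     (\<forall>z\<in>center_group_algebra H.
        block_central_char star H B z = induced_central_char star H K b z)"

definition Irr_defect ::
  "(complex \<Rightarrow> 'k::field) \<Rightarrow> nat \<Rightarrow> ('a, 'b) monoid_scheme \<Rightarrow> 'a set \<Rightarrow> ('a \<Rightarrow> complex) set" where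
  "Irr_defect star l H D = {\<chi> \<in> Irr H. defect_group star l H (bl star H \<chi>) D}"

definition Irr0 ::
  "(complex \<Rightarrow> 'k::field) \<Rightarrow> nat \<Rightarrow> ('a, 'b) monoid_scheme \<Rightarrow> 'a set \<Rightarrow> ('a \<Rightarrow> complex) set" where
  "Irr0 star l H D = {\<chi> \<in> Irr_defect star l H D.
     l_part l (char_degree H \<chi>) = l_part l (group_index H D)}"

section \<open>Automorphisms\<close>

text \<open>\<open>Aut(G)\<close> is \<^term>\<open>AutoGroup G\<close>, with multiplication the composition of maps. An automorphism
  \<open>\<sigma>\<close> stabilizing \<open>M\<close> acts on the characters of \<open>M\<close> by \<^term>\<open>\<lambda>\<chi>. compose M \<chi> \<sigma>\<close>.\<close>

definition Aut_set :: "('a, 'b) monoid_scheme \<Rightarrow> 'a set \<Rightarrow> ('a \<Rightarrow> 'a) set" where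
  "Aut_set G D = {\<sigma> \<in> auto G. \<sigma> ` D = D}"

definition Aut_char :: "('a, 'b) monoid_scheme \<Rightarrow> ('a \<Rightarrow> complex) \<Rightarrow> ('a \<Rightarrow> 'a) set" where
  "Aut_char G \<chi> = {\<sigma> \<in> auto G. compose (carrier G) \<chi> \<sigma> = \<chi>}"

definition inner :: "('a, 'b) monoid_scheme \<Rightarrow> 'a \<Rightarrow> 'a \<Rightarrow> 'a" where
  "inner G g = (\<lambda>x\<in>carrier G. g \<otimes>\<^bsub>G\<^esub> x \<otimes>\<^bsub>G\<^esub> inv\<^bsub>G\<^esub> g)"

section \<open>The two forms of the condition\<close>

text \<open>Throughout, \<open>G\<close> is the universal covering group of a non-abelian simple group \<open>S\<close>, identified with
  \<open>G/Z(G)\<close>.\<close>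

definition AM_subgroup :: "('a, 'b) monoid_scheme \<Rightarrow> 'a set \<Rightarrow> 'a set \<Rightarrow> bool" where
  "AM_subgroup G D M \<longleftrightarrow>
     subgroup M G \<and> normalizer G D \<subseteq> M \<and> M \<noteq> carrier G \<and> (\<forall>\<sigma>\<in>Aut_set G D. \<sigma> ` M = M)"

definition AM_bijection ::
  "(complex \<Rightarrow> 'k::field) \<Rightarrow> nat \<Rightarrow> ('a, 'b) monoid_scheme \<Rightarrow> 'a set \<Rightarrow> 'a set \<Rightarrow>
     (('a \<Rightarrow> complex) \<Rightarrow> 'a \<Rightarrow> complex) \<Rightarrow> bool" where
  "AM_bijection star l G D M \<Omega> \<longleftrightarrow>
     bij_betw \<Omega> (Irr0 star l G D) (Irr0 star l (G\<lparr>carrier := M\<rparr>) D) \<and>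
     (\<forall>\<sigma>\<in>Aut_set G D. \<forall>\<chi>\<in>Irr0 star l G D.
        \<Omega> (compose (carrier G) \<chi> \<sigma>) = compose M (\<Omega> \<chi>) \<sigma>) \<and>
     (\<forall>\<nu>\<in>Irr (G\<lparr>carrier := center G\<rparr>).
        \<Omega> ` (Irr0 star l G D \<inter> Irr_over G (center G) \<nu>)
          \<subseteq> Irr_over (G\<lparr>carrier := M\<rparr>) (center G) \<nu>) \<and>
     (\<forall>\<chi>\<in>Irr0 star l G D.
        is_induced_block star G M (bl star (G\<lparr>carrier := M\<rparr>) (\<Omega> \<chi>)) (bl star G \<chi>))"

text \<open>Part (c) of the relative condition, for a single character \<open>\<chi>\<close> with \<open>\<chi>' = \<Omega>\<^sub>D(\<chi>)\<close>. The finite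
  group \<open>A\<close> is taken with natural numbers as elements, which is no restriction up to isomorphism;
  the inclusion of \<open>G/Z\<close> in \<open>A\<close> thus becomes a monomorphism \<open>i\<close>, and \<open>e\<close> is its composition with
  the projection of \<open>G\<close> onto \<open>G/Z\<close>. Here \<open>e ` M\<close> is \<open>MZ/Z\<close> and \<open>e ` D\<close> is \<open>DZ/Z\<close>. The
  isomorphism \<open>\<kappa>\<close> is the canonical one: \<open>\<kappa>(a Z(A))\<close> induces on \<open>G/Z\<close> the conjugation by \<open>a\<close>.\<close>

definition AM_extensions ::
  "(complex \<Rightarrow> 'k::field) \<Rightarrow> ('a, 'b) monoid_scheme \<Rightarrow> 'a set \<Rightarrow> 'a set \<Rightarrow>
     ('a \<Rightarrow> complex) \<Rightarrow> ('a \<Rightarrow> complex) \<Rightarrow> bool" where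
  "AM_extensions star G D M \<chi> \<chi>' \<longleftrightarrow>
     (\<exists>(A :: nat monoid) i \<kappa> \<chi>t \<chi>t'.
        let Z = char_kernel G \<chi> \<inter> center G;
            e = (\<lambda>g. i (Z #>\<^bsub>G\<^esub> g));
            Gb = e ` carrier G;
            Mb = e ` M;
            Db = e ` D;
            N = Mb <#>\<^bsub>A\<^esub> normalizer A Db
        in
          group A \<and> finite (carrier A) \<and>
          i \<in> mon (G Mod Z) A \<and> Gb \<lhd> A \<and> centralizer A Gb = center A \<and>
          \<kappa> \<in> iso (A Mod center A) (AutoGroup G\<lparr>carrier := Aut_char G \<chi>\<rparr>) \<and>
          (\<forall>a\<in>carrier A. \<forall>g\<in>carrier G.
             e (\<kappa> (center A #>\<^bsub>A\<^esub> a) g) = a \<otimes>\<^bsub>A\<^esub> e g \<otimes>\<^bsub>A\<^esub> inv\<^bsub>A\<^esub> a) \<and>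
          \<chi>t \<in> Irr A \<and>
          (\<exists>\<chi>b\<in>Irr (A\<lparr>carrier := Gb\<rparr>).
             (\<forall>g\<in>carrier G. \<chi>b (e g) = \<chi> g) \<and> restrict \<chi>t Gb = \<chi>b) \<and>
          \<chi>t' \<in> Irr (A\<lparr>carrier := N\<rparr>) \<and>
          (\<exists>\<chi>b'\<in>Irr (A\<lparr>carrier := Mb\<rparr>).
             (\<forall>g\<in>M. \<chi>b' (e g) = \<chi>' g) \<and> restrict \<chi>t' Mb = \<chi>b') \<and>
          (\<forall>J. subgroup J A \<and> Gb \<subseteq> J \<longrightarrow>
             (let NJ = Mb <#>\<^bsub>A\<^esub> normalizer (A\<lparr>carrier := J\<rparr>) Db in
                is_induced_block star (A\<lparr>carrier := J\<rparr>) NJ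
                  (bl star (A\<lparr>carrier := NJ\<rparr>) (restrict \<chi>t' NJ))
                  (bl star (A\<lparr>carrier := J\<rparr>) (restrict \<chi>t J)))) \<and>
          Irr_under A (center A) \<chi>t = Irr_under (A\<lparr>carrier := N\<rparr>) (center A) \<chi>t')"

definition relative_inductive_AM ::
  "(complex \<Rightarrow> 'k::field) \<Rightarrow> nat \<Rightarrow> ('a, 'b) monoid_scheme \<Rightarrow> 'a set \<Rightarrow> bool" where
  "relative_inductive_AM star l G D \<longleftrightarrow>
     (\<exists>M \<Omega>. AM_subgroup G D M \<and> AM_bijection star l G D M \<Omega> \<and>
        (\<forall>\<chi>\<in>Irr0 star l G D. AM_extensions star G D M \<chi> (\<Omega> \<chi>)))"

definition AM_epsilon ::
  "nat \<Rightarrow> ('a, 'b) monoid_scheme \<Rightarrow> 'a set \<Rightarrow> ('a \<Rightarrow> complex) \<Rightarrow> ('a \<Rightarrow> complex) \<Rightarrow> nat" where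
  "AM_epsilon l G M \<chi> \<chi>' = (THE \<epsilon>. \<epsilon> \<in> {1..l - 1} \<and>
     (\<epsilon> * l'_part l (char_degree G \<chi>)) mod l =
     (l'_part l (group_index G M) * l'_part l (char_degree (G\<lparr>carrier := M\<rparr>) \<chi>')) mod l)"

text \<open>\<open>H/Z(G)\<close>, for a subgroup \<open>H\<close> of \<open>G\<close> containing \<open>Z(G)\<close>, is identified with
  \<^term>\<open>inner G ` H\<close>; in particular \<open>S\<close> is \<^term>\<open>inner G ` carrier G\<close>, and a \<open>Z(G)\<close>-section is
  a right inverse of \<^term>\<open>inner G\<close> there.\<close>

definition center_section :: "('a, 'b) monoid_scheme \<Rightarrow> (('a \<Rightarrow> 'a) \<Rightarrow> 'a) \<Rightarrow> bool" where
  "center_section G rep \<longleftrightarrow>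
     (\<forall>s\<in>inner G ` carrier G. rep s \<in> carrier G \<and> inner G (rep s) = s) \<and>
     rep \<one>\<^bsub>AutoGroup G\<^esub> = \<one>\<^bsub>G\<^esub>"

definition obtained_using ::
  "('a, 'b) monoid_scheme \<Rightarrow> 'a set \<Rightarrow> ('a \<Rightarrow> complex) \<Rightarrow> (('a \<Rightarrow> 'a) \<Rightarrow> 'a) \<Rightarrow> nat \<Rightarrow>
     (('a \<Rightarrow> 'a) \<Rightarrow> complex mat) \<Rightarrow> bool" where
  "obtained_using G H \<chi> rep n P \<longleftrightarrow>
     (\<exists>\<rho>. \<rho> \<in> hom (G\<lparr>carrier := H\<rparr>) (GL n) \<and> affords (G\<lparr>carrier := H\<rparr>) \<rho> \<chi> \<and>
          (\<forall>s\<in>inner G ` H. P s = \<rho> (rep s)))"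

text \<open>The equation between reductions includes that both traces lie in the valuation ring \<open>R\<close>, the
  domain of the reduction map.\<close>

definition AM_projective ::
  "complex set \<Rightarrow> (complex \<Rightarrow> 'k::field) \<Rightarrow> nat \<Rightarrow> ('a, 'b) monoid_scheme \<Rightarrow> 'a set \<Rightarrow> 'a set \<Rightarrow>
     ('a \<Rightarrow> complex) \<Rightarrow> ('a \<Rightarrow> complex) \<Rightarrow> bool" where
  "AM_projective R star l G D M \<chi> \<chi>' \<longleftrightarrow>
     (let Q = AutoGroup G\<lparr>carrier := Aut_char G \<chi>\<rparr>;
          Q' = AutoGroup G\<lparr>carrier :=
                (inner G ` M) <#>\<^bsub>AutoGroup G\<^esub> (Aut_set G D \<inter> Aut_char G \<chi>)\<rparr>
      in \<exists>rep n n' P P' \<alpha> \<alpha>'.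
          center_section G rep \<and>
          projective_rep Q n P \<alpha> \<and> projective_rep Q' n' P' \<alpha>' \<and>
          obtained_using G (carrier G) \<chi> rep n P \<and>
          obtained_using G M \<chi>' rep n' P' \<and>
          (\<forall>x\<in>carrier Q'. \<forall>y\<in>carrier Q'. \<alpha> x y = \<alpha>' x y) \<and>
          (\<forall>x. l_regular l Q' x \<and>
               sylow_subgroup l
                 (AutoGroup G\<lparr>carrier := {s \<in> inner G ` carrier G.
                    s \<otimes>\<^bsub>AutoGroup G\<^esub> x = x \<otimes>\<^bsub>AutoGroup G\<^esub> s}\<rparr>)
                 (inner G ` (D <#>\<^bsub>G\<^esub> center G)) \<longrightarrow>
             mat_trace (P x) \<in> R \<and> mat_trace (P' x) \<in> R \<and>
             star (of_nat (AM_epsilon l G M \<chi> \<chi>')) * star (mat_trace (P x)) =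
               star (mat_trace (P' x))))"

definition inductive_AM_projective ::
  "complex set \<Rightarrow> (complex \<Rightarrow> 'k::field) \<Rightarrow> nat \<Rightarrow> ('a, 'b) monoid_scheme \<Rightarrow> bool" where
  "inductive_AM_projective R star l G \<longleftrightarrow>
     (\<forall>D. noncentral_radical l G D \<longrightarrow>
        (\<exists>M \<Omega>. AM_subgroup G D M \<and> AM_bijection star l G D M \<Omega> \<and>
           (\<forall>\<chi>\<in>Irr0 star l G D. AM_projective R star l G D M \<chi> (\<Omega> \<chi>))))"

end

theory Submission
  imports Defs "Jordan_Normal_Form.Schur_Decomposition"
begin

text \<open>The extensions \<open>\<chi>t\<close> and \<open>\<chi>t'\<close>, afforded by \<open>\<rho>\<close> and \<open>\<rho>'\<close>, give projective representations of
  quotients of \<open>A\<close> by \<open>Z(A)\<close> along a common section; \<open>Aut(G)\<^sub>\<chi>\<close> is \<open>A/Z(A)\<close>, and a preimage of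
  \<open>x\<close> is chosen compatibly with a section of \<open>G\<close> over its inner automorphisms, which is possible
  because \<open>G\<close> is perfect. The factor sets agree since \<open>\<chi>t\<close> and \<open>\<chi>t'\<close> lie over the same
  character of \<open>Z(A)\<close>.

  For the congruence at \<open>x\<close>, with preimage \<open>a\<close>, the block condition is used for the single group
  \<open>J = e(G) C\<^sub>A(a)\<close>, with \<open>e\<close> the given map from \<open>G\<close> to \<open>A\<close>, in which the class \<open>C\<close> of \<open>a\<close> is a \<open>G\<close>-orbit. It equates the central
  character of \<open>\<chi>t\<close> at \<open>C\<close> with the sum of the central characters of \<open>\<chi>t'\<close> at the \<open>M\<close>-orbits
  contained in \<open>C\<close>, modulo \<open>l\<close>. As \<open>\<chi>'\<close> has height zero and defect group \<open>D\<close>, an orbit contributes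
  only if \<open>D\<close> centralizes one of its elements; since \<open>D\<close> is a Sylow subgroup of \<open>C\<^sub>G(a)\<close> and
  \<open>N\<^sub>G(D) \<subseteq> M\<close>, only the orbit of \<open>a\<close> itself remains. What is left is a comparison of degrees and
  indices, together with \<open>|C\<^sub>G(a) : C\<^sub>M(a)| \<equiv> 1\<close> modulo \<open>l\<close>.\<close>

section \<open>Prime parts of natural numbers\<close>

text \<open>Height zero and the defect group \<open>D\<close> are known only for
  \<open>\<chi>\<close> in \<open>G\<close> and for \<open>\<chi>'\<close> in \<open>M\<close>; the
  defect groups of the blocks of \<open>J\<close> and of its subgroup are not under control. The
  block condition, which speaks of conjugacy classes of these larger groups, is therefore refined to
  orbits of \<open>G\<close> and \<open>M\<close> acting by conjugation: both restrictions are
  irreducible, so by Schur's lemma an orbit sum already acts as a scalar. An orbit need not be a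
  class, so the integrality of these scalars has to be proved separately, with the absolute value
  \<nu>. Regularity of \<open>x\<close> serves to lift the Sylow hypothesis to \<open>A\<close>: the
  commutator of an element of \<open>D\<close> with \<open>a\<close> is central, and its order is
  both a power of \<open>l\<close> and prime to \<open>l\<close>. Radicality of \<open>D\<close>
  makes it recoverable from \<open>D Z(G)\<close>. The constant \<epsilon> is the residue of |G:M|
  \<chi>'(1) / \<chi>(1) after removal of the \<open>l\<close>-parts. The ratio of the two traces is
  the inverse ratio of orbit length over degree, and the orbit lengths differ by |G:M| up to an
  index congruent to 1.\<close>

lemma l_part_mult:
  assumes "Factorial_Ring.prime l" "m > 0" "n > 0"
  shows "l_part l (m * n) = l_part l m * l_part l n"
  unfolding l_part_def using assms
  by (simp add: prime_elem_multiplicity_mult_distrib power_add)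

lemma l_part_dvd: "l_part l n dvd n"
  unfolding l_part_def by (rule multiplicity_dvd)

lemma l'_part_mult_l_part: "l_part l n * l'_part l n = n"
  unfolding l'_part_def using l_part_dvd by simp

lemma not_dvd_l'_part:
  assumes "Factorial_Ring.prime l" "n > 0"
  shows "\<not> l dvd l'_part l n"
proof -
  have "\<not> is_unit l" using assms(1) by auto
  then show ?thesis using assms unfolding l'_part_def l_part_def
    by (intro multiplicity_decompose) auto
qed

lemma l_part_pos: "Factorial_Ring.prime l \<Longrightarrow> l_part l n > 0"
  unfolding l_part_def using prime_gt_0_nat by simp

lemma l_part_power: "Factorial_Ring.prime l \<Longrightarrow> l_part l (l ^ k) = l ^ k"
  unfolding l_part_def by (simp add: prime_elem_multiplicity_mult_distrib)

lemma l_part_prime_dvd_le: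
  assumes "Factorial_Ring.prime l" "l ^ k dvd n" "n > 0"
  shows "l ^ k \<le> l_part l n"
proof -
  have "k \<le> multiplicity l n"
    using assms by (intro multiplicity_geI) auto
  then show ?thesis
    unfolding l_part_def using prime_gt_1_nat[OF assms(1)] by (intro power_increasing) auto
qed

lemma l_part_eq_1: "\<not> l dvd n \<Longrightarrow> l_part l n = 1"
  unfolding l_part_def by (simp add: not_dvd_imp_multiplicity_0)

lemma l_part_eq_iff:
  assumes "Factorial_Ring.prime l"
  shows "l_part l m = l_part l n \<longleftrightarrow> multiplicity l m = multiplicity l n"
  unfolding l_part_def using prime_gt_1_nat[OF assms] by simp

lemma l'_part_mult:
  assumes "Factorial_Ring.prime l" "m > 0" "n > 0"
  shows "l'_part l (m * n) = l'_part l m * l'_part l n"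
proof -
  have "l_part l m * l_part l n * l'_part l (m * n) = m * n"
    using l'_part_mult_l_part[of l "m * n"] l_part_mult[OF assms] by simp
  also have "\<dots> = (l_part l m * l'_part l m) * (l_part l n * l'_part l n)"
    by (simp only: l'_part_mult_l_part)
  also have "\<dots> = l_part l m * l_part l n * (l'_part l m * l'_part l n)"
     by (simp add: mult_ac)
  finally show ?thesis
    using l_part_pos[OF assms(1), of m] l_part_pos[OF assms(1), of n] by simp
qed

section \<open>Reduction modulo a prime\<close>

text \<open>The witnesses \<open>K\<close> and \<open>\<nu>\<close> hidden in
  \<open>modular_reduction\<close> become parameters, so that \<open>\<nu>\<close> can be used to
  measure divisibility by \<open>l\<close>.\<close>

locale mod_red =
  fixes l :: nat and R :: "complex set" and star :: "complex \<Rightarrow> 'k::field"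
    and K :: "complex set" and \<nu> :: "complex \<Rightarrow> real"
  assumes prime_l: "Factorial_Ring.prime l" and char_k: "CHAR('k) = l"
    and K_0: "0 \<in> K" and K_1: "1 \<in> K"
    and K_add: "x \<in> K \<Longrightarrow> y \<in> K \<Longrightarrow> x + y \<in> K"
    and K_mult: "x \<in> K \<Longrightarrow> y \<in> K \<Longrightarrow> x * y \<in> K"
    and K_inverse: "x \<in> K \<Longrightarrow> inverse x \<in> K"
    and K_root: "0 < n \<Longrightarrow> x ^ n = 1 \<Longrightarrow> x \<in> K"
    and \<nu>_nonneg: "x \<in> K \<Longrightarrow> 0 \<le> \<nu> x"
    and \<nu>_eq_0: "x \<in> K \<Longrightarrow> \<nu> x = 0 \<longleftrightarrow> x = 0"
    and \<nu>_mult: "x \<in> K \<Longrightarrow> y \<in> K \<Longrightarrow> \<nu> (x * y) = \<nu> x * \<nu> y"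
    and \<nu>_add: "x \<in> K \<Longrightarrow> y \<in> K \<Longrightarrow> \<nu> (x + y) \<le> max (\<nu> x) (\<nu> y)"
    and R_eq: "R = {x \<in> K. \<nu> x \<le> 1}"
    and star_1: "star 1 = 1"
    and star_add: "x \<in> R \<Longrightarrow> y \<in> R \<Longrightarrow> star (x + y) = star x + star y"
    and star_mult: "x \<in> R \<Longrightarrow> y \<in> R \<Longrightarrow> star (x * y) = star x * star y"
    and star_eq_0: "x \<in> R \<Longrightarrow> star x = 0 \<longleftrightarrow> \<nu> x < 1"
begin

lemma \<nu>_0: "\<nu> 0 = 0" using \<nu>_eq_0 K_0 by simp

lemma \<nu>_1: "\<nu> 1 = 1"
proof -
  have "\<nu> 1 * \<nu> 1 = \<nu> 1" using \<nu>_mult[OF K_1 K_1] by simp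
  moreover have "\<nu> 1 \<noteq> 0" using \<nu>_eq_0[OF K_1] by simp
  ultimately show ?thesis by simp
qed

lemma \<nu>_power: "x \<in> K \<Longrightarrow> x ^ n \<in> K \<and> \<nu> (x ^ n) = \<nu> x ^ n"
  by (induction n) (auto simp: K_1 \<nu>_1 K_mult \<nu>_mult)

lemma \<nu>_root: assumes "0 < n" "x ^ n = 1" shows "\<nu> x = 1"
proof -
  have x: "x \<in> K" using K_root assms by blast
  have "\<nu> x ^ n = 1" using \<nu>_power[OF x, of n] assms \<nu>_1 by simp
  then show ?thesis using \<nu>_nonneg[OF x] assms(1)
    by (metis power_eq_1_iff not_gr0 real_norm_def abs_of_nonneg)
qed

lemma R_K: "x \<in> R \<Longrightarrow> x \<in> K" unfolding R_eq by simp

lemma R_root: assumes "0 < n" "x ^ n = 1" shows "x \<in> R"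
  unfolding R_eq using K_root[OF assms] \<nu>_root[OF assms] by simp

lemma R_0: "0 \<in> R" and R_1: "1 \<in> R"
  unfolding R_eq by (auto simp: K_0 K_1 \<nu>_0 \<nu>_1)

lemma R_add: "x \<in> R \<Longrightarrow> y \<in> R \<Longrightarrow> x + y \<in> R"
  unfolding R_eq using K_add \<nu>_add by fastforce

lemma R_mult: "x \<in> R \<Longrightarrow> y \<in> R \<Longrightarrow> x * y \<in> R"
  unfolding R_eq using K_mult \<nu>_mult \<nu>_nonneg by (auto intro: mult_le_one)

lemma star_0: "star 0 = 0" using star_eq_0[OF R_0] \<nu>_0 by simp

lemma R_sum: "(\<And>i. i \<in> I \<Longrightarrow> f i \<in> R) \<Longrightarrow> (\<Sum>i\<in>I. f i) \<in> R"
  by (induction I rule: infinite_finite_induct) (auto simp: R_0 R_add)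

lemma star_sum:
  "(\<And>i. i \<in> I \<Longrightarrow> f i \<in> R) \<Longrightarrow> star (\<Sum>i\<in>I. f i) = (\<Sum>i\<in>I. star (f i))"
  by (induction I rule: infinite_finite_induct) (auto simp: star_0 star_add R_sum)

lemma R_of_nat: "of_nat n \<in> R"
  by (induction n) (auto simp: R_0 R_1 R_add)

lemma K_of_nat: "of_nat n \<in> K" using R_of_nat R_K by blast

lemma \<nu>_of_nat_le: "\<nu> (of_nat n) \<le> 1" using R_of_nat R_eq by auto

lemma star_of_nat: "star (of_nat n) = of_nat n"
  by (induction n) (auto simp: star_0 star_1 star_add R_1 R_of_nat)

lemma star_of_nat_eq_0: "star (of_nat n) = 0 \<longleftrightarrow> l dvd n"
  unfolding star_of_nat using of_nat_eq_0_iff_char_dvd[where 'a='k] char_k by simp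

lemma \<nu>_of_nat_coprime: "\<not> l dvd n \<Longrightarrow> \<nu> (of_nat n) = 1"
  using star_of_nat_eq_0[of n] star_eq_0[OF R_of_nat[of n]] \<nu>_of_nat_le[of n] by auto

lemma \<nu>_l: "0 < \<nu> (of_nat l)" "\<nu> (of_nat l) < 1"
proof -
  show "\<nu> (of_nat l) < 1" using star_of_nat_eq_0[of l] star_eq_0[OF R_of_nat[of l]] by auto
  have "\<nu> (of_nat l) \<noteq> 0" using \<nu>_eq_0[OF K_of_nat] prime_l by auto
  then show "0 < \<nu> (of_nat l)" using \<nu>_nonneg[OF K_of_nat, of l] by simp
qed

text \<open>The \<open>l'\<close>-part is a unit of the valuation ring, so only the power of
  \<open>l\<close> is seen. This translates between \<open>\<nu>\<close> and
  \<open>multiplicity l\<close>.\<close>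

lemma \<nu>_of_nat:
  assumes "n > 0" shows "\<nu> (of_nat n) = \<nu> (of_nat l) ^ multiplicity l n"
proof -
  have "n = l ^ multiplicity l n * l'_part l n"
    using l'_part_mult_l_part[of l n] by (simp add: l_part_def)
  then have "\<nu> (of_nat n) = \<nu> (of_nat l ^ multiplicity l n * of_nat (l'_part l n))"
    by (metis of_nat_mult of_nat_power)
  also have "\<dots> = \<nu> (of_nat l) ^ multiplicity l n"
    using \<nu>_mult \<nu>_power K_of_nat \<nu>_of_nat_coprime not_dvd_l'_part[OF prime_l assms] by simp
  finally show ?thesis .
qed

lemma K_sum: "(\<And>i. i \<in> I \<Longrightarrow> f i \<in> K) \<Longrightarrow> (\<Sum>i\<in>I. f i) \<in> K"
  by (induction I rule: infinite_finite_induct) (auto simp: K_0 K_add)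

lemma K_divide: "x \<in> K \<Longrightarrow> y \<in> K \<Longrightarrow> x / y \<in> K"
  by (simp add: divide_inverse K_mult K_inverse)

lemma \<nu>_divide: "x \<in> K \<Longrightarrow> y \<in> K \<Longrightarrow> y \<noteq> 0 \<Longrightarrow> \<nu> (x / y) = \<nu> x / \<nu> y"
  using \<nu>_mult[OF K_divide, of x y y] \<nu>_eq_0 by (simp add: field_simps)

text \<open>The ultrametric inequality makes a finite family that is closed under multiplication up to
  integral linear combinations integral: look at a member of maximal absolute value.\<close>

lemma R_of_structure_constants:
  fixes f :: "'i \<Rightarrow> complex" and c :: "'i \<Rightarrow> 'i \<Rightarrow> nat"
  assumes fin: "finite I" and K: "\<And>i. i \<in> I \<Longrightarrow> f i \<in> K"
    and mult: "\<And>i. i \<in> I \<Longrightarrow> f i * f i = (\<Sum>j\<in>I. of_nat (c i j) * f j)"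
    and i: "i \<in> I"
  shows "f i \<in> R"
proof -
  define m where "m = Max ((\<lambda>i. \<nu> (f i)) ` I)"
  have "m \<in> (\<lambda>i. \<nu> (f i)) ` I" unfolding m_def using fin i by (intro Max_in) auto
  then obtain k where k: "k \<in> I" "\<nu> (f k) = m" by auto
  have le: "\<nu> (f j) \<le> m" if "j \<in> I" for j unfolding m_def using fin that by auto
  have m0: "0 \<le> m" using k K \<nu>_nonneg by metis
  have sum_le: "\<nu> (\<Sum>j\<in>J. of_nat (c k j) * f j) \<le> m" if "J \<subseteq> I" for J
    using finite_subset[OF that fin] that
  proof (induction J rule: finite_induct)
    case empty
    then show ?case using m0 \<nu>_0 by simp
  next
    case (insert j J)
    have 1: "of_nat (c k j) * f j \<in> K" "(\<Sum>j\<in>J. of_nat (c k j) * f j) \<in> K"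
      using insert K K_mult K_of_nat by (auto intro!: K_sum)
    have j: "f j \<in> K" "\<nu> (f j) \<le> m" using insert.prems K le by auto
    have "\<nu> (of_nat (c k j) * f j) = \<nu> (of_nat (c k j)) * \<nu> (f j)"
      using \<nu>_mult[OF K_of_nat j(1)] .
    also have "\<dots> \<le> 1 * m"
      using j \<nu>_of_nat_le \<nu>_nonneg[OF j(1)] m0 by (intro mult_mono) auto
    finally have "\<nu> (of_nat (c k j) * f j) \<le> m" by simp
    moreover have "\<nu> (\<Sum>j\<in>J. of_nat (c k j) * f j) \<le> m" using insert by blast
    ultimately show ?case using \<nu>_add[OF 1] insert.hyps by simp
  qed
  \<comment> \<open>The square of the maximal member has absolute value m^2, and as an integral
    combination of the family it is bounded by \<open>m\<close>.\<close>
  have "m * m \<le> m" using sum_le[of I] mult[OF k(1)] k \<nu>_mult[OF K K, OF k(1) k(1)] by simp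
  then have "m \<le> 1" using m0 by (cases "m = 0") (auto simp: mult_le_cancel_left2)
  then show ?thesis unfolding R_eq using le[OF i] K[OF i] by auto
qed

text \<open>The equal \<open>l\<close>-parts of \<open>c\<close> and \<open>d\<close> cancel, which
  leaves an \<open>l\<close>-adic unit in the denominator. That unit is cleared by multiplication,
  so no inverse has to be reduced.\<close>

lemma star_scaled_quotient:
  assumes m: "multiplicity l c = multiplicity l d" and c: "c > 0" and d: "d > 0" and t: "t \<in> R"
  shows "of_nat (l'_part l d) * star (of_nat c * t / of_nat d) = of_nat (l'_part l c) * star t"
proof -
  define s where "s = of_nat (l'_part l c) * t / of_nat (l'_part l d)"
  have lp: "l_part l c = l_part l d" using m by (simp add: l_part_def)
  have nz: "(of_nat (l'_part l d) :: complex) \<noteq> 0"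
    using not_dvd_l'_part[OF prime_l d] by (metis dvd_0_right of_nat_eq_0_iff)
  have "of_nat c * t / of_nat d =
      of_nat (l_part l c * l'_part l c) * t / of_nat (l_part l d * l'_part l d)"
    by (simp only: l'_part_mult_l_part)
  also have "\<dots> = s" using l_part_pos[OF prime_l, of d] lp s_def by simp
  finally have eq: "of_nat c * t / of_nat d = s" .
  have "s \<in> K" unfolding s_def using K_divide K_mult K_of_nat R_K t by blast
  moreover have "\<nu> s \<le> 1"
  proof -
    have "\<nu> (of_nat (l'_part l c) * t) \<le> 1" using R_mult[OF R_of_nat t] R_eq by simp
    then show ?thesis
      using \<nu>_of_nat_coprime[OF not_dvd_l'_part[OF prime_l d]]
        \<nu>_divide[OF K_mult[OF K_of_nat R_K[OF t]] K_of_nat nz, of "l'_part l c"] s_def by simp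
  qed
  ultimately have "s \<in> R" by (simp add: R_eq)
  then have "star (of_nat (l'_part l d) * s) = of_nat (l'_part l d) * star s"
    using star_mult R_of_nat star_of_nat by simp
  moreover have "of_nat (l'_part l d) * s = of_nat (l'_part l c) * t" using nz s_def by simp
  ultimately show ?thesis using eq star_mult[OF R_of_nat t] star_of_nat by simp
qed

end

lemma modular_reductionE:
  fixes star :: "complex \<Rightarrow> 'k::alg_closed_field"
  assumes "modular_reduction l R star" "Factorial_Ring.prime l"
  obtains K \<nu> where "mod_red l R star K \<nu>"
proof -
  have "\<exists>K \<nu>. mod_red l R star K \<nu>"
    using assms(1) unfolding modular_reduction_def
    apply (elim conjE exE)
    subgoal for K \<nu>
      by (intro exI[of _ K] exI[of _ \<nu>]) (simp add: mod_red_def assms(2), blast)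
    done
  then show thesis using that by blast
qed

section \<open>Sylow theory\<close>

text \<open>Actions in the library take values in extensional bijections, hence the restriction of
  \<open>a g\<close> to \<open>E\<close>; bijectivity comes from the action of the inverse.\<close>

lemma group_actionI:
  assumes "group G"
    and closed: "\<And>g x. g \<in> carrier G \<Longrightarrow> x \<in> E \<Longrightarrow> a g x \<in> E"
    and one: "\<And>x. x \<in> E \<Longrightarrow> a \<one>\<^bsub>G\<^esub> x = x"
    and mult: "\<And>g h x. g \<in> carrier G \<Longrightarrow> h \<in> carrier G \<Longrightarrow> x \<in> E \<Longrightarrow>
                 a (g \<otimes>\<^bsub>G\<^esub> h) x = a g (a h x)"
  shows "group_action G E (\<lambda>g. \<lambda>x\<in>E. a g x)"
proof -
  interpret group G by fact
  have bij: "(\<lambda>x\<in>E. a g x) \<in> Bij E" if g: "g \<in> carrier G" for g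
  proof -
    have "a (inv\<^bsub>G\<^esub> g) (a g x) = x \<and> a g (a (inv\<^bsub>G\<^esub> g) x) = x" if "x \<in> E" for x
      using mult[of g "inv\<^bsub>G\<^esub> g" x] mult[of "inv\<^bsub>G\<^esub> g" g x] one g that by simp
    then have "bij_betw (a g) E E"
      using closed g by (intro bij_betw_byWitness[where f' = "a (inv\<^bsub>G\<^esub> g)"]) auto
    then show ?thesis by (simp add: Bij_def bij_betw_restrict_eq)
  qed
  have "(\<lambda>g. \<lambda>x\<in>E. a g x) \<in> hom G (BijGroup E)"
  proof (rule homI)
    fix g h assume gh: "g \<in> carrier G" "h \<in> carrier G"
    have "(\<lambda>x\<in>E. a (g \<otimes>\<^bsub>G\<^esub> h) x) = compose E (\<lambda>x\<in>E. a g x) (\<lambda>x\<in>E. a h x)"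
      using gh mult closed by (auto simp: compose_def fun_eq_iff)
    then show "(\<lambda>x\<in>E. a (g \<otimes>\<^bsub>G\<^esub> h) x) =
        (\<lambda>x\<in>E. a g x) \<otimes>\<^bsub>BijGroup E\<^esub> (\<lambda>x\<in>E. a h x)"
      using bij gh by (simp add: BijGroup_def)
  qed (simp add: bij BijGroup_def)
  then show ?thesis
    unfolding group_action_def group_hom_def group_hom_axioms_def
    using group_BijGroup is_group by blast
qed

text \<open>The length of an orbit divides the order l^k, so every orbit with more than one element
  has length divisible by \<open>l\<close>.\<close>

lemma card_fixed_points_mod:
  assumes G: "group G" and l: "Factorial_Ring.prime l" and ord: "Coset.order G = l ^ k"
    and E: "finite E"
    and closed: "\<And>g x. g \<in> carrier G \<Longrightarrow> x \<in> E \<Longrightarrow> a g x \<in> E"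
    and one: "\<And>x. x \<in> E \<Longrightarrow> a \<one>\<^bsub>G\<^esub> x = x"
    and mult: "\<And>g h x. g \<in> carrier G \<Longrightarrow> h \<in> carrier G \<Longrightarrow> x \<in> E \<Longrightarrow>
                 a (g \<otimes>\<^bsub>G\<^esub> h) x = a g (a h x)"
  shows "card E mod l = card {x \<in> E. \<forall>g\<in>carrier G. a g x = x} mod l"
proof -
  define \<phi> where "\<phi> = (\<lambda>g. \<lambda>x\<in>E. a g x)"
  interpret group_action G E \<phi>
    unfolding \<phi>_def using group_actionI[of G E a, OF G closed one mult] by simp
  let ?F = "{x \<in> E. \<forall>g\<in>carrier G. a g x = x}"
  let ?O = "orbits G E \<phi>"
  have orbE: "orbit G \<phi> x = {a g x | g. g \<in> carrier G}" if "x \<in> E" for x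
    using that by (simp add: orbit_def \<phi>_def)
  have orbs: "?O = (\<lambda>x. orbit G \<phi> x) ` E" by (auto simp: orbits_def)
  have finO: "finite ?O" using E orbs by simp
  have one_in: "\<one>\<^bsub>G\<^esub> \<in> carrier G" using G by (simp add: group.is_monoid monoid.one_closed)
  have single: "orb = {x} \<and> x \<in> ?F" if "orb \<in> ?O" "card orb = 1" "x \<in> orb" for orb x
  proof -
    from that orbs obtain y where y: "y \<in> E" "orb = orbit G \<phi> y" by auto
    from that(2,3) have orb: "orb = {x}" by (metis card_1_singletonE singletonD)
    have "y \<in> orb" using y orbE[OF y(1)] one[OF y(1)] one_in by force
    then have "x = y" using orb by simp
    then show ?thesis using orb y orbE[OF y(1)] by auto
  qed
  have sing_orb: "orbit G \<phi> x = {x}" if "x \<in> ?F" for x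
    using that orbE[of x] one[of x] one_in by force
  have "card E = (\<Sum>x\<in>E. 1)" by simp
  also have "\<dots> = (\<Sum>orb\<in>?O. \<Sum>x\<in>orb. 1)" using disjoint_sum[OF E] by metis
  also have "\<dots> = (\<Sum>orb\<in>?O. card orb)" by simp
  also have "\<dots> = (\<Sum>orb\<in>{b \<in> ?O. card b = 1}. card orb) + (\<Sum>orb\<in>{b \<in> ?O. card b \<noteq> 1}. card orb)"
    using finO by (subst sum.union_disjoint[symmetric]) (auto intro!: sum.cong)
  also have "(\<Sum>orb\<in>{b \<in> ?O. card b = 1}. card orb) = card {b \<in> ?O. card b = 1}" by simp
  also have "{b \<in> ?O. card b = 1} = (\<lambda>x. {x}) ` ?F"
  proof (intro equalityI subsetI)
    fix orb assume o: "orb \<in> {b \<in> ?O. card b = 1}"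
    then obtain x where "x \<in> orb" by (force simp: card_1_singleton_iff)
    then show "orb \<in> (\<lambda>x. {x}) ` ?F" using single o by blast
  next
    fix orb assume "orb \<in> (\<lambda>x. {x}) ` ?F"
    then obtain x where x: "x \<in> ?F" "orb = {x}" by blast
    then show "orb \<in> {b \<in> ?O. card b = 1}" using sing_orb[OF x(1)] orbs by auto
  qed
  also have "card ((\<lambda>x. {x}) ` ?F) = card ?F" by (intro card_image) simp
  finally have eq: "card E = card ?F + (\<Sum>orb\<in>{b \<in> ?O. card b \<noteq> 1}. card orb)" .
  have "l dvd card orb" if "orb \<in> ?O" "card orb \<noteq> 1" for orb
  proof -
    from that orbs obtain x where x: "x \<in> E" "orb = orbit G \<phi> x" by auto
    have "card orb dvd l ^ k" using orbit_stabilizer_theorem[OF x(1)] x(2) ord by (metis dvd_triv_left)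
    then obtain i where "card orb = l ^ i" using l divides_primepow_nat by blast
    then show ?thesis using that(2) by (cases i) auto
  qed
  then have "l dvd (\<Sum>orb\<in>{b \<in> ?O. card b \<noteq> 1}. card orb)" by (intro dvd_sum) auto
  then show ?thesis using eq by (auto elim!: dvdE)
qed

text \<open>Conjugation is injective and \<open>D\<close> is finite, so mapping \<open>D\<close>
  into itself already means mapping it onto itself.\<close>

lemma (in group) normalizer_iff:
  assumes "D \<subseteq> carrier G" "finite D"
  shows "g \<in> normalizer G D \<longleftrightarrow> g \<in> carrier G \<and> (\<forall>d\<in>D. g \<otimes> d \<otimes> inv g \<in> D)"
proof -
  have im: "g <# D #> inv g = (\<lambda>d. g \<otimes> d \<otimes> inv g) ` D"
    by (auto simp: l_coset_def r_coset_def)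
  have "inj_on (\<lambda>d. g \<otimes> d \<otimes> inv g) D" if "g \<in> carrier G"
    using that assms(1) by (auto simp: inj_on_def subset_eq)
  then have "(\<lambda>d. g \<otimes> d \<otimes> inv g) ` D = D \<longleftrightarrow> (\<forall>d\<in>D. g \<otimes> d \<otimes> inv g \<in> D)" if "g \<in> carrier G"
    using endo_inj_surj[OF assms(2), of "\<lambda>d. g \<otimes> d \<otimes> inv g"] that by auto
  then show ?thesis
    unfolding normalizer_def stabilizer_def using assms im by auto
qed

context group
begin

text \<open>\<open>P\<close> acts on the cosets \<open>Q x\<close> in \<open>C\<close> through right
  multiplication by \<open>inv p\<close>, the inverse making it an action on the left. The coset of
  \<open>x\<close> is fixed exactly if \<open>x\<close> conjugates \<open>P\<close> into
  \<open>Q\<close>.\<close>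

lemma coset_fixed_points:
  assumes fin: "finite (carrier G)" and l: "Factorial_Ring.prime l"
    and C: "subgroup C G" and Q: "subgroup Q G" "Q \<subseteq> C"
    and P: "subgroup P G" "P \<subseteq> C" "card P = l ^ k"
  shows "card ((\<lambda>x. Q #> x) ` C) * card Q = card C"
    and "card ((\<lambda>x. Q #> x) ` C) mod l =
      card ((\<lambda>x. Q #> x) ` {x \<in> C. \<forall>p\<in>P. x \<otimes> p \<otimes> inv x \<in> Q}) mod l"
proof -
  interpret C: group "G\<lparr>carrier := C\<rparr>" using C subgroup.subgroup_is_group is_group by blast
  have Cc: "C \<subseteq> carrier G" "P \<subseteq> carrier G" "Q \<subseteq> carrier G" using C P Q subgroup.subset by blast+
  have QC: "subgroup Q (G\<lparr>carrier := C\<rparr>)" using C Q by (simp add: subgroup_incl)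
  have "rcosets\<^bsub>G\<lparr>carrier := C\<rparr>\<^esub> Q = (\<lambda>x. Q #> x) ` C"
    by (auto simp: RCOSETS_def r_coset_def)
  then show "card ((\<lambda>x. Q #> x) ` C) * card Q = card C"
    using C.lagrange[OF QC] by (simp add: order_def Coset.order_def)
  let ?E = "(\<lambda>x. Q #> x) ` C"
  have act: "(Q #> x) #> inv p = Q #> (x \<otimes> inv p)" if "x \<in> C" "p \<in> P" for x p
    using that Cc by (intro coset_mult_assoc) auto
  have in_C: "x \<otimes> inv p \<in> C" if "x \<in> C" "p \<in> P" for x p
    using that P C by (meson subgroup.m_closed subgroup.m_inv_closed subsetD)
  have eqf: "(Q #> x) #> inv p = Q #> x \<longleftrightarrow> x \<otimes> p \<otimes> inv x \<in> Q" if "x \<in> C" "p \<in> P" for x p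
  proof -
    have c: "x \<in> carrier G" "p \<in> carrier G" using that Cc by auto
    have "(Q #> x) #> inv p = Q #> x \<longleftrightarrow> Q #> x = Q #> (x \<otimes> inv p)"
      using act[OF that] by auto
    also have "\<dots> \<longleftrightarrow> x \<in> Q #> (x \<otimes> inv p)"
      using repr_independence[OF _ _ Q(1), of x "x \<otimes> inv p"] rcos_self[OF _ Q(1), of x] c by auto
    also have "\<dots> \<longleftrightarrow> x \<otimes> inv (x \<otimes> inv p) \<in> Q"
      using subgroup.rcos_module[OF Q(1) is_group, of "x \<otimes> inv p" x] c by simp
    also have "x \<otimes> inv (x \<otimes> inv p) = x \<otimes> p \<otimes> inv x"
      using c by (simp add: inv_mult_group m_assoc)
    finally show ?thesis .
  qed
  have "card ?E mod l = card {Y \<in> ?E. \<forall>p\<in>carrier (G\<lparr>carrier := P\<rparr>). Y #> inv p = Y} mod l"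
  proof (rule card_fixed_points_mod[where k = k])
    show "group (G\<lparr>carrier := P\<rparr>)" using P subgroup.subgroup_is_group is_group by blast
    show "Coset.order (G\<lparr>carrier := P\<rparr>) = l ^ k" using P by (simp add: Coset.order_def)
    show "finite ?E" using fin Cc finite_subset by blast
    show "Y #> inv p \<in> ?E" if "p \<in> carrier (G\<lparr>carrier := P\<rparr>)" "Y \<in> ?E" for p Y
      using that act in_C by auto
    show "Y #> inv \<one>\<^bsub>G\<lparr>carrier := P\<rparr>\<^esub> = Y" if "Y \<in> ?E" for Y
    proof -
      from that have "Y \<subseteq> carrier G" using Cc Q(1) r_coset_subset_G by blast
      then show ?thesis by (simp add: coset_mult_one)
    qed
    show "Y #> inv (p \<otimes>\<^bsub>G\<lparr>carrier := P\<rparr>\<^esub> q) = (Y #> inv q) #> inv p"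
      if "p \<in> carrier (G\<lparr>carrier := P\<rparr>)" "q \<in> carrier (G\<lparr>carrier := P\<rparr>)" "Y \<in> ?E" for p q Y
    proof -
      from that have Y: "Y \<subseteq> carrier G" using Cc Q(1) r_coset_subset_G by blast
      have pq: "p \<in> carrier G" "q \<in> carrier G" using that Cc by auto
      then have "inv (p \<otimes> q) = inv q \<otimes> inv p" by (simp add: inv_mult_group)
      then show ?thesis using coset_mult_assoc[OF Y, of "inv q" "inv p"] pq by simp
    qed
  qed fact
  also have "{Y \<in> ?E. \<forall>p\<in>carrier (G\<lparr>carrier := P\<rparr>). Y #> inv p = Y} =
      (\<lambda>x. Q #> x) ` {x \<in> C. \<forall>p\<in>P. x \<otimes> p \<otimes> inv x \<in> Q}"
    using eqf by auto
  finally show "card ?E mod l = card ((\<lambda>x. Q #> x) ` {x \<in> C. \<forall>p\<in>P. x \<otimes> p \<otimes> inv x \<in> Q}) mod l" .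
qed

lemma sylow_exists:
  assumes "finite (carrier G)" "Factorial_Ring.prime l" "subgroup C G"
  obtains P where "subgroup P G" "P \<subseteq> C" "card P = l_part l (card C)"
proof -
  interpret C: group "G\<lparr>carrier := C\<rparr>" using assms subgroup.subgroup_is_group is_group by blast
  have ord: "Coset.order (G\<lparr>carrier := C\<rparr>) = l ^ multiplicity l (card C) * l'_part l (card C)"
    using l'_part_mult_l_part[of l "card C"] by (simp add: l_part_def Coset.order_def)
  have "finite (carrier (G\<lparr>carrier := C\<rparr>))"
    using assms(1) finite_subset[OF subgroup.subset[OF assms(3)]] by simp
  from sylow_thm[OF assms(2) C.is_group ord this]
  obtain P where P: "subgroup P (G\<lparr>carrier := C\<rparr>)" "card P = l_part l (card C)"
    by (auto simp: l_part_def)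
  have "P \<subseteq> C" using subgroup.subset[OF P(1)] by simp
  moreover have "subgroup P G" using incl_subgroup[OF assms(3) P(1)] .
  ultimately show thesis using that P by blast
qed

lemma card_subgroup_pos:
  assumes "finite (carrier G)" "subgroup C G" shows "card C > 0"
  using finite_subset[OF subgroup.subset[OF assms(2)] assms(1)] subgroup.one_closed[OF assms(2)]
  by (auto simp: card_gt_0_iff)

lemma card_subgroup_dvd:
  assumes "finite (carrier G)" "subgroup P G" "subgroup C G" "P \<subseteq> C" shows "card P dvd card C"
proof -
  interpret C: group "G\<lparr>carrier := C\<rparr>" using assms subgroup.subgroup_is_group is_group by blast
  show ?thesis using C.lagrange[OF subgroup_incl[OF assms(2,3,4)]]
    by (simp add: Coset.order_def) (metis dvd_triv_right)
qed

text \<open>The number of cosets of \<open>Q\<close> in \<open>C\<close> is prime to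
  \<open>l\<close>, so the action of the \<open>l\<close>-group \<open>P\<close> on them has a fixed
  point.\<close>

lemma sylow_conj:
  assumes fin: "finite (carrier G)" and l: "Factorial_Ring.prime l"
    and C: "subgroup C G" and Q: "subgroup Q G" "Q \<subseteq> C" "card Q = l_part l (card C)"
    and P: "subgroup P G" "P \<subseteq> C" "card P = l ^ k"
  obtains x where "x \<in> C" "\<And>p. p \<in> P \<Longrightarrow> x \<otimes> p \<otimes> inv x \<in> Q"
proof -
  note cf = coset_fixed_points[OF fin l C Q(1,2) P]
  have "card ((\<lambda>x. Q #> x) ` C) = l'_part l (card C)"
  proof -
    have "card Q * card ((\<lambda>x. Q #> x) ` C) = card Q * l'_part l (card C)"
      using cf(1) Q(3) l'_part_mult_l_part[of l "card C"] by (simp add: mult.commute)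
    then show ?thesis using Q(3) l_part_pos[OF l, of "card C"] by simp
  qed
  then have "\<not> l dvd card ((\<lambda>x. Q #> x) ` C)"
    using not_dvd_l'_part[OF l card_subgroup_pos[OF fin C]] by simp
  then have "{x \<in> C. \<forall>p\<in>P. x \<otimes> p \<otimes> inv x \<in> Q} \<noteq> {}"
    using cf(2) by (metis image_empty card.empty mod_0 dvd_eq_mod_eq_0)
  then show thesis using that by blast
qed

text \<open>A form of the Frattini argument: \<open>D\<close> fixes exactly one coset of \<open>C \<inter> M\<close> in \<open>C\<close>.\<close>

lemma index_mod_of_normalizer_le:
  assumes fin: "finite (carrier G)" and l: "Factorial_Ring.prime l"
    and C: "subgroup C G" and M: "subgroup M G"
    and D: "subgroup D G" "D \<subseteq> C" "D \<subseteq> M" "card D = l_part l (card C)"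
    and N: "normalizer G D \<subseteq> M"
  obtains c where "card C = c * card (C \<inter> M)" "c mod l = 1"
proof -
  define Q where "Q = C \<inter> M"
  have Q: "subgroup Q G" "Q \<subseteq> C" unfolding Q_def using C M subgroups_Inter_pair by auto
  have DQ: "D \<subseteq> Q" using D Q_def by simp
  have l1: "l > 1" using l prime_gt_1_nat by blast
  have Dl: "card D = l ^ multiplicity l (card C)" using D(4) by (simp add: l_part_def)
  have cQ: "card D = l_part l (card Q)"
  proof (rule antisym)
    show "card D \<le> l_part l (card Q)"
      using card_subgroup_dvd[OF fin D(1) Q(1) DQ] l_part_prime_dvd_le[OF l] Dl
        card_subgroup_pos[OF fin Q(1)] by simp
    have "l_part l (card Q) dvd card C"
      using l_part_dvd card_subgroup_dvd[OF fin Q(1) C Q(2)] dvd_trans by blast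
    then show "l_part l (card Q) \<le> card D"
      using l_part_prime_dvd_le[OF l] card_subgroup_pos[OF fin C] D(4) by (metis l_part_def)
  qed
  note cf = coset_fixed_points[OF fin l C Q D(1,2) Dl]
  \<comment> \<open>If \<open>x\<close> conjugates \<open>D\<close> into \<open>Q\<close>, then some
    \<open>y\<close> in \<open>Q\<close> brings the conjugate back into \<open>D\<close>, because
    \<open>D\<close> is Sylow in \<open>Q\<close>. So \<open>y \<otimes> x\<close> normalizes
    \<open>D\<close>, lies in \<open>M\<close>, and \<open>x\<close> lies in \<open>M\<close> as
    well.\<close>
  have "{x \<in> C. \<forall>d\<in>D. x \<otimes> d \<otimes> inv x \<in> Q} = Q"
  proof (intro equalityI subsetI)
    fix x assume x: "x \<in> {x \<in> C. \<forall>d\<in>D. x \<otimes> d \<otimes> inv x \<in> Q}"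
    then have xG: "x \<in> carrier G" using C subgroup.subset by blast
    have DG: "D \<subseteq> carrier G" using D(1) subgroup.subset by blast
    have im: "x <# D #> inv x = (\<lambda>d. x \<otimes> d \<otimes> inv x) ` D"
      by (auto simp: l_coset_def r_coset_def)
    have P: "subgroup (x <# D #> inv x) G" using subgroup_conjugation_is_surj2 xG D(1) by blast
    have "inj_on (\<lambda>d. x \<otimes> d \<otimes> inv x) D" using xG DG by (auto simp: inj_on_def subset_eq)
    then have "card (x <# D #> inv x) = l ^ multiplicity l (card C)" using im Dl card_image by metis
    moreover have "x <# D #> inv x \<subseteq> Q" using x im by auto
    ultimately obtain y where y: "y \<in> Q" "\<And>p. p \<in> x <# D #> inv x \<Longrightarrow> y \<otimes> p \<otimes> inv y \<in> D"
      using sylow_conj[OF fin l Q(1) D(1) DQ cQ P] by blast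
    then have yG: "y \<in> carrier G" using Q(1) subgroup.subset by blast
    have "(y \<otimes> x) \<otimes> d \<otimes> inv (y \<otimes> x) \<in> D" if "d \<in> D" for d
    proof -
      have "d \<in> carrier G" using that DG by blast
      then have "(y \<otimes> x) \<otimes> d \<otimes> inv (y \<otimes> x) = y \<otimes> (x \<otimes> d \<otimes> inv x) \<otimes> inv y"
        using xG yG by (simp add: inv_mult_group m_assoc)
      then show ?thesis using y(2) im that by auto
    qed
    then have "y \<otimes> x \<in> normalizer G D"
      using normalizer_iff[OF DG finite_subset[OF DG fin]] xG yG by auto
    then have "y \<otimes> x \<in> M" using N by blast
    moreover have "inv y \<in> M" "x = inv y \<otimes> (y \<otimes> x)"
      using y(1) Q_def M subgroup.m_inv_closed xG yG by (auto simp: m_assoc[symmetric])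
    ultimately have "x \<in> M" using subgroup.m_closed[OF M, of "inv y" "y \<otimes> x"] by simp
    then show "x \<in> Q" using x Q_def by simp
  next
    fix x assume "x \<in> Q"
    then show "x \<in> {x \<in> C. \<forall>d\<in>D. x \<otimes> d \<otimes> inv x \<in> Q}"
      using Q DQ by (auto intro!: subgroup.m_closed subgroup.m_inv_closed)
  qed
  moreover have "(\<lambda>x. Q #> x) ` Q = {Q}"
  proof -
    have "Q #> x = Q" if "x \<in> Q" for x
      using coset_join2[OF _ Q(1) that] subgroup.mem_carrier[OF Q(1) that] .
    then show ?thesis using subgroup.one_closed[OF Q(1)] by auto
  qed
  ultimately have "card ((\<lambda>x. Q #> x) ` C) mod l = 1" using cf(2) l1 by simp
  then show thesis using that cf(1)[symmetric] unfolding Q_def by blast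
qed

end

lemma (in group) mult_inv_cancel:
  assumes "x \<in> carrier G" "y \<in> carrier G"
  shows "x \<otimes> (inv x \<otimes> y) = y" "inv x \<otimes> (x \<otimes> y) = y"
  using assms by (simp_all add: m_assoc[symmetric])

section \<open>Complex representations\<close>

lemma mat_trace_mult_comm:
  assumes "A \<in> carrier_mat n m" "B \<in> carrier_mat m n"
  shows "mat_trace (A * B) = mat_trace (B * A)"
proof -
  have "mat_trace (A * B) = (\<Sum>i<n. \<Sum>j<m. A $$ (i, j) * B $$ (j, i))"
    using assms by (auto simp: mat_trace_def scalar_prod_def intro!: sum.cong simp flip: lessThan_atLeast0)
  also have "\<dots> = (\<Sum>j<m. \<Sum>i<n. A $$ (i, j) * B $$ (j, i))" by (rule sum.swap)
  also have "\<dots> = mat_trace (B * A)"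
    using assms by (auto simp: mat_trace_def scalar_prod_def mult.commute intro!: sum.cong
        simp flip: lessThan_atLeast0)
  finally show ?thesis .
qed

lemma mult_zero_vec: "A *\<^sub>v 0\<^sub>v n = 0\<^sub>v m" if "A \<in> carrier_mat m n"
  for A :: "'a::semiring_0 mat"
  using that by (intro eq_vecI) auto

lemma mat_trace_smult: "mat_trace (c \<cdot>\<^sub>m A) = c * mat_trace A" if "A \<in> carrier_mat n n"
  using that by (auto simp: mat_trace_def sum_distrib_left)

lemma mat_trace_one: "mat_trace (1\<^sub>m n) = of_nat n"
  by (simp add: mat_trace_def)

text \<open>The size of a matrix is part of its value, so there is no size-independent zero; fixing
  \<open>n\<close> gives the empty sum a definite value.\<close>

definition mat_sum :: "nat \<Rightarrow> ('i \<Rightarrow> complex mat) \<Rightarrow> 'i set \<Rightarrow> complex mat" where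
  "mat_sum n F I = mat n n (\<lambda>(i, j). \<Sum>x\<in>I. F x $$ (i, j))"

lemma mat_sum_carrier [simp]: "mat_sum n F I \<in> carrier_mat n n"
  by (simp add: mat_sum_def)

lemma mat_sum_index: "i < n \<Longrightarrow> j < n \<Longrightarrow> mat_sum n F I $$ (i, j) = (\<Sum>x\<in>I. F x $$ (i, j))"
  by (simp add: mat_sum_def)

lemma mult_mat_sum:
  assumes "A \<in> carrier_mat n n" "\<And>x. x \<in> I \<Longrightarrow> F x \<in> carrier_mat n n"
  shows "A * mat_sum n F I = mat_sum n (\<lambda>x. A * F x) I"
proof (rule eq_matI)
  fix i j assume "i < dim_row (mat_sum n (\<lambda>x. A * F x) I)" "j < dim_col (mat_sum n (\<lambda>x. A * F x) I)"
  then have ij: "i < n" "j < n" by (auto simp: mat_sum_def)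
  have "(A * mat_sum n F I) $$ (i, j) = (\<Sum>k<n. \<Sum>x\<in>I. A $$ (i, k) * F x $$ (k, j))"
    using ij assms(1) by (auto simp: scalar_prod_def mat_sum_def sum_distrib_left
        simp flip: lessThan_atLeast0 intro!: sum.cong)
  also have "\<dots> = (\<Sum>x\<in>I. \<Sum>k<n. A $$ (i, k) * F x $$ (k, j))" by (rule sum.swap)
  also have "\<dots> = (\<Sum>x\<in>I. (A * F x) $$ (i, j))"
  proof (rule sum.cong)
    fix x assume "x \<in> I"
    note assms(2)[OF this]
    then show "(\<Sum>k<n. A $$ (i, k) * F x $$ (k, j)) = (A * F x) $$ (i, j)"
      using ij assms(1) by (auto simp: scalar_prod_def simp flip: lessThan_atLeast0)
  qed simp
  finally show "(A * mat_sum n F I) $$ (i, j) = mat_sum n (\<lambda>x. A * F x) I $$ (i, j)"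
    using ij by (simp add: mat_sum_index)
qed (use assms in \<open>auto simp: mat_sum_def\<close>)

lemma mat_sum_mult:
  assumes "A \<in> carrier_mat n n" "\<And>x. x \<in> I \<Longrightarrow> F x \<in> carrier_mat n n"
  shows "mat_sum n F I * A = mat_sum n (\<lambda>x. F x * A) I"
proof (rule eq_matI)
  fix i j assume "i < dim_row (mat_sum n (\<lambda>x. F x * A) I)" "j < dim_col (mat_sum n (\<lambda>x. F x * A) I)"
  then have ij: "i < n" "j < n" by (auto simp: mat_sum_def)
  have "(mat_sum n F I * A) $$ (i, j) = (\<Sum>k<n. \<Sum>x\<in>I. F x $$ (i, k) * A $$ (k, j))"
    using ij assms(1) by (auto simp: scalar_prod_def mat_sum_def sum_distrib_right
        simp flip: lessThan_atLeast0 intro!: sum.cong)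
  also have "\<dots> = (\<Sum>x\<in>I. \<Sum>k<n. F x $$ (i, k) * A $$ (k, j))" by (rule sum.swap)
  also have "\<dots> = (\<Sum>x\<in>I. (F x * A) $$ (i, j))"
  proof (rule sum.cong)
    fix x assume "x \<in> I"
    note assms(2)[OF this]
    then show "(\<Sum>k<n. F x $$ (i, k) * A $$ (k, j)) = (F x * A) $$ (i, j)"
      using ij assms(1) by (auto simp: scalar_prod_def simp flip: lessThan_atLeast0)
  qed simp
  finally show "(mat_sum n F I * A) $$ (i, j) = mat_sum n (\<lambda>x. F x * A) I $$ (i, j)"
    using ij by (simp add: mat_sum_index)
qed (use assms in \<open>auto simp: mat_sum_def\<close>)

lemma mat_trace_mat_sum:
  assumes "\<And>x. x \<in> I \<Longrightarrow> F x \<in> carrier_mat n n"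
  shows "mat_trace (mat_sum n F I) = (\<Sum>x\<in>I. mat_trace (F x))"
proof -
  have "mat_trace (mat_sum n F I) = (\<Sum>i<n. \<Sum>x\<in>I. F x $$ (i, i))"
    by (simp add: mat_trace_def mat_sum_def)
  also have "\<dots> = (\<Sum>x\<in>I. \<Sum>i<n. F x $$ (i, i))" by (rule sum.swap)
  also have "\<dots> = (\<Sum>x\<in>I. mat_trace (F x))"
    using assms by (intro sum.cong) (auto simp: mat_trace_def)
  finally show ?thesis .
qed

lemma mat_sum_cong: "(\<And>x. x \<in> I \<Longrightarrow> F x = F' x) \<Longrightarrow> mat_sum n F I = mat_sum n F' I"
  by (auto simp: mat_sum_def intro!: cong_mat sum.cong)

lemma mat_sum_reindex:
  "bij_betw f I I' \<Longrightarrow> mat_sum n F I' = mat_sum n (\<lambda>x. F (f x)) I"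
  unfolding mat_sum_def by (intro cong_mat) (auto intro: sum.reindex_bij_betw[symmetric])

section \<open>Matrix representations of groups\<close>

lemma GL_simps:
  "A \<in> carrier (GL n) \<longleftrightarrow> A \<in> carrier_mat n n \<and> (\<exists>B\<in>carrier_mat n n. A * B = 1\<^sub>m n \<and> B * A = 1\<^sub>m n)"
  "A \<otimes>\<^bsub>GL n\<^esub> B = A * B" "\<one>\<^bsub>GL n\<^esub> = 1\<^sub>m n"
  by (auto simp: GL_def units_of_def Units_def ring_mat_def)

lemma group_GL: "group (GL n)"
  unfolding GL_def by (rule monoid.units_group[OF ring.axioms(2)[OF ring_mat]])

lemma GL_I:
  assumes "A \<in> carrier_mat n n" "B \<in> carrier_mat n n" "A * B = 1\<^sub>m n" "B * A = 1\<^sub>m n"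
  shows "A \<in> carrier (GL n)"
  using assms unfolding GL_simps by blast

locale representation = group H for H :: "('a, 'b) monoid_scheme" (structure) +
  fixes n :: nat and \<rho> :: "'a \<Rightarrow> complex mat"
  assumes rep_hom: "\<rho> \<in> hom H (GL n)" and rep_dim: "0 < n"
begin

lemma rep_carrier: "x \<in> carrier H \<Longrightarrow> \<rho> x \<in> carrier_mat n n"
  using rep_hom GL_simps(1) by (auto simp: hom_def)

lemma rep_mult: "x \<in> carrier H \<Longrightarrow> y \<in> carrier H \<Longrightarrow> \<rho> (x \<otimes> y) = \<rho> x * \<rho> y"
  using rep_hom by (simp add: hom_def GL_simps(2))

lemma rep_one: "\<rho> \<one> = 1\<^sub>m n"
  using hom_one[OF rep_hom is_group group_GL] GL_simps(3) by metis

lemma rep_pow: "x \<in> carrier H \<Longrightarrow> \<rho> (x [^] k) = \<rho> x ^\<^sub>m k"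
  using rep_carrier by (induction k) (auto simp: rep_one rep_mult nat_pow_Suc)

lemma trace_one: "mat_trace (\<rho> \<one>) = of_nat n"
  by (simp add: rep_one mat_trace_one)

lemma trace_conj:
  assumes "x \<in> carrier H" "y \<in> carrier H"
  shows "mat_trace (\<rho> (x \<otimes> y \<otimes> inv x)) = mat_trace (\<rho> y)"
proof -
  have "mat_trace (\<rho> (x \<otimes> y \<otimes> inv x)) = mat_trace (\<rho> (inv x) * \<rho> (x \<otimes> y))"
    using rep_mult[of "x \<otimes> y" "inv x"] mat_trace_mult_comm[OF rep_carrier rep_carrier] assms by simp
  also have "\<rho> (inv x) * \<rho> (x \<otimes> y) = \<rho> (inv x \<otimes> (x \<otimes> y))"
    using rep_mult[of "inv x" "x \<otimes> y"] assms by simp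
  also have "inv x \<otimes> (x \<otimes> y) = y" using assms by (simp add: m_assoc[symmetric])
  finally show ?thesis .
qed

lemma irreducible_rep_iff:
  "irreducible_rep H n \<rho> \<longleftrightarrow>
     (\<forall>W. invariant_subspace H n \<rho> W \<longrightarrow> W = {0\<^sub>v n} \<or> W = carrier_vec n)"
  using rep_hom rep_dim by (simp add: irreducible_rep_def)

end

section \<open>Schur's lemma and irreducibility\<close>

lemma irreducible_imp_representation:
  "group H \<Longrightarrow> irreducible_rep H n \<rho> \<Longrightarrow> representation H n \<rho>"
  by (simp add: representation_def representation_axioms_def irreducible_rep_def)

text \<open>A complex matrix of positive size has an eigenvalue \<open>c\<close>. The eigenspace is
  invariant because \<open>B\<close> commutes with \<rho>, and it is nonzero, hence it is the whole
  space.\<close>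

lemma schur_scalar:
  assumes H: "group H" and irr: "irreducible_rep H n \<rho>"
    and B: "B \<in> carrier_mat n n" and comm: "\<And>h. h \<in> carrier H \<Longrightarrow> \<rho> h * B = B * \<rho> h"
  obtains c where "B = c \<cdot>\<^sub>m 1\<^sub>m n"
proof -
  interpret representation H n \<rho> using irreducible_imp_representation[OF H irr] .
  from char_poly_factorized[OF B] obtain es
    where es: "char_poly B = (\<Prod>a\<leftarrow>es. [:- a, 1:])" "length es = n" by blast
  then obtain c where "c \<in> set es" using rep_dim by (cases es) auto
  then have "poly (char_poly B) c = 0" unfolding es(1) by (rule linear_poly_root)
  then have "eigenvalue B c" using eigenvalue_root_char_poly[OF B] by simp
  then obtain v where v: "v \<in> carrier_vec n" "v \<noteq> 0\<^sub>v n" "B *\<^sub>v v = c \<cdot>\<^sub>v v"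
    using B unfolding eigenvalue_def eigenvector_def by auto
  define W where "W = {w \<in> carrier_vec n. B *\<^sub>v w = c \<cdot>\<^sub>v w}"
  have "invariant_subspace H n \<rho> W"
    unfolding invariant_subspace_def
  proof (intro conjI ballI allI)
    fix u w assume "u \<in> W" "w \<in> W"
    then show "u + w \<in> W" using B
      by (auto simp: W_def mult_add_distrib_mat_vec smult_add_distrib_vec)
  next
    fix a u assume "u \<in> W"
    then show "a \<cdot>\<^sub>v u \<in> W" using B
      by (auto simp: W_def mult_mat_vec smult_smult_assoc mult.commute)
  next
    fix h u assume h: "h \<in> carrier H" and u: "u \<in> W"
    note r = rep_carrier[OF h]
    have "B *\<^sub>v (\<rho> h *\<^sub>v u) = (\<rho> h * B) *\<^sub>v u"
      using assoc_mult_mat_vec[OF B r, of u] u comm[OF h] by (simp add: W_def)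
    also have "\<dots> = \<rho> h *\<^sub>v (c \<cdot>\<^sub>v u)"
      using assoc_mult_mat_vec[OF r B, of u] u by (simp add: W_def)
    also have "\<dots> = c \<cdot>\<^sub>v (\<rho> h *\<^sub>v u)" using mult_mat_vec[OF r, of u c] u by (simp add: W_def)
    finally show "\<rho> h *\<^sub>v u \<in> W" using r u by (simp add: W_def)
  qed (use B in \<open>auto simp: W_def\<close>)
  moreover have "v \<in> W" "v \<notin> {0\<^sub>v n}" using v by (auto simp: W_def)
  ultimately have W: "W = carrier_vec n" using irr unfolding irreducible_rep_def by blast
  have "B = c \<cdot>\<^sub>m 1\<^sub>m n"
  proof (rule eq_matI)
    fix i j assume "i < dim_row (c \<cdot>\<^sub>m 1\<^sub>m n)" "j < dim_col (c \<cdot>\<^sub>m 1\<^sub>m n)"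
    then have ij: "i < n" "j < n" by auto
    have "unit_vec n j \<in> W" using W by simp
    then have "(B *\<^sub>v unit_vec n j) $ i = (c \<cdot>\<^sub>v unit_vec n j) $ i" by (simp add: W_def)
    then show "B $$ (i, j) = (c \<cdot>\<^sub>m 1\<^sub>m n) $$ (i, j)"
      using ij B by (auto simp: scalar_prod_right_unit[of _ n])
  qed (use B in auto)
  then show thesis by (rule that)
qed

text \<open>A subspace invariant under \<open>H\<close> is invariant under \<open>Y\<close> acting
  through \<open>e\<close>, so irreducibility passes from the pullback up to
  \<open>H\<close>.\<close>

lemma irreducible_rep_pullback:
  assumes "group H" "e \<in> hom Y H" "\<rho> \<in> hom H (GL n)" "irreducible_rep Y n (\<lambda>x. \<rho> (e x))"
  shows "irreducible_rep H n \<rho>"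
proof -
  have "invariant_subspace Y n (\<lambda>x. \<rho> (e x)) W" if "invariant_subspace H n \<rho> W" for W
    using that assms(2) by (auto simp: invariant_subspace_def hom_def)
  then show ?thesis using assms unfolding irreducible_rep_def by blast
qed

lemma IrrE:
  assumes "\<chi> \<in> Irr H"
  obtains n \<rho> where "irreducible_rep H n \<rho>" "\<And>x. x \<in> carrier H \<Longrightarrow> \<chi> x = mat_trace (\<rho> x)"
    "\<chi> = (\<lambda>x\<in>carrier H. mat_trace (\<rho> x))"
  using assms unfolding Irr_def affords_def by auto

lemma char_degree_eq:
  assumes "\<chi> \<one>\<^bsub>H\<^esub> = of_nat n" shows "char_degree H \<chi> = n"
  unfolding char_degree_def using assms by (intro the_equality) auto

context
  fixes Y :: "('x, 'c) monoid_scheme" and H :: "('a, 'b) monoid_scheme"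
    and e :: "'x \<Rightarrow> 'a" and n :: nat and \<rho> :: "'a \<Rightarrow> complex mat"
  assumes Y: "group Y" and H: "group H" and e: "e \<in> hom Y H"
    and rho: "\<rho> \<in> hom H (GL n)" and irr: "irreducible_rep Y n (\<lambda>x. \<rho> (e x))"
begin

text \<open>By Schur's lemma the sum of \<open>\<rho>\<close> over a set invariant under the conjugation by \<open>e ` Y\<close>
  is a scalar.\<close>

lemma invariant_sum_trace:
  assumes U: "U \<subseteq> carrier H"
    and inv: "\<And>m u. m \<in> carrier Y \<Longrightarrow> u \<in> U \<Longrightarrow> e m \<otimes>\<^bsub>H\<^esub> u \<otimes>\<^bsub>H\<^esub> inv\<^bsub>H\<^esub> e m \<in> U"
    and g: "g \<in> carrier H"
  shows "(\<Sum>u\<in>U. mat_trace (\<rho> (g \<otimes>\<^bsub>H\<^esub> u))) =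
    mat_trace (\<rho> g) * ((\<Sum>u\<in>U. mat_trace (\<rho> u)) / of_nat n)"
proof -
  interpret H: representation H n \<rho>
    using H rho irr by (simp add: representation_def representation_axioms_def irreducible_rep_def)
  interpret Y: group Y by fact
  interpret e: group_hom Y H e using Y H e by (simp add: group_hom_def group_hom_axioms_def)
  define B where "B = mat_sum n \<rho> U"
  have B: "B \<in> carrier_mat n n" by (simp add: B_def)
  have rU: "\<rho> u \<in> carrier_mat n n" if "u \<in> U" for u using that U H.rep_carrier by blast
  have "\<rho> (e m) * B = B * \<rho> (e m)" if m: "m \<in> carrier Y" for m
  proof -
    have em: "e m \<in> carrier H" using m by simp
    have uH: "u \<in> carrier H" if "u \<in> U" for u using that U by blast
    have conj2: "e m \<otimes>\<^bsub>H\<^esub> (inv\<^bsub>H\<^esub> e m \<otimes>\<^bsub>H\<^esub> u \<otimes>\<^bsub>H\<^esub> e m) \<otimes>\<^bsub>H\<^esub> inv\<^bsub>H\<^esub> e m = u"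
      "inv\<^bsub>H\<^esub> e m \<otimes>\<^bsub>H\<^esub> (e m \<otimes>\<^bsub>H\<^esub> u \<otimes>\<^bsub>H\<^esub> inv\<^bsub>H\<^esub> e m) \<otimes>\<^bsub>H\<^esub> e m = u" if "u \<in> U" for u
      using em uH[OF that] by (simp_all add: H.m_assoc H.mult_inv_cancel)
    have inv': "inv\<^bsub>H\<^esub> e m \<otimes>\<^bsub>H\<^esub> u \<otimes>\<^bsub>H\<^esub> e m \<in> U" if "u \<in> U" for u
      using inv[of "inv\<^bsub>Y\<^esub> m" u] that m by simp
    have bij: "bij_betw (\<lambda>u. e m \<otimes>\<^bsub>H\<^esub> u \<otimes>\<^bsub>H\<^esub> inv\<^bsub>H\<^esub> e m) U U"
      using inv[OF m] inv' conj2
      by (intro bij_betw_byWitness[where f' = "\<lambda>u. inv\<^bsub>H\<^esub> e m \<otimes>\<^bsub>H\<^esub> u \<otimes>\<^bsub>H\<^esub> e m"]) auto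
    have "B * \<rho> (e m) = mat_sum n (\<lambda>u. \<rho> u * \<rho> (e m)) U"
      unfolding B_def by (rule mat_sum_mult[OF H.rep_carrier[OF em] rU])
    also have "\<dots> = mat_sum n (\<lambda>u. \<rho> (e m \<otimes>\<^bsub>H\<^esub> u \<otimes>\<^bsub>H\<^esub> inv\<^bsub>H\<^esub> e m) * \<rho> (e m)) U"
      using mat_sum_reindex[OF bij] .
    also have "\<dots> = mat_sum n (\<lambda>u. \<rho> (e m) * \<rho> u) U"
    proof (rule mat_sum_cong)
      fix u assume "u \<in> U"
      then have u: "u \<in> carrier H" using U by blast
      have "\<rho> (e m \<otimes>\<^bsub>H\<^esub> u \<otimes>\<^bsub>H\<^esub> inv\<^bsub>H\<^esub> e m) * \<rho> (e m) =
          \<rho> (e m \<otimes>\<^bsub>H\<^esub> u \<otimes>\<^bsub>H\<^esub> inv\<^bsub>H\<^esub> e m \<otimes>\<^bsub>H\<^esub> e m)"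
        using em u H.rep_mult[of "e m \<otimes>\<^bsub>H\<^esub> u \<otimes>\<^bsub>H\<^esub> inv\<^bsub>H\<^esub> e m" "e m"] by simp
      also have "e m \<otimes>\<^bsub>H\<^esub> u \<otimes>\<^bsub>H\<^esub> inv\<^bsub>H\<^esub> e m \<otimes>\<^bsub>H\<^esub> e m = e m \<otimes>\<^bsub>H\<^esub> u"
        using em u by (simp add: H.m_assoc)
      finally show "\<rho> (e m \<otimes>\<^bsub>H\<^esub> u \<otimes>\<^bsub>H\<^esub> inv\<^bsub>H\<^esub> e m) * \<rho> (e m) = \<rho> (e m) * \<rho> u"
        using em u H.rep_mult by simp
    qed
    also have "\<dots> = \<rho> (e m) * B"
      unfolding B_def by (rule mult_mat_sum[OF H.rep_carrier[OF em] rU, symmetric])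
    finally show ?thesis by simp
  qed
  from schur_scalar[OF Y irr B this] obtain c where c: "B = c \<cdot>\<^sub>m 1\<^sub>m n" .
  have "c * of_nat n = mat_trace B"
    unfolding c using mat_trace_smult[of "1\<^sub>m n" n c] by (simp add: mat_trace_one)
  also have "\<dots> = (\<Sum>u\<in>U. mat_trace (\<rho> u))" unfolding B_def using rU by (rule mat_trace_mat_sum)
  finally have c_eq: "c = (\<Sum>u\<in>U. mat_trace (\<rho> u)) / of_nat n"
    using H.rep_dim by (simp add: field_simps)
  note rg = H.rep_carrier[OF g]
  have "(\<Sum>u\<in>U. mat_trace (\<rho> (g \<otimes>\<^bsub>H\<^esub> u))) = (\<Sum>u\<in>U. mat_trace (\<rho> g * \<rho> u))"
    using U g H.rep_mult by (intro sum.cong) auto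
  also have "\<dots> = mat_trace (mat_sum n (\<lambda>u. \<rho> g * \<rho> u) U)"
    using rg rU by (intro mat_trace_mat_sum[symmetric]) auto
  also have "mat_sum n (\<lambda>u. \<rho> g * \<rho> u) U = \<rho> g * B"
    unfolding B_def by (rule mult_mat_sum[OF rg rU, symmetric])
  also have "\<rho> g * B = c \<cdot>\<^sub>m \<rho> g" unfolding c using rg mult_smult_distrib[OF rg one_carrier_mat, of c] by simp
  also have "mat_trace \<dots> = c * mat_trace (\<rho> g)" using mat_trace_smult[OF rg] .
  finally show ?thesis by (simp add: c_eq)
qed

end

section \<open>Orthogonality relations and equality of traces\<close>

lemma mult_elementary_mult_index:
  fixes A B :: "complex mat"
  assumes "A \<in> carrier_mat n n" "B \<in> carrier_mat n n" "i < n" "j < n"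
  shows "(A * mat n n (\<lambda>(a, b). if a = i \<and> b = j then 1 else 0) * B) $$ (i, j) =
    A $$ (i, i) * B $$ (j, j)"
proof -
  define E where "E = mat n n (\<lambda>(a, b). if a = i \<and> b = j then 1 else (0::complex))"
  have E: "E \<in> carrier_mat n n" by (simp add: E_def)
  have AE: "(A * E) $$ (i, b) = (if b = j then A $$ (i, i) else 0)" if "b < n" for b
  proof -
    have "(A * E) $$ (i, b) = (\<Sum>k<n. A $$ (i, k) * E $$ (k, b))"
      using assms that E by (auto simp: scalar_prod_def simp flip: lessThan_atLeast0)
    also have "\<dots> = (\<Sum>k<n. if k = i then (if b = j then A $$ (i, i) else 0) else 0)"
      using that assms by (intro sum.cong) (auto simp: E_def)
    finally show ?thesis using assms by simp
  qed
  have "A * E \<in> carrier_mat n n" using assms E by simp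
  then have "(A * E * B) $$ (i, j) = (\<Sum>k<n. (A * E) $$ (i, k) * B $$ (k, j))"
    using assms by (auto simp: scalar_prod_def simp flip: lessThan_atLeast0)
  also have "\<dots> = (\<Sum>k<n. if k = j then A $$ (i, i) * B $$ (j, j) else 0)"
    using AE by (intro sum.cong) auto
  finally show ?thesis using assms by (simp add: E_def)
qed

text \<open>Averaging an arbitrary matrix over the group produces an intertwiner; the substitution
  of \<open>h g\<close> for \<open>g\<close> absorbs the factor.\<close>

lemma intertwiner_mat_sum:
  assumes "representation H n \<sigma>" "representation H n \<rho>" "finite (carrier H)"
    and M: "M \<in> carrier_mat n n" and h: "h \<in> carrier H"
  defines "T \<equiv> mat_sum n (\<lambda>g. \<sigma> g * M * \<rho> (inv\<^bsub>H\<^esub> g)) (carrier H)"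
  shows "\<sigma> h * T = T * \<rho> h"
proof -
  interpret s: representation H n \<sigma> by fact
  interpret r: representation H n \<rho> by fact
  have c: "\<sigma> g * M * \<rho> (inv\<^bsub>H\<^esub> g) \<in> carrier_mat n n" if "g \<in> carrier H" for g
    using that s.rep_carrier r.rep_carrier M by (auto intro!: mult_carrier_mat)
  have bij: "bij_betw (\<lambda>g. h \<otimes>\<^bsub>H\<^esub> g) (carrier H) (carrier H)"
    using h by (intro bij_betw_byWitness[where f' = "\<lambda>g. inv\<^bsub>H\<^esub> h \<otimes>\<^bsub>H\<^esub> g"])
      (auto simp: s.m_assoc[symmetric])
  have "T * \<rho> h = mat_sum n (\<lambda>g. \<sigma> g * M * \<rho> (inv\<^bsub>H\<^esub> g) * \<rho> h) (carrier H)"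
    unfolding T_def using c r.rep_carrier[OF h] by (rule mat_sum_mult[rotated])
  also have "\<dots> = mat_sum n (\<lambda>g. \<sigma> (h \<otimes>\<^bsub>H\<^esub> g) * M * \<rho> (inv\<^bsub>H\<^esub> (h \<otimes>\<^bsub>H\<^esub> g)) * \<rho> h) (carrier H)"
    using mat_sum_reindex[OF bij] .
  also have "\<dots> = mat_sum n (\<lambda>g. \<sigma> h * (\<sigma> g * M * \<rho> (inv\<^bsub>H\<^esub> g))) (carrier H)"
  proof (rule mat_sum_cong)
    fix g assume g: "g \<in> carrier H"
    note cs = s.rep_carrier[OF h] s.rep_carrier[OF g] r.rep_carrier[OF h] M
      r.rep_carrier[OF s.inv_closed[OF h]] r.rep_carrier[OF s.inv_closed[OF g]]
    have "\<rho> (inv\<^bsub>H\<^esub> (h \<otimes>\<^bsub>H\<^esub> g)) * \<rho> h = \<rho> (inv\<^bsub>H\<^esub> (h \<otimes>\<^bsub>H\<^esub> g) \<otimes>\<^bsub>H\<^esub> h)"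
      using g h r.rep_mult by simp
    also have "inv\<^bsub>H\<^esub> (h \<otimes>\<^bsub>H\<^esub> g) \<otimes>\<^bsub>H\<^esub> h = inv\<^bsub>H\<^esub> g"
      using g h by (simp add: s.inv_mult_group s.m_assoc)
    finally have e: "\<rho> (inv\<^bsub>H\<^esub> (h \<otimes>\<^bsub>H\<^esub> g)) * \<rho> h = \<rho> (inv\<^bsub>H\<^esub> g)" .
    have "\<sigma> (h \<otimes>\<^bsub>H\<^esub> g) * M * \<rho> (inv\<^bsub>H\<^esub> (h \<otimes>\<^bsub>H\<^esub> g)) * \<rho> h =
        \<sigma> (h \<otimes>\<^bsub>H\<^esub> g) * M * (\<rho> (inv\<^bsub>H\<^esub> (h \<otimes>\<^bsub>H\<^esub> g)) * \<rho> h)"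
      using g h s.rep_carrier r.rep_carrier M
      by (intro assoc_mult_mat[of _ n n _ n _ n]) (auto intro!: mult_carrier_mat)
    also have "\<dots> = \<sigma> h * \<sigma> g * M * \<rho> (inv\<^bsub>H\<^esub> g)" using e s.rep_mult[OF h g] by metis
    also have "\<dots> = \<sigma> h * (\<sigma> g * M * \<rho> (inv\<^bsub>H\<^esub> g))"
      using cs assoc_mult_mat[of "\<sigma> h" n n "\<sigma> g" n M n]
        assoc_mult_mat[of "\<sigma> h" n n "\<sigma> g * M" n "\<rho> (inv\<^bsub>H\<^esub> g)" n] by simp
    finally show "\<sigma> (h \<otimes>\<^bsub>H\<^esub> g) * M * \<rho> (inv\<^bsub>H\<^esub> (h \<otimes>\<^bsub>H\<^esub> g)) * \<rho> h =
        \<sigma> h * (\<sigma> g * M * \<rho> (inv\<^bsub>H\<^esub> g))" .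
  qed
  also have "\<dots> = \<sigma> h * T"
    unfolding T_def using s.rep_carrier[OF h] c by (rule mult_mat_sum[symmetric])
  finally show ?thesis by simp
qed

text \<open>For the elementary matrix at (i, j), the (i, j) entry of each summand is a product of
  one diagonal entry of each factor, and these products add up to the product of the traces. So a
  nonzero sum of traces exhibits a nonzero averaged intertwiner.\<close>

lemma sum_trace_inverse:
  assumes "representation H n \<sigma>" "representation H n \<rho>"
  shows "(\<Sum>g\<in>carrier H. mat_trace (\<sigma> g) * mat_trace (\<rho> (inv\<^bsub>H\<^esub> g))) =
    (\<Sum>i<n. \<Sum>j<n. mat_sum n (\<lambda>g. \<sigma> g * mat n n (\<lambda>(a, b). if a = i \<and> b = j then 1 else 0)
      * \<rho> (inv\<^bsub>H\<^esub> g)) (carrier H) $$ (i, j))"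
proof -
  interpret s: representation H n \<sigma> by fact
  interpret r: representation H n \<rho> by fact
  have "(\<Sum>g\<in>carrier H. mat_trace (\<sigma> g) * mat_trace (\<rho> (inv\<^bsub>H\<^esub> g))) =
      (\<Sum>g\<in>carrier H. \<Sum>i<n. \<Sum>j<n. \<sigma> g $$ (i, i) * \<rho> (inv\<^bsub>H\<^esub> g) $$ (j, j))"
  proof (rule sum.cong)
    fix g assume g: "g \<in> carrier H"
    have "dim_row (\<sigma> g) = n" "dim_row (\<rho> (inv\<^bsub>H\<^esub> g)) = n"
      using s.rep_carrier[OF g] r.rep_carrier[OF s.inv_closed[OF g]] by auto
    then show "mat_trace (\<sigma> g) * mat_trace (\<rho> (inv\<^bsub>H\<^esub> g)) =
        (\<Sum>i<n. \<Sum>j<n. \<sigma> g $$ (i, i) * \<rho> (inv\<^bsub>H\<^esub> g) $$ (j, j))"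
      by (simp add: mat_trace_def sum_product)
  qed simp
  also have "\<dots> = (\<Sum>i<n. \<Sum>g\<in>carrier H. \<Sum>j<n. \<sigma> g $$ (i, i) * \<rho> (inv\<^bsub>H\<^esub> g) $$ (j, j))"
    by (rule sum.swap)
  also have "\<dots> = (\<Sum>i<n. \<Sum>j<n. \<Sum>g\<in>carrier H. \<sigma> g $$ (i, i) * \<rho> (inv\<^bsub>H\<^esub> g) $$ (j, j))"
    by (intro sum.cong refl sum.swap)
  also have "\<dots> = (\<Sum>i<n. \<Sum>j<n. mat_sum n (\<lambda>g. \<sigma> g * mat n n (\<lambda>(a, b). if a = i \<and> b = j then 1 else 0)
      * \<rho> (inv\<^bsub>H\<^esub> g)) (carrier H) $$ (i, j))"
    using mult_elementary_mult_index[OF s.rep_carrier r.rep_carrier[OF s.inv_closed]]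
    by (intro sum.cong refl) (simp add: mat_sum_index)
  finally show ?thesis .
qed

text \<open>By Schur's lemma each averaged elementary matrix is scalar. Its trace shows that the
  scalar is |H|/n on the diagonal and 0 off it, and the \<open>n\<close> diagonal terms add up to
  |H|.\<close>

lemma irreducible_sum_trace_inverse:
  assumes H: "group H" and fin: "finite (carrier H)" and irr: "irreducible_rep H n \<rho>"
  shows "(\<Sum>g\<in>carrier H. mat_trace (\<rho> g) * mat_trace (\<rho> (inv\<^bsub>H\<^esub> g))) = of_nat (Coset.order H)"
proof -
  interpret r: representation H n \<rho> using irreducible_imp_representation[OF H irr] .
  have "mat_sum n (\<lambda>g. \<rho> g * mat n n (\<lambda>(a, b). if a = i \<and> b = j then 1 else 0)
      * \<rho> (inv\<^bsub>H\<^esub> g)) (carrier H) $$ (i, j) =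
      (if i = j then of_nat (Coset.order H) / of_nat n else 0)" (is "?T $$ _ = _")
    if ij: "i < n" "j < n" for i j
  proof -
    define E where "E = mat n n (\<lambda>(a, b). if a = i \<and> b = j then 1 else (0::complex))"
    have E: "E \<in> carrier_mat n n" by (simp add: E_def)
    have trE: "mat_trace E = (if i = j then 1 else 0)"
    proof -
      have "mat_trace E = (\<Sum>a<n. if a = i then (if i = j then 1 else 0) else 0)"
        by (auto simp: mat_trace_def E_def intro!: sum.cong)
      then show ?thesis using ij by simp
    qed
    have T: "?T = mat_sum n (\<lambda>g. \<rho> g * E * \<rho> (inv\<^bsub>H\<^esub> g)) (carrier H)" by (simp add: E_def)
    have car: "\<rho> g * E * \<rho> (inv\<^bsub>H\<^esub> g) \<in> carrier_mat n n" if "g \<in> carrier H" for g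
      using that r.rep_carrier E by (auto intro!: mult_carrier_mat)
    have "\<rho> h * ?T = ?T * \<rho> h" if "h \<in> carrier H" for h
      unfolding T using intertwiner_mat_sum[OF r.representation_axioms r.representation_axioms fin E that] .
    from schur_scalar[OF H irr mat_sum_carrier this] obtain c where c: "?T = c \<cdot>\<^sub>m 1\<^sub>m n" by blast
    have "c * of_nat n = mat_trace ?T"
      unfolding c using mat_trace_smult[of "1\<^sub>m n" n c] by (simp add: mat_trace_one)
    also have "\<dots> = (\<Sum>g\<in>carrier H. mat_trace (\<rho> g * E * \<rho> (inv\<^bsub>H\<^esub> g)))"
      unfolding T using car by (rule mat_trace_mat_sum)
    also have "\<dots> = (\<Sum>g\<in>carrier H. mat_trace E)"
    proof (rule sum.cong)
      fix g assume g: "g \<in> carrier H"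
      note cs = r.rep_carrier[OF g] r.rep_carrier[OF r.inv_closed[OF g]]
      have "mat_trace (\<rho> g * E * \<rho> (inv\<^bsub>H\<^esub> g)) = mat_trace (\<rho> (inv\<^bsub>H\<^esub> g) * (\<rho> g * E))"
        using cs E by (intro mat_trace_mult_comm[of _ n n]) auto
      also have "\<rho> (inv\<^bsub>H\<^esub> g) * (\<rho> g * E) = \<rho> (inv\<^bsub>H\<^esub> g) * \<rho> g * E"
        using cs E by (intro assoc_mult_mat[of _ n n _ n _ n, symmetric]) auto
      also have "\<rho> (inv\<^bsub>H\<^esub> g) * \<rho> g = 1\<^sub>m n"
        using g r.rep_mult[of "inv\<^bsub>H\<^esub> g" g] r.rep_one by simp
      finally show "mat_trace (\<rho> g * E * \<rho> (inv\<^bsub>H\<^esub> g)) = mat_trace E" using E by simp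
    qed simp
    finally have "c * of_nat n = (if i = j then of_nat (Coset.order H) else 0)"
      by (simp add: trE Coset.order_def)
    then have "c = (if i = j then of_nat (Coset.order H) / of_nat n else 0)"
      using r.rep_dim by (auto simp: field_simps)
    then show ?thesis unfolding c using ij by simp
  qed
  then show ?thesis
    using sum_trace_inverse[OF r.representation_axioms r.representation_axioms] r.rep_dim by simp
qed

text \<open>Equal traces make the orthogonality sum of \<sigma> against \<rho> equal to |H|, so some
  averaged intertwiner \<open>T\<close> is nonzero. \<open>T\<close> turns out to be invertible and
  carries irreducibility from \<rho> to \<sigma>. This gives the irreducibility of restrictions that
  are known only through their characters.\<close>

lemma irreducible_rep_of_same_trace:
  assumes H: "group H" and fin: "finite (carrier H)" and irr: "irreducible_rep H n \<rho>"
    and s: "representation H m \<sigma>"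
    and tr: "\<And>g. g \<in> carrier H \<Longrightarrow> mat_trace (\<sigma> g) = mat_trace (\<rho> g)"
  shows "irreducible_rep H m \<sigma>" "m = n"
proof -
  interpret r: representation H n \<rho> using irreducible_imp_representation[OF H irr] .
  interpret s0: representation H m \<sigma> by fact
  show mn: "m = n"
    using tr[OF r.one_closed] r.trace_one s0.trace_one by simp
  have sn: "representation H n \<sigma>" using s mn by simp
  interpret s: representation H n \<sigma> by fact
  let ?E = "\<lambda>i j. mat n n (\<lambda>(a, b). if a = i \<and> b = j then 1 else (0::complex))"
  let ?T = "\<lambda>i j. mat_sum n (\<lambda>g. \<sigma> g * ?E i j * \<rho> (inv\<^bsub>H\<^esub> g)) (carrier H)"
  have "(\<Sum>i<n. \<Sum>j<n. ?T i j $$ (i, j)) = of_nat (Coset.order H)"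
    using sum_trace_inverse[OF sn r.representation_axioms] irreducible_sum_trace_inverse[OF H fin irr] tr
    by simp
  also have "\<dots> \<noteq> 0" using fin r.one_closed by (auto simp: Coset.order_def)
  finally obtain i j where ij: "i < n" "j < n" "?T i j $$ (i, j) \<noteq> 0"
    by (metis (no_types, lifting) sum.neutral lessThan_iff)
  define T where "T = ?T i j"
  have T: "T \<in> carrier_mat n n" by (simp add: T_def)
  have int: "\<sigma> h * T = T * \<rho> h" if "h \<in> carrier H" for h
    unfolding T_def by (rule intertwiner_mat_sum[OF sn r.representation_axioms fin _ that]) simp
  have W: "W = {0\<^sub>v n} \<or> W = carrier_vec n" if "invariant_subspace H n \<rho> W" for W
    using irr that unfolding irreducible_rep_def by blast
  \<comment> \<open>The kernel of an intertwiner is invariant under the irreducible \<rho>; since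
    \<open>T\<close> has a nonzero entry, the kernel is trivial.\<close>
  define N where "N = {v \<in> carrier_vec n. T *\<^sub>v v = 0\<^sub>v n}"
  have "invariant_subspace H n \<rho> N"
    unfolding invariant_subspace_def
  proof (intro conjI ballI allI)
    fix u w assume "u \<in> N" "w \<in> N"
    then show "u + w \<in> N" using T by (auto simp: N_def mult_add_distrib_mat_vec)
  next
    fix a u assume "u \<in> N"
    then show "a \<cdot>\<^sub>v u \<in> N" using T by (auto simp: N_def mult_mat_vec)
  next
    fix h u assume h: "h \<in> carrier H" and u: "u \<in> N"
    have "T *\<^sub>v (\<rho> h *\<^sub>v u) = (\<sigma> h * T) *\<^sub>v u"
      using assoc_mult_mat_vec[OF T r.rep_carrier[OF h], of u] u int[OF h] by (simp add: N_def)
    also have "\<dots> = \<sigma> h *\<^sub>v 0\<^sub>v n"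
      using assoc_mult_mat_vec[OF s.rep_carrier[OF h] T, of u] u by (simp add: N_def)
    also have "\<dots> = 0\<^sub>v n" using mult_zero_vec[OF s.rep_carrier[OF h]] .
    finally show "\<rho> h *\<^sub>v u \<in> N" using r.rep_carrier[OF h] u by (simp add: N_def)
  qed (use mult_zero_vec[OF T] in \<open>auto simp: N_def\<close>)
  moreover have "N \<noteq> carrier_vec n"
  proof
    assume "N = carrier_vec n"
    then have "T *\<^sub>v unit_vec n j = 0\<^sub>v n" unfolding N_def using unit_vec_carrier by blast
    then have "(T *\<^sub>v unit_vec n j) $ i = 0" using ij by simp
    then show False using ij T unfolding T_def[symmetric] by (simp add: scalar_prod_right_unit[of _ n])
  qed
  ultimately have N: "N = {0\<^sub>v n}" using W by blast
  then have "det T \<noteq> 0" using det_0_iff_vec_prod_zero_field[OF T] N_def by auto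
  then obtain T' where T': "T' \<in> carrier_mat n n" "T * T' = 1\<^sub>m n" "T' * T = 1\<^sub>m n"
    using det_non_zero_imp_unit[OF T, of "()"] by (auto simp: Units_def ring_mat_def)
  have TT': "T *\<^sub>v (T' *\<^sub>v v) = v" if "v \<in> carrier_vec n" for v
    using assoc_mult_mat_vec[OF T T'(1) that] T'(2) that by simp
  have "V = {0\<^sub>v n} \<or> V = carrier_vec n" if V: "invariant_subspace H n \<sigma> V" for V
  proof -
    have Vc: "V \<subseteq> carrier_vec n" using V by (simp add: invariant_subspace_def)
    \<comment> \<open>A subspace invariant under \<sigma> is pulled back along \<open>T\<close> to
      one invariant under \<rho>, where irreducibility is known.\<close>
    define U where "U = {v \<in> carrier_vec n. T *\<^sub>v v \<in> V}"
    have "invariant_subspace H n \<rho> U"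
      unfolding invariant_subspace_def
    proof (intro conjI ballI allI)
      fix u w assume "u \<in> U" "w \<in> U"
      then show "u + w \<in> U"
        using T V by (auto simp: U_def mult_add_distrib_mat_vec invariant_subspace_def)
    next
      fix a u assume "u \<in> U"
      then show "a \<cdot>\<^sub>v u \<in> U" using T V by (auto simp: U_def mult_mat_vec invariant_subspace_def)
    next
      fix h u assume h: "h \<in> carrier H" and u: "u \<in> U"
      have "T *\<^sub>v (\<rho> h *\<^sub>v u) = \<sigma> h *\<^sub>v (T *\<^sub>v u)"
        using assoc_mult_mat_vec[OF T r.rep_carrier[OF h], of u] u int[OF h]
          assoc_mult_mat_vec[OF s.rep_carrier[OF h] T, of u] by (simp add: U_def)
      then show "\<rho> h *\<^sub>v u \<in> U"
        using V h r.rep_carrier[OF h] u by (simp add: U_def invariant_subspace_def)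
    next
      have "T *\<^sub>v 0\<^sub>v n = 0\<^sub>v n" using mult_zero_vec[OF T] .
      then show "0\<^sub>v n \<in> U" using V by (simp add: U_def invariant_subspace_def)
    qed (auto simp: U_def)
    from W[OF this] show ?thesis
    proof
      assume U: "U = {0\<^sub>v n}"
      have "v = 0\<^sub>v n" if "v \<in> V" for v
      proof -
        have v: "v \<in> carrier_vec n" using that Vc by blast
        then have "T' *\<^sub>v v \<in> U" using TT'[OF v] that T'(1) by (simp add: U_def)
        then have "T' *\<^sub>v v = 0\<^sub>v n" using U by simp
        then have "v = T *\<^sub>v 0\<^sub>v n" using TT'[OF v] by simp
        then show ?thesis using mult_zero_vec[OF T] by simp
      qed
      then show ?thesis using V by (auto simp: invariant_subspace_def)
    next
      assume U: "U = carrier_vec n"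
      have "v \<in> V" if v: "v \<in> carrier_vec n" for v
      proof -
        have "T' *\<^sub>v v \<in> U" using U T'(1) v by simp
        then show ?thesis using TT'[OF v] by (simp add: U_def)
      qed
      then show ?thesis using Vc by blast
    qed
  qed
  then show "irreducible_rep H m \<sigma>" using s.irreducible_rep_iff mn by simp
qed

section \<open>Character values as sums of roots of unity\<close>

lemma eigenvalue_root_of_unity:
  assumes A: "A \<in> carrier_mat n n" "A ^\<^sub>m k = 1\<^sub>m n" and e: "eigenvalue A e"
  shows "e ^ k = (1 :: complex)"
proof -
  from e obtain v where v: "eigenvector A v e" unfolding eigenvalue_def by blast
  have vc: "v \<in> carrier_vec n" "v \<noteq> 0\<^sub>v n" using v A by (auto simp: eigenvector_def)
  have "1 \<cdot>\<^sub>v v = e ^ k \<cdot>\<^sub>v v" using eigenvector_pow[OF A(1) v, of k] A(2) vc by simp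
  moreover obtain i where "i < n" "v $ i \<noteq> 0" using vc by (metis eq_vecI carrier_vecD index_zero_vec)
  ultimately show ?thesis using vc by (metis carrier_vecD index_smult_vec(1) mult_cancel_right)
qed

text \<open>A Schur decomposition is similar to \<open>A\<close>, has the same trace, and carries
  the roots of the characteristic polynomial on its diagonal.\<close>

lemma trace_finite_order:
  assumes A: "A \<in> carrier_mat n n" "A ^\<^sub>m k = 1\<^sub>m n"
  obtains es where "mat_trace A = sum_list es" "\<And>e. e \<in> set es \<Longrightarrow> e ^ k = 1"
proof -
  from char_poly_factorized[OF A(1)] obtain es
    where es: "char_poly A = (\<Prod>a\<leftarrow>es. [:- a, 1:])" by blast
  obtain B P Q where BPQ: "schur_decomposition A es = (B, P, Q)" by (cases "schur_decomposition A es")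
  from schur_decomposition[OF A(1) es BPQ]
  have sim: "similar_mat_wit A B P Q" and dB: "diag_mat B = es" by auto
  note w = similar_mat_witD2[OF A(1) sim]
  have "mat_trace A = mat_trace (P * (B * Q))" using w by (simp add: assoc_mult_mat[OF w(6,5,7)])
  also have "\<dots> = mat_trace (B * Q * P)" using w by (intro mat_trace_mult_comm) auto
  also have "B * Q * P = B" using w by (simp add: assoc_mult_mat[OF w(5,7,6)])
  also have "mat_trace B = sum_list (diag_mat B)"
    by (simp add: mat_trace_def diag_mat_def sum_list_distinct_conv_sum_set lessThan_atLeast0)
  finally have "mat_trace A = sum_list es" using dB by simp
  moreover have "e ^ k = 1" if "e \<in> set es" for e
  proof -
    have "poly (char_poly A) e = 0" unfolding es using that by (rule linear_poly_root)
    then show ?thesis using eigenvalue_root_char_poly[OF A(1)] eigenvalue_root_of_unity[OF A] by blast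
  qed
  ultimately show thesis by (rule that)
qed

lemma (in representation) rep_finite_order:
  assumes "finite (carrier H)" "x \<in> carrier H"
  shows "\<rho> x ^\<^sub>m Coset.order H = 1\<^sub>m n"
  using rep_pow[OF assms(2), of "Coset.order H"] pow_order_eq_1[OF assms(2)] rep_one by simp

lemma (in mod_red) char_value_in_R:
  assumes "representation H n \<rho>" "finite (carrier H)" "x \<in> carrier H"
  shows "mat_trace (\<rho> x) \<in> R"
proof -
  interpret r: representation H n \<rho> by fact
  from trace_finite_order[OF r.rep_carrier[OF assms(3)] r.rep_finite_order[OF assms(2,3)]]
  obtain es where es: "mat_trace (\<rho> x) = sum_list es" "\<And>e. e \<in> set es \<Longrightarrow> e ^ Coset.order H = 1"
    by blast
  have "Coset.order H > 0" using assms(2,3) by (auto simp: Coset.order_def card_gt_0_iff)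
  then have "set es \<subseteq> R" using es(2) R_root by blast
  then have "sum_list es \<in> R" by (induction es) (auto simp: R_0 R_add)
  then show ?thesis using es by simp
qed

lemma (in group) subgroup_centralizer:
  assumes "U \<subseteq> carrier G" shows "subgroup (centralizer G U) G"
proof
  fix x y assume xy: "x \<in> centralizer G U" "y \<in> centralizer G U"
  have "x \<otimes> y \<otimes> u = u \<otimes> (x \<otimes> y)" if "u \<in> U" for u
  proof -
    have c: "x \<in> carrier G" "y \<in> carrier G" "u \<in> carrier G" "x \<otimes> u = u \<otimes> x" "y \<otimes> u = u \<otimes> y"
      using xy that assms by (auto simp: centralizer_def)
    have "x \<otimes> y \<otimes> u = x \<otimes> u \<otimes> y" using c(1,2,3,5) by (simp add: m_assoc)
    then show ?thesis using c(1-4) by (simp add: m_assoc)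
  qed
  then show "x \<otimes> y \<in> centralizer G U" using xy by (simp add: centralizer_def)
next
  fix x assume x: "x \<in> centralizer G U"
  have "inv x \<otimes> u = u \<otimes> inv x" if "u \<in> U" for u
  proof -
    have c: "x \<in> carrier G" "u \<in> carrier G" "x \<otimes> u = u \<otimes> x"
      using x that assms by (auto simp: centralizer_def)
    then have "u = inv x \<otimes> (u \<otimes> x)" by (metis mult_inv_cancel(2))
    also have "\<dots> = inv x \<otimes> u \<otimes> x" using c(1,2) by (simp add: m_assoc)
    finally show ?thesis using c(1,2) by (metis inv_closed m_closed inv_solve_right)
  qed
  then show "inv x \<in> centralizer G U" using x by (simp add: centralizer_def)
qed (use assms in \<open>auto simp: centralizer_def\<close>)

section \<open>Central characters on orbit sums\<close>

text \<open>A representation \<open>\<rho>\<close> of \<open>H\<close> that remains irreducible when pulled back along \<open>e\<close> gives a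
  central character on the sums over the orbits of \<open>Y\<close>, acting on \<open>H\<close> by conjugation through
  \<open>e\<close>.\<close>

locale pulled_back_rep = mod_red l R star K \<nu> + Y: group Y + H: representation H n \<rho>
  for l R and star :: "complex \<Rightarrow> 'k::field" and K \<nu>
    and Y :: "('y, 'c) monoid_scheme" and H :: "('a, 'b) monoid_scheme" and n \<rho> +
  fixes e :: "'y \<Rightarrow> 'a"
  assumes e_hom: "e \<in> hom Y H" and irr: "irreducible_rep Y n (\<lambda>x. \<rho> (e x))"
    and finY: "finite (carrier Y)" and finH: "finite (carrier H)"
begin

sublocale e: group_hom Y H e
  using e_hom Y.is_group H.is_group by (simp add: group_hom_def group_hom_axioms_def)

definition \<chi> :: "'a \<Rightarrow> complex" where "\<chi> x = mat_trace (\<rho> x)"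

definition act :: "'y \<Rightarrow> 'a \<Rightarrow> 'a" where
  "act m w = e m \<otimes>\<^bsub>H\<^esub> w \<otimes>\<^bsub>H\<^esub> inv\<^bsub>H\<^esub> e m"

definition orb :: "'a \<Rightarrow> 'a set" where "orb w = {act m w | m. m \<in> carrier Y}"

definition stab :: "'a \<Rightarrow> 'y set" where "stab w = {m \<in> carrier Y. act m w = w}"

text \<open>For an invariant set \<open>U\<close> this is the scalar by which the sum of \<rho> over
  \<open>U\<close> acts, the analogue of \<open>omega\<close> with orbits of \<open>Y\<close> in
  place of conjugacy classes.\<close>

definition omg :: "'a set \<Rightarrow> complex" where "omg U = (\<Sum>u\<in>U. \<chi> u) / of_nat n"

definition invariant :: "'a set \<Rightarrow> bool" where
  "invariant U \<longleftrightarrow> U \<subseteq> carrier H \<and> (\<forall>m\<in>carrier Y. \<forall>u\<in>U. act m u \<in> U)"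

lemma act_closed: "m \<in> carrier Y \<Longrightarrow> w \<in> carrier H \<Longrightarrow> act m w \<in> carrier H"
  by (simp add: act_def)

lemma act_one: "w \<in> carrier H \<Longrightarrow> act \<one>\<^bsub>Y\<^esub> w = w"
  by (simp add: act_def)

lemma act_mult:
  "m \<in> carrier Y \<Longrightarrow> k \<in> carrier Y \<Longrightarrow> w \<in> carrier H \<Longrightarrow> act (m \<otimes>\<^bsub>Y\<^esub> k) w = act m (act k w)"
  by (simp add: act_def H.m_assoc H.inv_mult_group)

lemma act_distrib:
  "m \<in> carrier Y \<Longrightarrow> v \<in> carrier H \<Longrightarrow> w \<in> carrier H \<Longrightarrow>
    act m (v \<otimes>\<^bsub>H\<^esub> w) = act m v \<otimes>\<^bsub>H\<^esub> act m w"
  by (simp add: act_def H.m_assoc H.mult_inv_cancel)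

lemma act_inv:
  "m \<in> carrier Y \<Longrightarrow> w \<in> carrier H \<Longrightarrow> act (inv\<^bsub>Y\<^esub> m) (act m w) = w"
  "m \<in> carrier Y \<Longrightarrow> w \<in> carrier H \<Longrightarrow> act m (act (inv\<^bsub>Y\<^esub> m) w) = w"
  using act_mult[of "inv\<^bsub>Y\<^esub> m" m w] act_mult[of m "inv\<^bsub>Y\<^esub> m" w] act_one by simp_all

lemma \<chi>_act: "m \<in> carrier Y \<Longrightarrow> w \<in> carrier H \<Longrightarrow> \<chi> (act m w) = \<chi> w"
  unfolding \<chi>_def act_def by (intro H.trace_conj) simp_all

lemma \<chi>_R: "w \<in> carrier H \<Longrightarrow> \<chi> w \<in> R"
  unfolding \<chi>_def by (rule char_value_in_R[OF H.representation_axioms finH])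

lemma invariant_subset: "invariant U \<Longrightarrow> U \<subseteq> carrier H"
  and invariant_act: "invariant U \<Longrightarrow> m \<in> carrier Y \<Longrightarrow> u \<in> U \<Longrightarrow> act m u \<in> U"
  by (auto simp: invariant_def)

lemma invariant_finite: "invariant U \<Longrightarrow> finite U"
  using invariant_subset finH finite_subset by blast

lemma action: "invariant U \<Longrightarrow> group_action Y U (\<lambda>m. \<lambda>w\<in>U. act m w)"
  using invariant_subset invariant_act act_one act_mult
  by (intro group_actionI) (auto simp: Y.is_group subset_iff)

lemma orbits_eq:
  assumes "invariant U"
  shows "orbits Y U (\<lambda>m. \<lambda>w\<in>U. act m w) = orb ` U"
  by (auto simp: orbits_def orbit_def orb_def image_iff)

lemma sum_orbits:
  assumes "invariant U"
  shows "(\<Sum>P\<in>orb ` U. \<Sum>w\<in>P. f w) = (\<Sum>w\<in>U. f w)"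
  using group_action.disjoint_sum[OF action[OF assms] invariant_finite[OF assms]] orbits_eq[OF assms]
  by metis

lemma invariant_carrier: "invariant (carrier H)"
  by (simp add: invariant_def act_closed)

lemma mem_orb: "w \<in> carrier H \<Longrightarrow> w \<in> orb w"
  using act_one Y.one_closed by (force simp: orb_def)

lemma invariant_orb: assumes "w \<in> carrier H" shows "invariant (orb w)"
proof -
  have "act k (act m w) \<in> orb w" if "k \<in> carrier Y" "m \<in> carrier Y" for k m
  proof -
    have "act (k \<otimes>\<^bsub>Y\<^esub> m) w \<in> orb w" using that orb_def by blast
    then show ?thesis using act_mult[OF that assms] by simp
  qed
  then show ?thesis using assms act_closed by (auto simp: invariant_def orb_def)
qed

lemma orb_eq: assumes "w \<in> carrier H" "v \<in> orb w" shows "orb v = orb w"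
proof -
  from assms(2) obtain m where m: "m \<in> carrier Y" "v = act m w" by (auto simp: orb_def)
  have v: "v \<in> carrier H" using m act_closed assms by simp
  have "orb v \<subseteq> orb w"
    using invariant_act[OF invariant_orb[OF assms(1)] _ assms(2)] by (auto simp: orb_def)
  moreover have "act (inv\<^bsub>Y\<^esub> m) v \<in> orb v" using Y.inv_closed[OF m(1)] orb_def by blast
  then have "w \<in> orb v" using act_inv(1)[OF m(1) assms(1)] m by simp
  then have "orb w \<subseteq> orb v"
    using invariant_act[OF invariant_orb[OF v]] by (auto simp: orb_def)
  ultimately show ?thesis by blast
qed

lemma
  assumes "w \<in> carrier H"
  shows subgroup_stab: "subgroup (stab w) Y"
  and card_orb: "card (orb w) * card (stab w) = Coset.order Y"
proof -
  interpret A: group_action Y "carrier H" "\<lambda>m. \<lambda>w\<in>carrier H. act m w"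
    using action[OF invariant_carrier] .
  have "stabilizer Y (\<lambda>m. \<lambda>w\<in>carrier H. act m w) w = stab w"
    "orbit Y (\<lambda>m. \<lambda>w\<in>carrier H. act m w) w = orb w"
    using assms unfolding stabilizer_def stab_def orbit_def orb_def by auto
  then show "subgroup (stab w) Y" "card (orb w) * card (stab w) = Coset.order Y"
    using A.stabilizer_subgroup[OF assms] A.orbit_stabilizer_theorem[OF assms] by metis+
qed

lemma omg_orb:
  assumes "w \<in> carrier H" shows "omg (orb w) = of_nat (card (orb w)) * \<chi> w / of_nat n"
proof -
  have "(\<Sum>u\<in>orb w. \<chi> u) = (\<Sum>u\<in>orb w. \<chi> w)"
    using \<chi>_act assms by (intro sum.cong) (auto simp: orb_def)
  then show ?thesis by (simp add: omg_def)
qed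

text \<open>The first factor is an indexed family \<open>f\<close> rather than a subset of
  \<open>H\<close>, so that the lemma covers both an orbit in \<open>H\<close> and a conjugacy class
  of \<open>Y\<close> carried into \<open>H\<close> by the possibly non-injective \<open>e\<close>.
  The structure constant \<open>N w\<close> counts the factorizations of \<open>w\<close>; it is
  constant on orbits, because \<open>Y\<close> permutes them.\<close>

lemma omg_mult:
  fixes L :: "'i set" and f :: "'i \<Rightarrow> 'a" and b :: "'y \<Rightarrow> 'i \<Rightarrow> 'i"
  assumes finL: "finite L" and f: "\<And>u. u \<in> L \<Longrightarrow> f u \<in> carrier H"
    and b: "\<And>m u. m \<in> carrier Y \<Longrightarrow> u \<in> L \<Longrightarrow> b m u \<in> L"
    and b_inv: "\<And>m u. m \<in> carrier Y \<Longrightarrow> u \<in> L \<Longrightarrow> b (inv\<^bsub>Y\<^esub> m) (b m u) = u"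
    and equiv: "\<And>m u. m \<in> carrier Y \<Longrightarrow> u \<in> L \<Longrightarrow> f (b m u) = act m (f u)"
    and U: "invariant U"
  defines "N \<equiv> \<lambda>w. card {(u, v). u \<in> L \<and> v \<in> U \<and> f u \<otimes>\<^bsub>H\<^esub> v = w}"
  shows "\<And>m w. m \<in> carrier Y \<Longrightarrow> w \<in> carrier H \<Longrightarrow> N (act m w) = N w"
    and "(\<Sum>u\<in>L. \<chi> (f u)) / of_nat n * omg U =
      (\<Sum>P\<in>orb ` carrier H. of_nat (N (SOME w. w \<in> P)) * omg P)"
proof -
  define E where "E = (\<lambda>w. {(u, v). u \<in> L \<and> v \<in> U \<and> f u \<otimes>\<^bsub>H\<^esub> v = w})"
  have NE: "N w = card (E w)" for w by (simp add: N_def E_def)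
  have UH: "U \<subseteq> carrier H" "finite U" using U invariant_subset invariant_finite by auto
  have finE: "finite (E w)" for w
    by (rule finite_subset[of _ "L \<times> U"]) (use finL UH in \<open>auto simp: E_def\<close>)
  have le: "card (E w) \<le> card (E (act m w))" if m: "m \<in> carrier Y" and w: "w \<in> carrier H" for m w
  proof (rule card_inj_on_le[OF _ _ finE])
    show "inj_on (\<lambda>(u, v). (b m u, act m v)) (E w)"
    proof (rule inj_onI, clarsimp simp: E_def)
      fix u v u' v' assume a: "u \<in> L" "v \<in> U" "u' \<in> L" "v' \<in> U" "b m u = b m u'" "act m v = act m v'"
      then show "u = u' \<and> v = v'"
        using b_inv[OF m] act_inv(1)[OF m] UH by (metis subsetD)
    qed
    show "(\<lambda>(u, v). (b m u, act m v)) ` E w \<subseteq> E (act m w)"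
      using b[OF m] invariant_act[OF U m] equiv[OF m] act_distrib[OF m] f UH by (auto simp: E_def subset_iff)
  qed
  \<comment> \<open>The inequality for \<open>m\<close> and the one for its inverse together give
    equality.\<close>
  show N_act: "N (act m w) = N w" if m: "m \<in> carrier Y" and w: "w \<in> carrier H" for m w
    using le[OF m w] le[OF Y.inv_closed[OF m] act_closed[OF m w]] act_inv(1)[OF m w] by (simp add: NE)
  \<comment> \<open>Since the sum over \<open>U\<close> acts as the scalar \<open>omg U\<close>,
    this factor can be moved inside each trace.\<close>
  have "(\<Sum>u\<in>L. \<chi> (f u)) * omg U = (\<Sum>u\<in>L. \<Sum>v\<in>U. \<chi> (f u \<otimes>\<^bsub>H\<^esub> v))"
    unfolding sum_distrib_right omg_def \<chi>_def
    using invariant_sum_trace[OF Y.is_group H.is_group e_hom H.rep_hom irr UH(1) _ f]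
      invariant_act[OF U] by (intro sum.cong refl) (auto simp: act_def)
  also have "\<dots> = (\<Sum>x\<in>L \<times> U. \<chi> (f (fst x) \<otimes>\<^bsub>H\<^esub> snd x))"
    by (simp add: sum.cartesian_product case_prod_beta)
  also have "\<dots> = (\<Sum>w\<in>carrier H. \<Sum>x\<in>{x \<in> L \<times> U. f (fst x) \<otimes>\<^bsub>H\<^esub> snd x = w}. \<chi> (f (fst x) \<otimes>\<^bsub>H\<^esub> snd x))"
    using finL UH finH f by (intro sum.group[symmetric]) auto
  also have "\<dots> = (\<Sum>w\<in>carrier H. of_nat (N w) * \<chi> w)"
  proof (rule sum.cong)
    fix w
    have "{x \<in> L \<times> U. f (fst x) \<otimes>\<^bsub>H\<^esub> snd x = w} = E w" by (auto simp: E_def)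
    moreover have "(\<Sum>x\<in>E w. \<chi> (f (fst x) \<otimes>\<^bsub>H\<^esub> snd x)) = (\<Sum>x\<in>E w. \<chi> w)"
      by (intro sum.cong) (auto simp: E_def)
    ultimately show "(\<Sum>x\<in>{x \<in> L \<times> U. f (fst x) \<otimes>\<^bsub>H\<^esub> snd x = w}. \<chi> (f (fst x) \<otimes>\<^bsub>H\<^esub> snd x)) =
        of_nat (N w) * \<chi> w"
      by (simp add: NE)
  qed simp
  also have "\<dots> = (\<Sum>P\<in>orb ` carrier H. \<Sum>w\<in>P. of_nat (N w) * \<chi> w)"
    using sum_orbits[OF invariant_carrier] by metis
  also have "\<dots> = (\<Sum>P\<in>orb ` carrier H. of_nat (N (SOME w. w \<in> P)) * (\<Sum>w\<in>P. \<chi> w))"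
  proof (rule sum.cong)
    fix P assume "P \<in> orb ` carrier H"
    then obtain w where w: "w \<in> carrier H" "P = orb w" by blast
    have const: "N v = N w" if "v \<in> P" for v
      using that w N_act by (auto simp: orb_def)
    have "(SOME w. w \<in> P) \<in> P" using mem_orb[OF w(1)] w(2) someI_ex[of "\<lambda>w. w \<in> P"] by blast
    then have "N v = N (SOME w. w \<in> P)" if "v \<in> P" for v using const that by simp
    then have "(\<Sum>v\<in>P. of_nat (N v) * \<chi> v) = (\<Sum>v\<in>P. of_nat (N (SOME w. w \<in> P)) * \<chi> v)"
      by (intro sum.cong) auto
    then show "(\<Sum>v\<in>P. of_nat (N v) * \<chi> v) = of_nat (N (SOME w. w \<in> P)) * (\<Sum>v\<in>P. \<chi> v)"
      by (simp add: sum_distrib_left)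
  qed simp
  finally have "(\<Sum>u\<in>L. \<chi> (f u)) * omg U =
      (\<Sum>P\<in>orb ` carrier H. of_nat (N (SOME w. w \<in> P)) * (\<Sum>w\<in>P. \<chi> w))" .
  then have "(\<Sum>u\<in>L. \<chi> (f u)) / of_nat n * omg U =
      (\<Sum>P\<in>orb ` carrier H. of_nat (N (SOME w. w \<in> P)) * (\<Sum>w\<in>P. \<chi> w)) / of_nat n"
    by simp
  also have "\<dots> = (\<Sum>P\<in>orb ` carrier H. of_nat (N (SOME w. w \<in> P)) * omg P)"
    by (simp only: omg_def times_divide_eq_right
        sum_divide_distrib[of _ "orb ` carrier H" "of_nat n"])
  finally show "(\<Sum>u\<in>L. \<chi> (f u)) / of_nat n * omg U =
      (\<Sum>P\<in>orb ` carrier H. of_nat (N (SOME w. w \<in> P)) * omg P)" .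
qed

text \<open>The product of two orbit sums is a combination of orbit sums with natural coefficients,
  so \<open>R_of_structure_constants\<close> applies to the finite family of all orbit
  scalars.\<close>

lemma omg_orb_R: assumes "w \<in> carrier H" shows "omg (orb w) \<in> R"
proof (rule R_of_structure_constants[where I = "orb ` carrier H" and f = omg and c =
      "\<lambda>P Q. card {(u, v). u \<in> P \<and> v \<in> P \<and> u \<otimes>\<^bsub>H\<^esub> v = (SOME w. w \<in> Q)}"])
  show "finite (orb ` carrier H)" using finH by simp
  show "omg P \<in> K" if "P \<in> orb ` carrier H" for P
  proof -
    from that obtain v where "v \<in> carrier H" "P = orb v" by blast
    then have "P \<subseteq> carrier H" using invariant_orb invariant_subset by blast
    then show ?thesis unfolding omg_def using \<chi>_R R_K K_of_nat by (intro K_divide K_sum) auto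
  qed
  fix P assume P: "P \<in> orb ` carrier H"
  then have inv: "invariant P" using invariant_orb by blast
  have act_inv': "act (inv\<^bsub>Y\<^esub> m) (act m u) = u" if "m \<in> carrier Y" "u \<in> P" for m u
    using act_inv(1) that invariant_subset[OF inv] by blast
  have "omg P * omg P = (\<Sum>u\<in>P. \<chi> u) / of_nat n * omg P" by (simp add: omg_def)
  also have "\<dots> = (\<Sum>Q\<in>orb ` carrier H.
      of_nat (card {(u, v). u \<in> P \<and> v \<in> P \<and> u \<otimes>\<^bsub>H\<^esub> v = (SOME w. w \<in> Q)}) * omg Q)"
    using invariant_subset[OF inv] invariant_act[OF inv] act_inv'
    by (intro omg_mult(2)[OF invariant_finite[OF inv], where f = "\<lambda>u. u" and b = act]) (auto simp: inv)
  finally show "omg P * omg P = (\<Sum>Q\<in>orb ` carrier H.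
      of_nat (card {(u, v). u \<in> P \<and> v \<in> P \<and> u \<otimes>\<^bsub>H\<^esub> v = (SOME w. w \<in> Q)}) * omg Q)" .
qed (use assms in simp)

text \<open>An invariant set is a disjoint union of orbits, and by \<open>zero\<close> at most the
  orbit of \<open>a\<close> has a scalar that survives reduction.\<close>

lemma star_omg_invariant:
  assumes U: "invariant U" and a: "a \<in> carrier H"
    and zero: "\<And>w. w \<in> U \<Longrightarrow> star (omg (orb w)) \<noteq> 0 \<Longrightarrow> w \<in> orb a"
  shows "star (omg U) = (if a \<in> U then star (omg (orb a)) else 0)"
proof -
  have UH: "w \<in> carrier H" if "w \<in> U" for w using U that invariant_subset by blast
  have "omg U = (\<Sum>P\<in>orb ` U. omg P)"
    using sum_orbits[OF U, of "\<lambda>w. \<chi> w / of_nat n"] by (simp add: omg_def sum_divide_distrib)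
  then have "star (omg U) = (\<Sum>P\<in>orb ` U. star (omg P))"
    using omg_orb_R UH by (auto intro!: star_sum)
  also have "\<dots> = (\<Sum>P\<in>orb ` U. if P = orb a then star (omg (orb a)) else 0)"
  proof (intro sum.cong refl)
    fix P assume "P \<in> orb ` U"
    then obtain w where w: "w \<in> U" "P = orb w" by blast
    show "star (omg P) = (if P = orb a then star (omg (orb a)) else 0)"
    proof (cases "star (omg P) = 0")
      case False
      then have "w \<in> orb a" using zero w by blast
      then show ?thesis using orb_eq[OF a] w by simp
    qed auto
  qed
  also have "\<dots> = (if orb a \<in> orb ` U then star (omg (orb a)) else 0)"
    using invariant_finite[OF U] by simp
  also have "orb a \<in> orb ` U \<longleftrightarrow> a \<in> U"
  proof
    assume "orb a \<in> orb ` U"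
    then obtain w where w: "w \<in> U" "orb a = orb w" by blast
    then have "a \<in> orb w" using mem_orb[OF a] by simp
    then show "a \<in> U" using invariant_act[OF U] w(1) by (auto simp: orb_def)
  qed blast
  finally show ?thesis .
qed

text \<open>A scalar that survives reduction has absolute value 1, and character values are
  integral, so the \<open>l\<close>-part of the orbit length divides that of \<open>n\<close>. The
  height-zero equation for \<open>n * card D\<close> turns this into a lower bound for the
  stabilizer.\<close>

lemma card_stab_ge:
  assumes w: "w \<in> carrier H" and nz: "star (omg (orb w)) \<noteq> 0"
    and D: "card D > 0" "multiplicity l (n * card D) = multiplicity l (Coset.order Y)"
  shows "multiplicity l (card D) \<le> multiplicity l (card (stab w))"
proof -
  have pos: "card (stab w) > 0" "card (orb w) > 0"
    using card_orb[OF w] Y.order_gt_0_iff_finite finY by (metis gr0I mult_0 mult_0_right less_numeral_extra(3))+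
  have "omg (orb w) \<in> R" using omg_orb_R[OF w] .
  then have 1: "\<nu> (omg (orb w)) = 1" using nz star_eq_0[of "omg (orb w)"] by (simp add: R_eq)
  have 2: "\<nu> (omg (orb w)) = \<nu> (of_nat (card (orb w))) * \<nu> (\<chi> w) / \<nu> (of_nat n)"
    unfolding omg_orb[OF w] using \<chi>_R[OF w] R_K K_of_nat H.rep_dim
    by (subst \<nu>_divide) (auto simp: K_mult \<nu>_mult)
  have "\<nu> (of_nat n) \<noteq> 0" using \<nu>_eq_0[OF K_of_nat, of n] H.rep_dim by simp
  then have "\<nu> (of_nat n) = \<nu> (of_nat (card (orb w))) * \<nu> (\<chi> w)"
    using 1 2 by simp
  also have "\<dots> \<le> \<nu> (of_nat (card (orb w))) * 1"
    using \<chi>_R[OF w] \<nu>_nonneg[OF K_of_nat] by (intro mult_left_mono) (auto simp: R_eq)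
  finally have "\<nu> (of_nat l) ^ multiplicity l n \<le> \<nu> (of_nat l) ^ multiplicity l (card (orb w))"
    using \<nu>_of_nat H.rep_dim pos by simp
  then have "multiplicity l (card (orb w)) \<le> multiplicity l n"
    using \<nu>_l by (metis power_decreasing_iff)
  moreover have "multiplicity l n + multiplicity l (card D) =
      multiplicity l (card (orb w)) + multiplicity l (card (stab w))"
    using D card_orb[OF w] pos H.rep_dim prime_l
    by (metis prime_elem_multiplicity_mult_distrib prime_imp_prime_elem not_gr0)
  ultimately show ?thesis by simp
qed

text \<open>The analogue, for orbits of \<open>Y\<close>, of the min-max theorem on defect groups.\<close>

lemma defect_group_stabilizes:
  assumes u: "u \<in> carrier Y" and D: "subgroup D Y" "D \<subseteq> centralizer Y {u}"
    "card D = l_part l (card (centralizer Y {u}))"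
    and defect: "star ((\<Sum>x\<in>conj_class Y u. \<chi> (e x)) / of_nat n) \<noteq> 0"
    and height: "multiplicity l (n * card D) = multiplicity l (Coset.order Y)"
    and w: "w \<in> carrier H" "star (omg (orb w)) \<noteq> 0"
  obtains v where "v \<in> orb w" "D \<subseteq> stab v"
proof -
  define L where "L = conj_class Y u"
  define b where "b = (\<lambda>m x. m \<otimes>\<^bsub>Y\<^esub> x \<otimes>\<^bsub>Y\<^esub> inv\<^bsub>Y\<^esub> m)"
  have conjY: "b m (b k x) = b (m \<otimes>\<^bsub>Y\<^esub> k) x" if "m \<in> carrier Y" "k \<in> carrier Y" "x \<in> carrier Y" for m k x
    using that by (simp add: b_def Y.m_assoc Y.inv_mult_group)
  have L_eq: "L = {b m u | m. m \<in> carrier Y}" by (simp add: L_def conj_class_def b_def)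
  have LY: "L \<subseteq> carrier Y" using u by (auto simp: L_eq b_def)
  have finL: "finite L" using LY finY finite_subset by blast
  have bL: "b m x \<in> L" if "m \<in> carrier Y" "x \<in> L" for m x
  proof -
    from that obtain k where k: "k \<in> carrier Y" "x = b k u" by (auto simp: L_eq)
    then show ?thesis using conjY[OF that(1) k(1) u] that by (auto simp: L_eq)
  qed
  have b1: "b \<one>\<^bsub>Y\<^esub> x = x" if "x \<in> carrier Y" for x using that by (simp add: b_def)
  have b_inv: "b (inv\<^bsub>Y\<^esub> m) (b m x) = x" if "m \<in> carrier Y" "x \<in> L" for m x
    using conjY[of "inv\<^bsub>Y\<^esub> m" m x] that LY b1 by (auto simp: subset_iff)
  have eb: "e (b m x) = act m (e x)" if "m \<in> carrier Y" "x \<in> L" for m x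
    using that LY by (auto simp: b_def act_def subset_iff)
  have eL: "e x \<in> carrier H" if "x \<in> L" for x using that LY by auto
  \<comment> \<open>The interpretation is kept local: its simplification rules for the identity homomorphism loop.\<close>
  have dL: "(\<Sum>x\<in>L. \<chi> (e x)) / of_nat n \<in> R"
  proof -
    interpret self: pulled_back_rep l R star K \<nu> Y Y n "\<lambda>x. \<rho> (e x)" "\<lambda>x. x"
    proof (unfold_locales)
      show "(\<lambda>x. \<rho> (e x)) \<in> hom Y (GL n)" using irr by (simp add: irreducible_rep_def)
      show "(\<lambda>x. x) \<in> hom Y Y" unfolding hom_def by blast
    qed (fact H.rep_dim irr finY)+
    have "self.orb u = L" unfolding self.orb_def self.act_def L_eq b_def ..
    then show "(\<Sum>x\<in>L. \<chi> (e x)) / of_nat n \<in> R"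
      using self.omg_orb_R[OF u] unfolding self.omg_def self.\<chi>_def \<chi>_def by simp
  qed
  have C: "subgroup (centralizer Y {u}) Y" using Y.subgroup_centralizer u by simp
  define N where "N = (\<lambda>w'. card {(x, v). x \<in> L \<and> v \<in> orb w \<and> e x \<otimes>\<^bsub>H\<^esub> v = w'})"
  have inv_w: "invariant (orb w)" using invariant_orb[OF w(1)] .
  \<comment> \<open>Neither factor on the left vanishes under \<open>star\<close>. Hence the
    expansion contains an orbit \<open>P\<close> whose structure constant is prime to
    \<open>l\<close> and whose own scalar survives.\<close>
  have om: "(\<Sum>x\<in>L. \<chi> (e x)) / of_nat n * omg (orb w) =
      (\<Sum>P\<in>orb ` carrier H. of_nat (N (SOME w. w \<in> P)) * omg P)"
    unfolding N_def by (rule omg_mult(2)[OF finL eL bL b_inv eb inv_w])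
  have "star ((\<Sum>x\<in>L. \<chi> (e x)) / of_nat n * omg (orb w)) \<noteq> 0"
    using star_mult[OF dL omg_orb_R[OF w(1)]] defect w(2) by (simp add: L_def)
  moreover have Rs: "of_nat (N (SOME w. w \<in> P)) * omg P \<in> R" if "P \<in> orb ` carrier H" for P
    using that omg_orb_R R_of_nat R_mult by blast
  moreover have "star (\<Sum>P\<in>orb ` carrier H. of_nat (N (SOME w. w \<in> P)) * omg P) =
      (\<Sum>P\<in>orb ` carrier H. star (of_nat (N (SOME w. w \<in> P)) * omg P))"
    by (rule star_sum) (rule Rs)
  ultimately have "(\<Sum>P\<in>orb ` carrier H. star (of_nat (N (SOME w. w \<in> P)) * omg P)) \<noteq> 0"
    unfolding om by (simp only:) simp
  then obtain P where P: "P \<in> orb ` carrier H" "star (of_nat (N (SOME w. w \<in> P)) * omg P) \<noteq> 0"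
    by (rule sum.not_neutral_contains_not_neutral)
  from P(1) obtain w0 where w0: "w0 \<in> carrier H" "P = orb w0" by blast
  define w' where "w' = (SOME w. w \<in> P)"
  have "w0 \<in> P" using mem_orb[OF w0(1)] w0(2) by simp
  then have w'P: "w' \<in> P" unfolding w'_def by (rule someI)
  then have w': "w' \<in> carrier H" "P = orb w'"
    using w0 invariant_subset[OF invariant_orb[OF w0(1)]] orb_eq[OF w0(1)] by auto
  have "omg P \<in> R" using w' omg_orb_R by simp
  then have Nl: "\<not> l dvd N w'" and nzP: "star (omg (orb w')) \<noteq> 0"
    using P(2) star_mult[OF R_of_nat] star_of_nat_eq_0 w' unfolding w'_def by auto
  \<comment> \<open>A Sylow subgroup \<open>S\<close> of the stabilizer of \<open>w'\<close>
    permutes the factorizations of \<open>w'\<close> counted by \<open>N w'\<close>. Their number is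
    prime to \<open>l\<close>, so \<open>S\<close> fixes one of them.\<close>
  from Y.sylow_exists[OF finY prime_l subgroup_stab[OF w'(1)]]
  obtain S where S: "subgroup S Y" "S \<subseteq> stab w'" "card S = l_part l (card (stab w'))" by blast
  have SY: "S \<subseteq> carrier Y" using S(1) subgroup.subset by blast
  define E where "E = {(x, v). x \<in> L \<and> v \<in> orb w \<and> e x \<otimes>\<^bsub>H\<^esub> v = w'}"
  have E: "finite E" by (rule finite_subset[of _ "L \<times> orb w"])
      (use finL invariant_finite[OF inv_w] in \<open>auto simp: E_def\<close>)
  have oH: "v \<in> carrier H" if "v \<in> orb w" for v using invariant_subset[OF inv_w] that by blast
  have Ecar: "fst p \<in> carrier Y" "snd p \<in> carrier H" if "p \<in> E" for p
    using that LY oH by (auto simp: E_def)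
  define c where "c = (\<lambda>s p. (b s (fst p), act s (snd p)))"
  have c_E: "c s p \<in> E" if s: "s \<in> carrier (Y\<lparr>carrier := S\<rparr>)" and p: "p \<in> E" for s p
  proof -
    have s: "s \<in> carrier Y" "act s w' = w'" using s S SY by (auto simp: stab_def)
    obtain x v where xv: "p = (x, v)" "x \<in> L" "v \<in> orb w" "e x \<otimes>\<^bsub>H\<^esub> v = w'"
      using p unfolding E_def by blast
    have "e (b s x) \<otimes>\<^bsub>H\<^esub> act s v = act s (e x \<otimes>\<^bsub>H\<^esub> v)"
      using act_distrib[OF s(1) eL[OF xv(2)] oH[OF xv(3)]] eb[OF s(1) xv(2)] by simp
    also have "\<dots> = w'" unfolding xv(4) by (rule s(2))
    finally have "e (b s x) \<otimes>\<^bsub>H\<^esub> act s v = w'" .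
    then have "(b s x, act s v) \<in> E"
      using bL[OF s(1) xv(2)] invariant_act[OF inv_w s(1) xv(3)] unfolding E_def by blast
    then show ?thesis by (simp only: xv(1) fst_conv snd_conv c_def)
  qed
  have c_one: "c \<one>\<^bsub>Y\<lparr>carrier := S\<rparr>\<^esub> p = p" if "p \<in> E" for p
    using b1[OF Ecar(1)[OF that]] act_one[OF Ecar(2)[OF that]] by (simp add: c_def)
  have c_mult: "c (s \<otimes>\<^bsub>Y\<lparr>carrier := S\<rparr>\<^esub> t) p = c s (c t p)"
    if "s \<in> carrier (Y\<lparr>carrier := S\<rparr>)" "t \<in> carrier (Y\<lparr>carrier := S\<rparr>)" "p \<in> E" for s t p
    using conjY[of s t "fst p"] act_mult[of s t "snd p"] Ecar[OF that(3)] that(1,2) SY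
    by (simp add: subsetD c_def)
  have grp: "group (Y\<lparr>carrier := S\<rparr>)"
    using S(1) Y.is_group subgroup.subgroup_is_group by blast
  have ordS: "Coset.order (Y\<lparr>carrier := S\<rparr>) = l ^ multiplicity l (card (stab w'))"
    using S(3) by (simp add: Coset.order_def l_part_def)
  have "card E mod l = card {p \<in> E. \<forall>s\<in>carrier (Y\<lparr>carrier := S\<rparr>). c s p = p} mod l"
    using card_fixed_points_mod[OF grp prime_l ordS E, of c] c_E c_one c_mult by blast
  moreover have "card E = N w'" by (simp add: E_def N_def)
  ultimately have "card {p \<in> E. \<forall>s\<in>S. c s p = p} mod l \<noteq> 0"
    using Nl by (simp add: dvd_eq_mod_eq_0)
  then have "{p \<in> E. \<forall>s\<in>S. c s p = p} \<noteq> {}" by (metis card.empty mod_0)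
  then obtain x v where xv: "x \<in> L" "v \<in> orb w" "\<And>s. s \<in> S \<Longrightarrow> b s x = x" "\<And>s. s \<in> S \<Longrightarrow> act s v = v"
    by (auto simp: E_def c_def)
  \<comment> \<open>In the fixed factorization \<open>S\<close> centralizes \<open>x\<close>, a
    conjugate of \<open>u\<close>. Conjugating back by \<open>g\<close> moves \<open>S\<close> into
    the centralizer of \<open>u\<close>, in which \<open>D\<close> is Sylow.\<close>
  from xv(1) obtain g where g: "g \<in> carrier Y" "x = b g u" by (auto simp: L_eq)
  define S' where "S' = inv\<^bsub>Y\<^esub> g <#\<^bsub>Y\<^esub> S #>\<^bsub>Y\<^esub> g"
  have S'_eq: "S' = (\<lambda>s. inv\<^bsub>Y\<^esub> g \<otimes>\<^bsub>Y\<^esub> s \<otimes>\<^bsub>Y\<^esub> g) ` S"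
    by (auto simp: S'_def l_coset_def r_coset_def)
  have S': "subgroup S' Y" unfolding S'_def using Y.subgroup_conjugation_is_surj1[OF g(1) S(1)] .
  have "inj_on (\<lambda>s. inv\<^bsub>Y\<^esub> g \<otimes>\<^bsub>Y\<^esub> s \<otimes>\<^bsub>Y\<^esub> g) S"
    using g SY by (auto simp: inj_on_def subset_iff)
  then have cS': "card S' = l ^ multiplicity l (card (stab w'))"
    using S(3) card_image S'_eq by (metis l_part_def)
  have S'C: "S' \<subseteq> centralizer Y {u}"
  proof
    fix t assume "t \<in> S'"
    then obtain s where s: "s \<in> S" "t = inv\<^bsub>Y\<^esub> g \<otimes>\<^bsub>Y\<^esub> s \<otimes>\<^bsub>Y\<^esub> g" unfolding S'_eq by blast
    have sY: "s \<in> carrier Y" using s SY by blast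
    have "b t u = b (inv\<^bsub>Y\<^esub> g) (b s x)"
      using conjY[of "inv\<^bsub>Y\<^esub> g" s "b g u"] conjY[of "inv\<^bsub>Y\<^esub> g \<otimes>\<^bsub>Y\<^esub> s" g u] g sY u s xv(1) LY by auto
    also have "\<dots> = u" using xv(3)[OF s(1)] g conjY[of "inv\<^bsub>Y\<^esub> g" g u] u b1 by simp
    finally have "b t u = u" .
    then have "t \<otimes>\<^bsub>Y\<^esub> u = u \<otimes>\<^bsub>Y\<^esub> t"
      using s(2) sY g u by (simp add: b_def Y.inv_solve_right')
    then show "t \<in> centralizer Y {u}" using s(2) sY g by (simp add: centralizer_def)
  qed
  from Y.sylow_conj[OF finY prime_l C D(1,2,3) S' S'C cS']
  obtain y where y: "y \<in> centralizer Y {u}" "\<And>s. s \<in> S' \<Longrightarrow> y \<otimes>\<^bsub>Y\<^esub> s \<otimes>\<^bsub>Y\<^esub> inv\<^bsub>Y\<^esub> y \<in> D" by blast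
  have yY: "y \<in> carrier Y" using y(1) by (simp add: centralizer_def)
  have DY: "D \<subseteq> carrier Y" "finite D" using D(1) subgroup.subset finY finite_subset by blast+
  have S'Y: "S' \<subseteq> carrier Y" using S' subgroup.subset by blast
  \<comment> \<open>Height zero, applied to the orbit of \<open>w'\<close>, makes \<open>S'\<close>
    at least as large as \<open>D\<close>. Its conjugate inside \<open>D\<close> is therefore all of
    \<open>D\<close>.\<close>
  have "card D \<le> card S'"
  proof -
    have "multiplicity l (card D) \<le> multiplicity l (card (stab w'))"
      using card_stab_ge[OF w'(1) nzP _ height] Y.card_subgroup_pos[OF finY D(1)] by simp
    moreover have "card D = l ^ multiplicity l (card D)"
      using D(3) l_part_power[OF prime_l] by (metis l_part_def)
    ultimately show ?thesis
      using cS' prime_gt_1_nat[OF prime_l] by (metis power_increasing less_imp_le_nat)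
  qed
  moreover have "inj_on (\<lambda>s. y \<otimes>\<^bsub>Y\<^esub> s \<otimes>\<^bsub>Y\<^esub> inv\<^bsub>Y\<^esub> y) S'"
    using yY S'Y by (auto simp: inj_on_def subset_iff)
  ultimately have Dim: "(\<lambda>s. y \<otimes>\<^bsub>Y\<^esub> s \<otimes>\<^bsub>Y\<^esub> inv\<^bsub>Y\<^esub> y) ` S' = D"
    using y(2) DY(2) by (intro card_seteq) (auto simp: card_image)
  \<comment> \<open>\<open>z\<close> conjugates \<open>S\<close> onto \<open>D\<close>. As
    \<open>S\<close> fixes \<open>v\<close>, the group \<open>D\<close> fixes the translate of
    \<open>v\<close> by \<open>z\<close>, which is still in the orbit of \<open>w\<close>.\<close>
  define z where "z = y \<otimes>\<^bsub>Y\<^esub> inv\<^bsub>Y\<^esub> g"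
  have zY: "z \<in> carrier Y" using yY g by (simp add: z_def)
  have vH: "v \<in> carrier H" using oH xv(2) by simp
  have "d \<in> stab (act z v)" if "d \<in> D" for d
  proof -
    from that Dim S'_eq obtain s where s: "s \<in> S"
      "d = y \<otimes>\<^bsub>Y\<^esub> (inv\<^bsub>Y\<^esub> g \<otimes>\<^bsub>Y\<^esub> s \<otimes>\<^bsub>Y\<^esub> g) \<otimes>\<^bsub>Y\<^esub> inv\<^bsub>Y\<^esub> y" by auto
    have sY: "s \<in> carrier Y" using s SY by blast
    have dY: "d \<in> carrier Y" using s sY yY g by simp
    have "d \<otimes>\<^bsub>Y\<^esub> z = z \<otimes>\<^bsub>Y\<^esub> s"
      using sY yY g by (simp add: s(2) z_def Y.m_assoc Y.mult_inv_cancel)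
    then have "act d (act z v) = act z (act s v)"
      using act_mult[OF dY zY vH] act_mult[OF zY sY vH] by simp
    then show ?thesis using dY xv(4)[OF s(1)] by (simp add: stab_def)
  qed
  then show thesis using that[of "act z v"] invariant_act[OF inv_w zY xv(2)] by blast
qed

end

section \<open>Characters and blocks\<close>

lemma irreducible_imp_Irr:
  assumes "irreducible_rep H n \<rho>" "\<And>x. x \<in> carrier H \<Longrightarrow> \<chi> x = mat_trace (\<rho> x)"
  shows "restrict \<chi> (carrier H) \<in> Irr H"
  using assms unfolding Irr_def affords_def by (auto intro!: exI[of _ n] exI[of _ \<rho>])

lemma conj_classes_disjoint:
  assumes "group H" "C \<in> conj_classes H" "x \<in> C"
  shows "C = conj_class H x" "x \<in> carrier H"
proof -
  interpret group H by fact
  from assms(2) obtain y where y: "y \<in> carrier H" "C = conj_class H y" by (auto simp: conj_classes_def)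
  from assms(3) obtain g where g: "g \<in> carrier H" "x = g \<otimes>\<^bsub>H\<^esub> y \<otimes>\<^bsub>H\<^esub> inv\<^bsub>H\<^esub> g"
    by (auto simp: y conj_class_def)
  show x: "x \<in> carrier H" using g y by simp
  show "C = conj_class H x"
  proof (intro equalityI subsetI)
    fix z assume "z \<in> C"
    then obtain h where h: "h \<in> carrier H" "z = h \<otimes>\<^bsub>H\<^esub> y \<otimes>\<^bsub>H\<^esub> inv\<^bsub>H\<^esub> h" by (auto simp: y conj_class_def)
    let ?k = "h \<otimes>\<^bsub>H\<^esub> inv\<^bsub>H\<^esub> g"
    have "z = ?k \<otimes>\<^bsub>H\<^esub> x \<otimes>\<^bsub>H\<^esub> inv\<^bsub>H\<^esub> ?k"
      using g h y by (simp add: m_assoc inv_mult_group mult_inv_cancel)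
    moreover have "?k \<in> carrier H" using g h by simp
    ultimately show "z \<in> conj_class H x" unfolding conj_class_def by blast
  next
    fix z assume "z \<in> conj_class H x"
    then obtain h where h: "h \<in> carrier H" "z = h \<otimes>\<^bsub>H\<^esub> x \<otimes>\<^bsub>H\<^esub> inv\<^bsub>H\<^esub> h" by (auto simp: conj_class_def)
    have "z = (h \<otimes>\<^bsub>H\<^esub> g) \<otimes>\<^bsub>H\<^esub> y \<otimes>\<^bsub>H\<^esub> inv\<^bsub>H\<^esub> (h \<otimes>\<^bsub>H\<^esub> g)"
      using g h y by (simp add: m_assoc inv_mult_group)
    moreover have "h \<otimes>\<^bsub>H\<^esub> g \<in> carrier H" using g h by simp
    ultimately show "z \<in> C" unfolding y conj_class_def by blast
  qed
qed

lemma (in group) mem_conj_class: "x \<in> carrier G \<Longrightarrow> x \<in> conj_class G x"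
  unfolding conj_class_def by (auto intro!: exI[of _ \<one>])

text \<open>\<open>U\<close> is closed under conjugation, so the representative chosen in
  \<open>central_char\<close> lies in \<open>U\<close> exactly if its whole class does.\<close>

lemma central_char_indicator:
  assumes H: "group H" and fin: "finite (carrier H)"
    and U: "\<And>x h. x \<in> carrier H \<Longrightarrow> h \<in> carrier H \<Longrightarrow> x \<in> U \<Longrightarrow> h \<otimes>\<^bsub>H\<^esub> x \<otimes>\<^bsub>H\<^esub> inv\<^bsub>H\<^esub> h \<in> U"
  shows "central_char star H \<psi> (\<lambda>x. if x \<in> U then 1 else 0) =
    (\<Sum>C\<in>{C \<in> conj_classes H. C \<subseteq> U}. star (omega H \<psi> C))"
proof -
  interpret group H by fact
  have iff: "(SOME x. x \<in> C) \<in> U \<longleftrightarrow> C \<subseteq> U" if C: "C \<in> conj_classes H" for C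
  proof -
    from C obtain y where "y \<in> C" using mem_conj_class unfolding conj_classes_def by blast
    then have s: "(SOME x. x \<in> C) \<in> C" by (rule someI)
    note d = conj_classes_disjoint[OF H C s]
    show ?thesis
    proof
      assume u: "(SOME x. x \<in> C) \<in> U"
      show "C \<subseteq> U"
      proof
        fix z assume "z \<in> C"
        then obtain h where "h \<in> carrier H" "z = h \<otimes>\<^bsub>H\<^esub> (SOME x. x \<in> C) \<otimes>\<^bsub>H\<^esub> inv\<^bsub>H\<^esub> h"
          using d(1) unfolding conj_class_def by blast
        then show "z \<in> U" using U[OF d(2) _ u] by simp
      qed
    qed (use s in blast)
  qed
  have "finite (conj_classes H)" using fin by (simp add: conj_classes_def)
  then show ?thesis
    unfolding central_char_def using iff by (intro sum.mono_neutral_cong_right) auto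
qed

lemma indicator_center_group_algebra:
  assumes H: "group H" and sub: "U \<subseteq> carrier H"
    and U: "\<And>x h. x \<in> U \<Longrightarrow> h \<in> carrier H \<Longrightarrow> h \<otimes>\<^bsub>H\<^esub> x \<otimes>\<^bsub>H\<^esub> inv\<^bsub>H\<^esub> h \<in> U"
  shows "(\<lambda>x. if x \<in> U then 1 else (0::'k::field)) \<in> center_group_algebra H"
proof -
  interpret group H by fact
  have "h \<otimes>\<^bsub>H\<^esub> x \<otimes>\<^bsub>H\<^esub> inv\<^bsub>H\<^esub> h \<in> U \<longleftrightarrow> x \<in> U" if "x \<in> carrier H" "h \<in> carrier H" for x h
  proof
    assume "h \<otimes>\<^bsub>H\<^esub> x \<otimes>\<^bsub>H\<^esub> inv\<^bsub>H\<^esub> h \<in> U"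
    from U[OF this inv_closed[OF that(2)]] show "x \<in> U"
      using that by (simp add: m_assoc mult_inv_cancel)
  qed (use U that in blast)
  then show ?thesis using sub by (auto simp: center_group_algebra_def)
qed

lemma conj_class_closed:
  assumes "group H" "x \<in> carrier H"
  shows "conj_class H x \<subseteq> carrier H"
    and "\<And>y h. y \<in> conj_class H x \<Longrightarrow> h \<in> carrier H \<Longrightarrow> h \<otimes>\<^bsub>H\<^esub> y \<otimes>\<^bsub>H\<^esub> inv\<^bsub>H\<^esub> h \<in> conj_class H x"
proof -
  interpret group H by fact
  have C: "conj_class H x \<in> conj_classes H" using assms(2) by (simp add: conj_classes_def)
  show "conj_class H x \<subseteq> carrier H" using conj_classes_disjoint(2)[OF assms(1) C] by blast
  fix y h assume y: "y \<in> conj_class H x" and h: "h \<in> carrier H"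
  show "h \<otimes>\<^bsub>H\<^esub> y \<otimes>\<^bsub>H\<^esub> inv\<^bsub>H\<^esub> h \<in> conj_class H x"
    using conj_classes_disjoint(1)[OF assms(1) C y] h by (auto simp: conj_class_def)
qed

lemma central_char_class:
  assumes H: "group H" and fin: "finite (carrier H)" and x: "x \<in> carrier H"
  shows "central_char star H \<psi> (\<lambda>y. if y \<in> conj_class H x then 1 else 0) =
    star (omega H \<psi> (conj_class H x))"
proof -
  interpret group H by fact
  have C: "conj_class H x \<in> conj_classes H" using x by (simp add: conj_classes_def)
  have "{C \<in> conj_classes H. C \<subseteq> conj_class H x} = {conj_class H x}"
  proof (intro equalityI subsetI)
    fix B assume B: "B \<in> {C \<in> conj_classes H. C \<subseteq> conj_class H x}"
    then obtain y where y: "y \<in> B" using mem_conj_class unfolding conj_classes_def by blast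
    then have "y \<in> conj_class H x" using B by blast
    from conj_classes_disjoint(1)[OF H C this] conj_classes_disjoint(1)[OF H _ y] B
    show "B \<in> {conj_class H x}" by simp
  qed (use C in simp)
  then show ?thesis
    using central_char_indicator[OF H fin conj_class_closed(2)[OF H x], of star \<psi>] by simp
qed

text \<open>All characters in a block have the same central character, so the choice made in
  \<open>block_central_char\<close> is harmless.\<close>

lemma block_central_char_bl:
  assumes "\<psi> \<in> Irr H" "z \<in> center_group_algebra H"
  shows "block_central_char star H (bl star H \<psi>) z = central_char star H \<psi> z"
proof -
  have "\<psi> \<in> bl star H \<psi>" using assms(1) by (simp add: bl_def)
  then have "(SOME \<chi>. \<chi> \<in> bl star H \<psi>) \<in> bl star H \<psi>"
    by (rule someI[of "\<lambda>\<chi>. \<chi> \<in> bl star H \<psi>"])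
  then show ?thesis using assms(2) by (simp add: bl_def block_central_char_def)
qed

section \<open>Scalar action of the center\<close>

lemma (in group) subgroup_center: "subgroup (center G) G"
proof -
  have "center G = centralizer G (carrier G)" by (simp add: center_def centralizer_def)
  then show ?thesis using subgroup_centralizer by simp
qed

lemma (in group) center_commute: "z \<in> center G \<Longrightarrow> x \<in> carrier G \<Longrightarrow> z \<otimes> x = x \<otimes> z"
  and center_carrier: "z \<in> center G \<Longrightarrow> z \<in> carrier G"
  by (simp_all add: center_def)

lemma central_scalar:
  assumes H: "group H" and irr: "irreducible_rep H n \<rho>" and z: "z \<in> center H"
  shows "\<rho> z = (mat_trace (\<rho> z) / of_nat n) \<cdot>\<^sub>m 1\<^sub>m n"
proof -
  interpret representation H n \<rho> using irreducible_imp_representation[OF H irr] .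
  have zH: "z \<in> carrier H" using z by (simp add: center_def)
  have "\<rho> h * \<rho> z = \<rho> z * \<rho> h" if "h \<in> carrier H" for h
    using rep_mult[OF that zH] rep_mult[OF zH that] z that by (simp add: center_def)
  from schur_scalar[OF H irr rep_carrier[OF zH] this] obtain c where c: "\<rho> z = c \<cdot>\<^sub>m 1\<^sub>m n" by blast
  then have "mat_trace (\<rho> z) = c * of_nat n"
    using mat_trace_smult[of "1\<^sub>m n" n c] by (simp add: mat_trace_one)
  then show ?thesis using c rep_dim by simp
qed

lemma central_trace_mult:
  assumes H: "group H" and irr: "irreducible_rep H n \<rho>" and z: "z \<in> center H" and h: "h \<in> carrier H"
  shows "\<rho> (z \<otimes>\<^bsub>H\<^esub> h) = (mat_trace (\<rho> z) / of_nat n) \<cdot>\<^sub>m \<rho> h"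
proof -
  interpret representation H n \<rho> using irreducible_imp_representation[OF H irr] .
  have zH: "z \<in> carrier H" using z by (simp add: center_def)
  have "\<rho> (z \<otimes>\<^bsub>H\<^esub> h) = (mat_trace (\<rho> z) / of_nat n) \<cdot>\<^sub>m 1\<^sub>m n * \<rho> h"
    using rep_mult[OF zH h] central_scalar[OF H irr z] by simp
  also have "\<dots> = (mat_trace (\<rho> z) / of_nat n) \<cdot>\<^sub>m (1\<^sub>m n * \<rho> h)"
    by (rule mult_smult_assoc_mat[OF one_carrier_mat rep_carrier[OF h]])
  finally show ?thesis using rep_carrier[OF h] by simp
qed

text \<open>Central elements act as scalars, so \<chi>(zh) = \<chi>(z) \<chi>(h) / n. This makes the
  condition \<chi>(z) = n multiplicative on the center.\<close>

lemma subgroup_char_kernel_center: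
  assumes H: "group H" and chi: "\<chi> \<in> Irr H"
  shows "subgroup (char_kernel H \<chi> \<inter> center H) H"
proof -
  from chi obtain n \<rho> where irr: "irreducible_rep H n \<rho>" and tr: "\<And>x. x \<in> carrier H \<Longrightarrow> \<chi> x = mat_trace (\<rho> x)"
    by (elim IrrE) blast
  interpret representation H n \<rho> using irreducible_imp_representation[OF H irr] .
  interpret c: subgroup "center H" H by (rule subgroup_center)
  have scale: "\<chi> (z \<otimes>\<^bsub>H\<^esub> h) = \<chi> z / of_nat n * \<chi> h" if "z \<in> center H" "h \<in> carrier H" for z h
  proof -
    have zH: "z \<in> carrier H" using that(1) by (rule center_carrier)
    have "\<chi> (z \<otimes>\<^bsub>H\<^esub> h) = mat_trace ((mat_trace (\<rho> z) / of_nat n) \<cdot>\<^sub>m \<rho> h)"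
      using tr[of "z \<otimes>\<^bsub>H\<^esub> h"] zH that(2) central_trace_mult[OF H irr that] by simp
    then show ?thesis
      using mat_trace_smult[OF rep_carrier[OF that(2)]] tr[OF zH] tr[OF that(2)] by simp
  qed
  have one: "\<chi> \<one>\<^bsub>H\<^esub> = of_nat n" using tr trace_one by simp
  have nz: "(of_nat n :: complex) \<noteq> 0" using rep_dim by simp
  have ker: "char_kernel H \<chi> \<inter> center H = {z \<in> center H. \<chi> z = of_nat n}"
    by (auto simp: char_kernel_def one)
  show ?thesis unfolding ker
  proof
    fix x y assume "x \<in> {z \<in> center H. \<chi> z = of_nat n}" "y \<in> {z \<in> center H. \<chi> z = of_nat n}"
    then show "x \<otimes>\<^bsub>H\<^esub> y \<in> {z \<in> center H. \<chi> z = of_nat n}"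
      using scale[of x y] nz by simp
  next
    fix x assume x: "x \<in> {z \<in> center H. \<chi> z = of_nat n}"
    then have "\<chi> (inv\<^bsub>H\<^esub> x) = of_nat n" using scale[of x "inv\<^bsub>H\<^esub> x"] one rep_dim by simp
    then show "inv\<^bsub>H\<^esub> x \<in> {z \<in> center H. \<chi> z = of_nat n}" using x by simp
  qed (use one in auto)
qed

lemma root_of_unity_cnj:
  assumes "(c :: complex) ^ k = 1" "k > 0" shows "c * cnj c = 1"
proof -
  have "norm c ^ k = 1" using assms by (metis norm_one norm_power)
  then have "norm c = 1" using assms(2) by (metis norm_ge_zero power_eq_1_iff real_norm_def abs_of_nonneg
        not_gr0)
  then show ?thesis using complex_norm_square[of c] by simp
qed

text \<open>Translation of the summation variable by \<open>z\<close> multiplies the inner product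
  by \<open>\<phi> z * cnj (\<mu> z)\<close>, so this factor is 1; and \<open>\<mu> z\<close> is a
  root of unity, with inverse \<open>cnj (\<mu> z)\<close>.\<close>

lemma linear_characters_eq:
  assumes Z: "group Z" and fin: "finite (carrier Z)"
    and \<phi>: "\<And>x y. x \<in> carrier Z \<Longrightarrow> y \<in> carrier Z \<Longrightarrow> \<phi> (x \<otimes>\<^bsub>Z\<^esub> y) = \<phi> x * \<phi> y" "\<phi> \<one>\<^bsub>Z\<^esub> = 1"
    and \<mu>: "\<And>x y. x \<in> carrier Z \<Longrightarrow> y \<in> carrier Z \<Longrightarrow> \<mu> (x \<otimes>\<^bsub>Z\<^esub> y) = \<mu> x * \<mu> y" "\<mu> \<one>\<^bsub>Z\<^esub> = (1::complex)"
    and nz: "(\<Sum>x\<in>carrier Z. \<phi> x * cnj (\<mu> x)) \<noteq> 0" and z: "z \<in> carrier Z"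
  shows "\<phi> z = \<mu> z"
proof -
  interpret group Z by fact
  define f where "f = (\<lambda>x. \<phi> x * cnj (\<mu> x))"
  have bij: "bij_betw (\<lambda>x. z \<otimes>\<^bsub>Z\<^esub> x) (carrier Z) (carrier Z)"
    using z by (intro bij_betw_byWitness[where f' = "\<lambda>x. inv\<^bsub>Z\<^esub> z \<otimes>\<^bsub>Z\<^esub> x"]) (auto simp: mult_inv_cancel)
  have "(\<Sum>x\<in>carrier Z. f x) = (\<Sum>x\<in>carrier Z. f (z \<otimes>\<^bsub>Z\<^esub> x))"
    using sum.reindex_bij_betw[OF bij, of f] by simp
  also have "\<dots> = f z * (\<Sum>x\<in>carrier Z. f x)"
    using \<phi>(1) \<mu>(1) z by (simp add: f_def sum_distrib_left mult_ac)
  finally have "f z = 1" using nz unfolding f_def by simp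
  moreover have pow: "\<mu> (z [^]\<^bsub>Z\<^esub> k) = \<mu> z ^ k" for k :: nat
    using z by (induction k) (auto simp: \<mu> mult.commute)
  have "\<mu> z ^ Coset.order Z = 1" using pow[of "Coset.order Z"] pow_order_eq_1[OF z] \<mu>(2) by simp
  moreover have "Coset.order Z > 0" using fin order_gt_0_iff_finite by simp
  ultimately have "\<mu> z * cnj (\<mu> z) = 1" "\<phi> z * cnj (\<mu> z) = 1"
    using root_of_unity_cnj by (auto simp: f_def)
  then have "(\<phi> z - \<mu> z) * cnj (\<mu> z) = 0" "cnj (\<mu> z) \<noteq> 0" by (auto simp: algebra_simps)
  then show ?thesis by simp
qed

lemma linear_character_Irr:
  assumes Z: "group Z"
    and \<phi>: "\<And>x y. x \<in> carrier Z \<Longrightarrow> y \<in> carrier Z \<Longrightarrow> \<phi> (x \<otimes>\<^bsub>Z\<^esub> y) = \<phi> x * \<phi> y" "\<phi> \<one>\<^bsub>Z\<^esub> = (1::complex)"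
  shows "restrict \<phi> (carrier Z) \<in> Irr Z"
proof (rule irreducible_imp_Irr)
  interpret group Z by fact
  let ?r = "\<lambda>x. mat 1 1 (\<lambda>_. \<phi> x)"
  show "\<phi> x = mat_trace (?r x)" for x by (simp add: mat_trace_def)
  have mult: "?r (x \<otimes>\<^bsub>Z\<^esub> y) = ?r x * ?r y" if "x \<in> carrier Z" "y \<in> carrier Z" for x y
    using that by (intro eq_matI) (auto simp: \<phi> scalar_prod_def)
  have one: "?r \<one>\<^bsub>Z\<^esub> = 1\<^sub>m 1" by (intro eq_matI) (auto simp: \<phi>)
  have "?r \<in> hom Z (GL 1)"
  proof (rule homI)
    fix x assume x: "x \<in> carrier Z"
    show "?r x \<in> carrier (GL 1)"
      using mult[OF x inv_closed[OF x]] mult[OF inv_closed[OF x] x] x one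
      by (intro GL_I[of _ _ "?r (inv\<^bsub>Z\<^esub> x)"]) auto
  qed (simp only: GL_simps mult)
  moreover have "W = {0\<^sub>v 1} \<or> W = carrier_vec 1" if W: "invariant_subspace Z 1 ?r W" for W
  proof (cases "W = {0\<^sub>v 1}")
    case False
    then obtain v where v: "v \<in> W" "v \<noteq> 0\<^sub>v 1" using W by (auto simp: invariant_subspace_def)
    then have vc: "v \<in> carrier_vec 1" using W by (auto simp: invariant_subspace_def)
    then have "v $ 0 \<noteq> 0" using v(2) by (metis eq_vecI carrier_vecD index_zero_vec less_one)
    then have "w = (w $ 0 / v $ 0) \<cdot>\<^sub>v v" if "w \<in> carrier_vec 1" for w
      using that vc by (intro eq_vecI) auto
    moreover have "c \<cdot>\<^sub>v v \<in> W" for c using W v by (auto simp: invariant_subspace_def)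
    ultimately have "carrier_vec 1 \<subseteq> W" by (metis subsetI)
    then show ?thesis using W by (auto simp: invariant_subspace_def)
  qed simp
  ultimately show "irreducible_rep Z 1 ?r" by (simp add: irreducible_rep_def)
qed

section \<open>Radical subgroups and the center\<close>

context group
begin

lemma pow_card_subgroup:
  assumes "finite (carrier G)" "subgroup P G" "p \<in> P"
  shows "p [^] card P = \<one>"
proof -
  interpret P: group "G\<lparr>carrier := P\<rparr>" using assms(2) subgroup.subgroup_is_group is_group by blast
  have "p [^]\<^bsub>G\<lparr>carrier := P\<rparr>\<^esub> card P = \<one>"
    using P.pow_order_eq_1[of p] assms(3) by (simp add: Coset.order_def)
  then show ?thesis using nat_pow_consistent by metis
qed

text \<open>The cyclic group generated by \<open>z\<close> is a central \<open>l\<close>-subgroup of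
  the normalizer of \<open>D\<close>, hence contained in the \<open>l\<close>-core of that
  normalizer, which is \<open>D\<close>.\<close>

lemma l_element_center_in_radical:
  assumes fin: "finite (carrier G)" and l: "Factorial_Ring.prime l" and D: "radical_subgroup l G D"
    and z: "z \<in> center G" "z [^] (l ^ k) = \<one>"
  shows "z \<in> D"
proof -
  define N where "N = normalizer G D"
  interpret Z: subgroup "center G" G by (rule subgroup_center)
  have DG: "D \<subseteq> carrier G" using D subgroup.subset by (auto simp: radical_subgroup_def l_subgroup_def)
  have zG: "z \<in> carrier G" using z by simp
  have N: "subgroup N G" unfolding N_def using normalizer_imp_subgroup DG by simp
  have ZN: "center G \<subseteq> N"
  proof
    fix y assume y: "y \<in> center G"
    have "y \<otimes> d \<otimes> inv y = d" if "d \<in> D" for d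
      using center_commute[OF y, of d] that DG center_carrier[OF y] by (auto simp: m_assoc)
    then show "y \<in> N"
      unfolding N_def using normalizer_iff[OF DG finite_subset[OF DG fin]] y center_carrier by auto
  qed
  define P where "P = generate G {z}"
  have P: "subgroup P G" unfolding P_def using generate_is_subgroup zG by simp
  have PZ: "P \<subseteq> center G" unfolding P_def using generate_subgroup_incl[of "{z}" "center G"] z subgroup_center by simp
  interpret N: group "G\<lparr>carrier := N\<rparr>" using N subgroup.subgroup_is_group is_group by blast
  have PN: "subgroup P (G\<lparr>carrier := N\<rparr>)" using subgroup_incl[OF P N] PZ ZN by blast
  have "P \<lhd> G\<lparr>carrier := N\<rparr>"
  proof (rule N.normal_invI[OF PN])
    fix x h assume x: "x \<in> carrier (G\<lparr>carrier := N\<rparr>)" and h: "h \<in> P"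
    have xG: "x \<in> carrier G" using x N subgroup.subset by auto
    have hZ: "h \<in> center G" using h PZ by blast
    have "x \<otimes> h \<otimes> inv x = h"
      using center_commute[OF hZ xG] center_carrier[OF hZ] xG by (metis m_assoc r_inv r_one inv_closed)
    then show "x \<otimes>\<^bsub>G\<lparr>carrier := N\<rparr>\<^esub> h \<otimes>\<^bsub>G\<lparr>carrier := N\<rparr>\<^esub> inv\<^bsub>G\<lparr>carrier := N\<rparr>\<^esub> x \<in> P"
      using x h m_inv_consistent[OF N] by simp
  qed
  moreover have "l_subgroup l (G\<lparr>carrier := N\<rparr>) P"
  proof -
    have "card P = ord z" unfolding P_def using generate_pow_card[OF zG] by simp
    then have "card P dvd l ^ k" using pow_eq_id[OF zG] z(2) by simp
    then have "\<exists>j. card P = l ^ j" using l divides_primepow_nat by blast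
    then show ?thesis using PN by (simp add: l_subgroup_def)
  qed
  moreover have "z \<in> P" unfolding P_def by (rule generate.incl) simp
  ultimately have "z \<in> l_core l (G\<lparr>carrier := N\<rparr>)"
    unfolding l_core_def by (intro generate.incl) blast
  then show ?thesis using D by (simp add: radical_subgroup_def N_def)
qed

text \<open>In \<open>x = d \<otimes> z\<close> the factors commute, so \<open>z\<close> inherits an
  order that is a power of \<open>l\<close> from \<open>x\<close> and \<open>d\<close>, and the
  previous lemma puts it into \<open>D\<close>.\<close>

lemma l_element_mult_center_in_radical:
  assumes fin: "finite (carrier G)" and l: "Factorial_Ring.prime l" and D: "radical_subgroup l G D"
    and x: "x \<in> D <#> center G" "x [^] (l ^ k) = \<one>"
  shows "x \<in> D"
proof -
  have Ds: "subgroup D G" using D by (simp add: radical_subgroup_def l_subgroup_def)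
  obtain j where j: "card D = l ^ j" using D by (auto simp: radical_subgroup_def l_subgroup_def)
  from x(1) obtain d z where dz: "d \<in> D" "z \<in> center G" "x = d \<otimes> z" by (auto simp: set_mult_def)
  have c: "d \<in> carrier G" "z \<in> carrier G" using dz Ds subgroup.subset center_carrier by blast+
  have "d [^] (l ^ j) = \<one>" using pow_card_subgroup[OF fin Ds dz(1)] j by simp
  then have d1: "d [^] (l ^ j * l ^ k) = \<one>" using c by (simp add: nat_pow_pow[symmetric])
  have "x [^] (l ^ k * l ^ j) = \<one>" using x(2) c dz(3) by (simp add: nat_pow_pow[symmetric])
  moreover have "x [^] (l ^ k * l ^ j) = d [^] (l ^ k * l ^ j) \<otimes> z [^] (l ^ k * l ^ j)"
    using pow_mult_distrib[OF _ c] center_commute[OF dz(2) c(1)] dz(3) by simp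
  ultimately have "z [^] (l ^ (k + j)) = \<one>" using d1 c by (simp add: mult.commute power_add)
  then have "z \<in> D" using l_element_center_in_radical[OF fin l D dz(2)] by blast
  then show ?thesis using dz Ds subgroup.m_closed by metis
qed

lemma subgroup_mult_center:
  assumes "subgroup D G" shows "subgroup (D <#> center G) G"
proof
  interpret D: subgroup D G by fact
  interpret Z: subgroup "center G" G by (rule subgroup_center)
  show "D <#> center G \<subseteq> carrier G" by (auto simp: set_mult_def)
  fix x assume "x \<in> D <#> center G"
  then obtain d z where x: "x = d \<otimes> z" "d \<in> D" "z \<in> center G" by (auto simp: set_mult_def)
  have "inv x = inv d \<otimes> inv z"
    using x center_commute[of "inv z" "inv d"] by (simp add: inv_mult_group)
  then show "inv x \<in> D <#> center G" using x by (auto simp: set_mult_def)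
  fix y assume "y \<in> D <#> center G"
  then obtain d' z' where y: "y = d' \<otimes> z'" "d' \<in> D" "z' \<in> center G" by (auto simp: set_mult_def)
  have "x \<otimes> y = d \<otimes> (z \<otimes> d') \<otimes> z'" using x y by (simp add: m_assoc)
  also have "z \<otimes> d' = d' \<otimes> z" using center_commute x y by simp
  finally have "x \<otimes> y = (d \<otimes> d') \<otimes> (z \<otimes> z')" using x y by (simp add: m_assoc)
  then show "x \<otimes> y \<in> D <#> center G" using x y by (auto simp: set_mult_def)
next
  show "\<one> \<in> D <#> center G"
    using subgroup.one_closed[OF assms] subgroup.one_closed[OF subgroup_center]
    by (force simp: set_mult_def)
qed

text \<open>A Sylow \<open>l\<close>-subgroup of the product consists of \<open>l\<close>-elements,
  which all lie in \<open>D\<close>.\<close>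

lemma l_part_card_mult_center:
  assumes fin: "finite (carrier G)" and l: "Factorial_Ring.prime l" and D: "radical_subgroup l G D"
  shows "l_part l (card (D <#> center G)) = card D"
proof -
  have Ds: "subgroup D G" using D by (simp add: radical_subgroup_def l_subgroup_def)
  have DG: "D \<subseteq> carrier G" using Ds subgroup.subset by blast
  obtain j where j: "card D = l ^ j" using D by (auto simp: radical_subgroup_def l_subgroup_def)
  note DZ = subgroup_mult_center[OF Ds]
  have sub: "D \<subseteq> D <#> center G"
  proof
    fix d assume "d \<in> D"
    then have "d = d \<otimes> \<one>" "\<one> \<in> center G" using DG subgroup.one_closed[OF subgroup_center] by auto
    then show "d \<in> D <#> center G" using \<open>d \<in> D\<close> unfolding set_mult_def by blast
  qed
  from sylow_exists[OF fin l DZ] obtain P where P: "subgroup P G" "P \<subseteq> D <#> center G"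
    "card P = l_part l (card (D <#> center G))" by blast
  have "P \<subseteq> D"
  proof
    fix x assume x: "x \<in> P"
    have "x [^] (l ^ multiplicity l (card (D <#> center G))) = \<one>"
      using pow_card_subgroup[OF fin P(1) x] P(3) by (simp add: l_part_def)
    then show "x \<in> D" using l_element_mult_center_in_radical[OF fin l D] P(2) x by blast
  qed
  then have "card P \<le> card D" using DG fin by (meson card_mono finite_subset)
  moreover have "card D \<le> l_part l (card (D <#> center G))"
    using card_subgroup_dvd[OF fin Ds DZ sub] l_part_prime_dvd_le[OF l] card_subgroup_pos[OF fin DZ] j by metis
  ultimately show ?thesis using P(3) by simp
qed

lemma conj_central:
  assumes "z \<in> center G" "p \<in> carrier G" "y \<in> carrier G"
  shows "(z \<otimes> p) \<otimes> y \<otimes> inv (z \<otimes> p) = p \<otimes> y \<otimes> inv p"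
proof -
  have z: "z \<in> carrier G" using assms(1) by (rule center_carrier)
  have "(z \<otimes> p) \<otimes> y \<otimes> inv (z \<otimes> p) = z \<otimes> (p \<otimes> y \<otimes> inv p) \<otimes> inv z"
    using z assms by (simp add: inv_mult_group m_assoc)
  also have "z \<otimes> (p \<otimes> y \<otimes> inv p) = (p \<otimes> y \<otimes> inv p) \<otimes> z"
    using center_commute[OF assms(1)] assms by simp
  finally show ?thesis using z assms by (simp add: m_assoc)
qed

lemma mult_central_cancel:
  assumes "w \<in> center G" "q \<in> carrier G" "y \<in> carrier G"
  shows "w \<otimes> y \<otimes> inv (w \<otimes> q) = y \<otimes> inv q"
proof -
  have w: "w \<in> carrier G" using assms(1) by (rule center_carrier)
  have "w \<otimes> y \<otimes> inv (w \<otimes> q) = w \<otimes> (y \<otimes> inv q) \<otimes> inv w"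
    using w assms by (simp add: inv_mult_group m_assoc)
  also have "w \<otimes> (y \<otimes> inv q) = (y \<otimes> inv q) \<otimes> w"
    using center_commute[OF assms(1)] assms by simp
  finally show ?thesis using w assms by (simp add: m_assoc)
qed

text \<open>Two maps that agree up to central factors thus agree on commutators, which is how
  perfectness of \<open>G\<close> is used.\<close>

lemma commutator_central:
  assumes "z \<in> center G" "w \<in> center G" "p \<in> carrier G" "q \<in> carrier G"
  shows "(z \<otimes> p) \<otimes> (w \<otimes> q) \<otimes> inv (z \<otimes> p) \<otimes> inv (w \<otimes> q) = p \<otimes> q \<otimes> inv p \<otimes> inv q"
proof -
  have c: "z \<in> carrier G" "w \<in> carrier G" using assms center_carrier by auto
  have "(z \<otimes> p) \<otimes> (w \<otimes> q) \<otimes> inv (z \<otimes> p) = p \<otimes> (w \<otimes> q) \<otimes> inv p"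
    using conj_central[OF assms(1,3)] c assms by simp
  also have "\<dots> = w \<otimes> (p \<otimes> q \<otimes> inv p)"
    using center_commute[OF assms(2,3)] c assms by (metis inv_closed m_assoc m_closed)
  finally show ?thesis using mult_central_cancel[OF assms(2,4)] assms by simp
qed

section \<open>Automorphisms\<close>

lemma autoD:
  assumes "x \<in> auto G"
  shows "g \<in> carrier G \<Longrightarrow> x g \<in> carrier G"
    and "g \<in> carrier G \<Longrightarrow> h \<in> carrier G \<Longrightarrow> x (g \<otimes> h) = x g \<otimes> x h"
    and "x \<in> extensional (carrier G)" and "bij_betw x (carrier G) (carrier G)"
    and "x \<in> hom G G"
  using assms by (auto simp: auto_def hom_def Bij_def)

lemma auto_eqI:
  assumes "x \<in> auto G" "y \<in> auto G" "\<And>g. g \<in> carrier G \<Longrightarrow> x g = y g"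
  shows "x = y"
  using assms autoD(3) extensionalityI by metis

lemma AutoGroup_mult:
  assumes "x \<in> auto G" "y \<in> auto G" "g \<in> carrier G"
  shows "(x \<otimes>\<^bsub>AutoGroup G\<^esub> y) g = x (y g)"
  using assms by (simp add: AutoGroup_def BijGroup_def auto_def compose_def)

lemma AutoGroup_one: "\<one>\<^bsub>AutoGroup G\<^esub> = (\<lambda>g\<in>carrier G. g)"
  by (simp add: AutoGroup_def BijGroup_def)

lemma carrier_AutoGroup: "carrier (AutoGroup G) = auto G"
  by (simp add: AutoGroup_def)

lemma auto_mult_closed: "x \<in> auto G \<Longrightarrow> y \<in> auto G \<Longrightarrow> x \<otimes>\<^bsub>AutoGroup G\<^esub> y \<in> auto G"
  using group.is_monoid[OF AutoGroup] monoid.m_closed carrier_AutoGroup by metis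

lemma auto_hom: "x \<in> auto G \<Longrightarrow> group_hom G G x"
  using autoD(5) is_group by (simp add: group_hom_def group_hom_axioms_def)

lemma inner_auto: assumes g: "g \<in> carrier G" shows "inner G g \<in> auto G"
proof -
  have "inner G g \<in> hom G G"
    using g by (intro homI) (simp_all add: inner_def m_assoc mult_inv_cancel)
  moreover have "bij_betw (inner G g) (carrier G) (carrier G)"
    using g by (intro bij_betw_byWitness[where f' = "\<lambda>x. inv g \<otimes> x \<otimes> g"])
      (auto simp: inner_def m_assoc mult_inv_cancel)
  ultimately show ?thesis by (simp add: auto_def Bij_def inner_def)
qed

lemma inner_mult:
  assumes "g \<in> carrier G" "h \<in> carrier G"
  shows "inner G (g \<otimes> h) = inner G g \<otimes>\<^bsub>AutoGroup G\<^esub> inner G h"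
proof (rule auto_eqI)
  fix x assume x: "x \<in> carrier G"
  show "inner G (g \<otimes> h) x = (inner G g \<otimes>\<^bsub>AutoGroup G\<^esub> inner G h) x"
    using AutoGroup_mult[OF inner_auto inner_auto x] assms x
    by (simp add: inner_def m_assoc inv_mult_group)
qed (use assms inner_auto auto_mult_closed in simp_all)

lemma inner_eq_iff:
  assumes g: "g \<in> carrier G" and h: "h \<in> carrier G"
  shows "inner G g = inner G h \<longleftrightarrow> g \<in> center G #> h"
proof
  assume eq: "inner G g = inner G h"
  have "g \<otimes> inv h \<otimes> x = x \<otimes> (g \<otimes> inv h)" if x: "x \<in> carrier G" for x
  proof -
    have "inner G g (inv h \<otimes> x \<otimes> h) = inner G h (inv h \<otimes> x \<otimes> h)" using eq by simp
    then have "g \<otimes> (inv h \<otimes> x \<otimes> h) \<otimes> inv g = x"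
      using g h x by (simp add: inner_def m_assoc mult_inv_cancel)
    then have "g \<otimes> (inv h \<otimes> x \<otimes> h) = x \<otimes> g"
      using g h x by (metis inv_solve_right' inv_closed m_closed)
    then have "g \<otimes> inv h \<otimes> x \<otimes> h = x \<otimes> g" using g h x by (simp add: m_assoc)
    then have "g \<otimes> inv h \<otimes> x = x \<otimes> g \<otimes> inv h"
      using g h x by (metis inv_solve_right inv_closed m_closed)
    then show ?thesis using g h x by (simp add: m_assoc)
  qed
  then have "g \<otimes> inv h \<in> center G" using g h by (simp add: center_def)
  moreover have "g = g \<otimes> inv h \<otimes> h" using g h by (simp add: m_assoc)
  ultimately show "g \<in> center G #> h" unfolding r_coset_def by blast
next
  assume "g \<in> center G #> h"
  then obtain z where z: "z \<in> center G" "g = z \<otimes> h" by (auto simp: r_coset_def)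
  then show "inner G g = inner G h" using conj_central[OF z(1) h] by (auto simp: inner_def)
qed

text \<open>The fibers of \<open>inner G\<close> are cosets of the center, all of the same size and
  contained in \<open>U\<close>.\<close>

lemma card_inner_image:
  assumes fin: "finite (carrier G)" and U: "U \<subseteq> carrier G"
    and cosets: "\<And>u z. u \<in> U \<Longrightarrow> z \<in> center G \<Longrightarrow> z \<otimes> u \<in> U"
  shows "card U = card (inner G ` U) * card (center G)"
proof -
  have finU: "finite U" using fin U finite_subset by blast
  have fib: "card {u \<in> U. inner G u = s} = card (center G)" if "s \<in> inner G ` U" for s
  proof -
    from that obtain h where h: "h \<in> U" "s = inner G h" by blast
    have hG: "h \<in> carrier G" using h U by blast
    have "{u \<in> U. inner G u = s} = (\<lambda>z. z \<otimes> h) ` center G"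
      using inner_eq_iff[OF _ hG] U h cosets[OF h(1)] by (auto simp: r_coset_def subset_iff)
    moreover have "inj_on (\<lambda>z. z \<otimes> h) (center G)"
      using hG center_carrier by (auto simp: inj_on_def)
    ultimately show ?thesis by (simp add: card_image)
  qed
  have "card U = (\<Sum>s\<in>inner G ` U. card {u \<in> U. inner G u = s})"
    using finU sum.group[of U "inner G ` U" "inner G" "\<lambda>_. 1::nat"] by simp
  then show ?thesis using fib by simp
qed

end

section \<open>Automorphisms induced by an overgroup\<close>

text \<open>The embedding of the quotient of \<open>G\<close> is replaced by a homomorphism
  \<open>e\<close> on \<open>G\<close> with central kernel, so that all computations stay with
  elements of \<open>G\<close>.\<close>

locale AM_overgroup = G: group G + A: group A
  for G :: "'a monoid" and A :: "'c monoid" +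
  fixes l :: nat and D M :: "'a set" and \<chi> :: "'a \<Rightarrow> complex"
    and e :: "'a \<Rightarrow> 'c" and \<kappa> :: "'c set \<Rightarrow> 'a \<Rightarrow> 'a"
  assumes finG: "finite (carrier G)" and finA: "finite (carrier A)"
    and perfect: "derived G (carrier G) = carrier G"
    and l: "Factorial_Ring.prime l" and D: "radical_subgroup l G D" and M: "AM_subgroup G D M"
    and e_hom: "e \<in> hom G A" and e_ker: "g \<in> carrier G \<Longrightarrow> e g = \<one>\<^bsub>A\<^esub> \<Longrightarrow> g \<in> center G"
    and cent: "centralizer A (e ` carrier G) = center A"
    and \<kappa>: "\<kappa> \<in> iso (A Mod center A) (AutoGroup G\<lparr>carrier := Aut_char G \<chi>\<rparr>)"
    and conj: "a \<in> carrier A \<Longrightarrow> g \<in> carrier G \<Longrightarrow>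
      e (\<kappa> (center A #>\<^bsub>A\<^esub> a) g) = a \<otimes>\<^bsub>A\<^esub> e g \<otimes>\<^bsub>A\<^esub> inv\<^bsub>A\<^esub> a"
begin

sublocale e: group_hom G A e
  using e_hom G.is_group A.is_group by (simp add: group_hom_def group_hom_axioms_def)

text \<open>The canonical isomorphism \<open>\<kappa>\<close> read on \<open>A\<close> itself: a
  homomorphism onto \<open>Aut_char G \<chi>\<close> with kernel the center of
  \<open>A\<close>.\<close>

definition \<sigma> :: "'c \<Rightarrow> 'a \<Rightarrow> 'a" where "\<sigma> a = \<kappa> (center A #>\<^bsub>A\<^esub> a)"

definition nA :: "'c set" where "nA = normalizer A (e ` D)"

definition N :: "'c set" where "N = (e ` M) <#>\<^bsub>A\<^esub> nA"

lemma e_eq: assumes "g \<in> carrier G" "h \<in> carrier G" "e g = e h"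
  obtains z where "z \<in> center G" "g = z \<otimes>\<^bsub>G\<^esub> h"
proof -
  have "e (g \<otimes>\<^bsub>G\<^esub> inv\<^bsub>G\<^esub> h) = \<one>\<^bsub>A\<^esub>" using assms by simp
  then have "g \<otimes>\<^bsub>G\<^esub> inv\<^bsub>G\<^esub> h \<in> center G" using e_ker assms by simp
  moreover have "g = g \<otimes>\<^bsub>G\<^esub> inv\<^bsub>G\<^esub> h \<otimes>\<^bsub>G\<^esub> h" using assms by (simp add: G.m_assoc)
  ultimately show thesis using that by blast
qed

lemma center_normal: "center A \<lhd> A"
proof (rule A.normal_invI[OF A.subgroup_center])
  fix x h assume x: "x \<in> carrier A" and h: "h \<in> center A"
  then have "x \<otimes>\<^bsub>A\<^esub> h \<otimes>\<^bsub>A\<^esub> inv\<^bsub>A\<^esub> x = h"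
    using A.center_commute[OF h x] A.center_carrier[OF h] by (simp add: A.m_assoc flip: A.center_commute)
  then show "x \<otimes>\<^bsub>A\<^esub> h \<otimes>\<^bsub>A\<^esub> inv\<^bsub>A\<^esub> x \<in> center A" using h by simp
qed

lemma Aut_char_auto: "x \<in> Aut_char G \<chi> \<Longrightarrow> x \<in> auto G"
  by (simp add: Aut_char_def)

lemma coset_carrier: "a \<in> carrier A \<Longrightarrow> center A #>\<^bsub>A\<^esub> a \<in> carrier (A Mod center A)"
  by (auto simp: FactGroup_def RCOSETS_def)

lemma \<sigma>_Aut_char: "a \<in> carrier A \<Longrightarrow> \<sigma> a \<in> Aut_char G \<chi>"
  using iso_imp_homomorphism[OF \<kappa>] coset_carrier by (auto simp: \<sigma>_def hom_def)

lemma \<sigma>_auto: "a \<in> carrier A \<Longrightarrow> \<sigma> a \<in> auto G"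
  using \<sigma>_Aut_char Aut_char_auto by blast

lemma \<sigma>_conj: "a \<in> carrier A \<Longrightarrow> g \<in> carrier G \<Longrightarrow> e (\<sigma> a g) = a \<otimes>\<^bsub>A\<^esub> e g \<otimes>\<^bsub>A\<^esub> inv\<^bsub>A\<^esub> a"
  using conj by (simp add: \<sigma>_def)

lemma \<sigma>_mult:
  assumes "a \<in> carrier A" "b \<in> carrier A"
  shows "\<sigma> (a \<otimes>\<^bsub>A\<^esub> b) = \<sigma> a \<otimes>\<^bsub>AutoGroup G\<^esub> \<sigma> b"
proof -
  have "(center A #>\<^bsub>A\<^esub> a) <#>\<^bsub>A\<^esub> (center A #>\<^bsub>A\<^esub> b) = center A #>\<^bsub>A\<^esub> (a \<otimes>\<^bsub>A\<^esub> b)"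
    using normal.rcos_sum[OF center_normal assms] .
  then show ?thesis
    using hom_mult[OF iso_imp_homomorphism[OF \<kappa>] coset_carrier[OF assms(1)] coset_carrier[OF assms(2)]]
    by (simp add: \<sigma>_def FactGroup_def)
qed

lemma \<sigma>_hom: "group_hom A (AutoGroup G) \<sigma>"
  unfolding group_hom_def group_hom_axioms_def
  using A.is_group G.AutoGroup \<sigma>_auto \<sigma>_mult by (auto simp: hom_def G.carrier_AutoGroup)

lemma \<sigma>_surj: assumes "x \<in> Aut_char G \<chi>" obtains a where "a \<in> carrier A" "\<sigma> a = x"
proof -
  have "\<kappa> ` carrier (A Mod center A) = Aut_char G \<chi>"
    using \<kappa> by (auto simp: iso_def bij_betw_def)
  then obtain c where "c \<in> carrier (A Mod center A)" "x = \<kappa> c" using assms by blast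
  then show thesis using that by (auto simp: FactGroup_def RCOSETS_def \<sigma>_def)
qed

lemma \<sigma>_eq:
  assumes "a \<in> carrier A" "b \<in> carrier A" "\<sigma> a = \<sigma> b"
  obtains z where "z \<in> center A" "a = z \<otimes>\<^bsub>A\<^esub> b"
proof -
  have "inj_on \<kappa> (carrier (A Mod center A))" using \<kappa> by (auto simp: iso_def bij_betw_def)
  then have "center A #>\<^bsub>A\<^esub> a = center A #>\<^bsub>A\<^esub> b"
    using assms coset_carrier unfolding \<sigma>_def inj_on_def by blast
  moreover have "a \<in> center A #>\<^bsub>A\<^esub> a" using A.rcos_self[OF assms(1) A.subgroup_center] .
  ultimately show thesis using that by (auto simp: r_coset_def)
qed

text \<open>Both \<open>\<sigma> (e g)\<close> and the inner automorphism induce the same automorphism of \<open>G\<close> modulo the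
  center, so they agree on commutators.\<close>

lemma \<sigma>_e: assumes g: "g \<in> carrier G" shows "\<sigma> (e g) = inner G g"
proof (rule G.auto_eqI)
  define s where "s = \<sigma> (e g)"
  define t where "t = inner G g"
  show sa: "\<sigma> (e g) \<in> auto G" and ta: "inner G g \<in> auto G" using \<sigma>_auto G.inner_auto g by auto
  interpret s: group_hom G G s unfolding s_def using G.auto_hom[OF sa] .
  interpret t: group_hom G G t unfolding t_def using G.auto_hom[OF ta] .
  have st: "\<exists>z\<in>center G. s x = z \<otimes>\<^bsub>G\<^esub> t x" if x: "x \<in> carrier G" for x
  proof -
    have "e (s x) = e (t x)" using \<sigma>_conj[of "e g" x] g x by (simp add: s_def t_def inner_def)
    then show ?thesis using e_eq[OF s.hom_closed[OF x] t.hom_closed[OF x]] by metis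
  qed
  define E where "E = {x \<in> carrier G. s x = t x}"
  have E: "subgroup E G"
    by unfold_locales (auto simp: E_def)
  have "derived_set G (carrier G) \<subseteq> E"
  proof
    fix c assume "c \<in> derived_set G (carrier G)"
    then obtain x y where xy: "x \<in> carrier G" "y \<in> carrier G"
      "c = x \<otimes>\<^bsub>G\<^esub> y \<otimes>\<^bsub>G\<^esub> inv\<^bsub>G\<^esub> x \<otimes>\<^bsub>G\<^esub> inv\<^bsub>G\<^esub> y" by blast
    from st[OF xy(1)] st[OF xy(2)] obtain z w where zw: "z \<in> center G" "w \<in> center G"
      "s x = z \<otimes>\<^bsub>G\<^esub> t x" "s y = w \<otimes>\<^bsub>G\<^esub> t y" by blast
    have "s c = s x \<otimes>\<^bsub>G\<^esub> s y \<otimes>\<^bsub>G\<^esub> inv\<^bsub>G\<^esub> s x \<otimes>\<^bsub>G\<^esub> inv\<^bsub>G\<^esub> s y"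
      using xy by (simp add: s.hom_inv)
    also have "\<dots> = t x \<otimes>\<^bsub>G\<^esub> t y \<otimes>\<^bsub>G\<^esub> inv\<^bsub>G\<^esub> t x \<otimes>\<^bsub>G\<^esub> inv\<^bsub>G\<^esub> t y"
      unfolding zw(3,4) using G.commutator_central[OF zw(1,2)] xy by simp
    also have "\<dots> = t c" using xy by (simp add: t.hom_inv)
    finally show "c \<in> E" using xy by (simp add: E_def)
  qed
  then have "generate G (derived_set G (carrier G)) \<subseteq> E" using G.generate_subgroup_incl E by blast
  then have "carrier G \<subseteq> E" using perfect by (simp add: derived_def)
  then show "\<sigma> (e g) x = inner G g x" if "x \<in> carrier G" for x
    using that by (auto simp: E_def s_def t_def)
qed

lemma subgroup_D: "subgroup D G" and subgroup_M: "subgroup M G"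
  and normalizer_le: "normalizer G D \<subseteq> M"
  and M_stable: "x \<in> Aut_set G D \<Longrightarrow> x ` M = M"
  using D M by (auto simp: radical_subgroup_def l_subgroup_def AM_subgroup_def)

lemma D_carrier: "D \<subseteq> carrier G" and M_carrier: "M \<subseteq> carrier G"
  using subgroup_D subgroup_M subgroup.subset by blast+

lemma card_D: obtains r where "card D = l ^ r"
  using D by (auto simp: radical_subgroup_def l_subgroup_def)

lemma D_M: "D \<subseteq> M"
proof -
  have "D \<subseteq> normalizer G D"
    using G.normalizer_iff[OF D_carrier finite_subset[OF D_carrier finG]] subgroup_D
    by (auto intro!: subgroup.m_closed subgroup.m_inv_closed subgroup.mem_carrier)
  then show ?thesis using normalizer_le by blast
qed

lemma nA_iff: "a \<in> nA \<longleftrightarrow> a \<in> carrier A \<and> (\<forall>d\<in>D. a \<otimes>\<^bsub>A\<^esub> e d \<otimes>\<^bsub>A\<^esub> inv\<^bsub>A\<^esub> a \<in> e ` D)"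
proof -
  have "e ` D \<subseteq> carrier A" using D_carrier by auto
  moreover have "finite (e ` D)" using finite_subset[OF D_carrier finG] by simp
  ultimately show ?thesis unfolding nA_def using A.normalizer_iff by simp
qed

lemma subgroup_nA: "subgroup nA A"
  unfolding nA_def using D_carrier by (intro A.normalizer_imp_subgroup) auto

lemma center_nA: "center A \<subseteq> nA"
proof
  fix z assume z: "z \<in> center A"
  have "z \<otimes>\<^bsub>A\<^esub> e d \<otimes>\<^bsub>A\<^esub> inv\<^bsub>A\<^esub> z = e d" if "d \<in> D" for d
    using A.center_commute[OF z, of "e d"] A.center_carrier[OF z] that D_carrier
    by (auto simp: A.m_assoc)
  then show "z \<in> nA" using nA_iff A.center_carrier[OF z] by simp
qed

text \<open>Since \<open>D\<close> is radical, it consists of the \<open>l\<close>-elements of \<open>D Z(G)\<close>, hence it can be recovered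
  from its image in \<open>A\<close>.\<close>

lemma nA_Aut_set:
  assumes a: "a \<in> carrier A" shows "a \<in> nA \<longleftrightarrow> \<sigma> a \<in> Aut_set G D"
proof
  assume n: "a \<in> nA"
  note aut = \<sigma>_auto[OF a]
  interpret s: group_hom G G "\<sigma> a" using G.auto_hom[OF aut] .
  obtain r where r: "card D = l ^ r" by (rule card_D)
  have "\<sigma> a d \<in> D" if d: "d \<in> D" for d
  proof -
    have dG: "d \<in> carrier G" using d D_carrier by blast
    have "e (\<sigma> a d) \<in> e ` D" using n d nA_iff \<sigma>_conj[OF a dG] by simp
    then obtain d' where d': "d' \<in> D" "e (\<sigma> a d) = e d'" by auto
    have d'G: "d' \<in> carrier G" using d' D_carrier by blast
    obtain z where z: "z \<in> center G" "\<sigma> a d = z \<otimes>\<^bsub>G\<^esub> d'"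
      using e_eq[OF s.hom_closed[OF dG] d'G d'(2)] .
    then have "\<sigma> a d = d' \<otimes>\<^bsub>G\<^esub> z" using G.center_commute[OF z(1) d'G] by simp
    then have "\<sigma> a d \<in> D <#>\<^bsub>G\<^esub> center G" using d' z unfolding set_mult_def by blast
    moreover have "\<sigma> a d [^]\<^bsub>G\<^esub> (l ^ r) = \<one>\<^bsub>G\<^esub>"
      using s.hom_nat_pow[OF dG, of "l ^ r"] G.pow_card_subgroup[OF finG subgroup_D d] r by simp
    ultimately show ?thesis using G.l_element_mult_center_in_radical[OF finG l D] by blast
  qed
  moreover have "inj_on (\<sigma> a) D"
    using G.autoD(4)[OF aut] D_carrier by (meson bij_betw_imp_inj_on inj_on_subset)
  ultimately have "\<sigma> a ` D = D"
    using endo_inj_surj[OF finite_subset[OF D_carrier finG]] by blast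
  then show "\<sigma> a \<in> Aut_set G D" using aut by (simp add: Aut_set_def)
next
  assume "\<sigma> a \<in> Aut_set G D"
  then have "\<sigma> a d \<in> D" if "d \<in> D" for d using that by (auto simp: Aut_set_def)
  then have "a \<otimes>\<^bsub>A\<^esub> e d \<otimes>\<^bsub>A\<^esub> inv\<^bsub>A\<^esub> a \<in> e ` D" if "d \<in> D" for d
    using \<sigma>_conj[OF a, of d] that D_carrier by (metis image_eqI subsetD)
  then show "a \<in> nA" using a nA_iff by simp
qed

lemma nA_carrier: "a \<in> nA \<Longrightarrow> a \<in> carrier A"
  using nA_iff by blast

text \<open>Stability of \<open>M\<close> under the automorphisms fixing \<open>D\<close>, applied
  to \<open>\<sigma> a\<close>. It is what makes the product \<open>N\<close> a subgroup.\<close>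

lemma nA_conj_M: assumes "a \<in> nA" "m \<in> M"
  obtains m' where "m' \<in> M" "a \<otimes>\<^bsub>A\<^esub> e m \<otimes>\<^bsub>A\<^esub> inv\<^bsub>A\<^esub> a = e m'"
proof -
  have a: "a \<in> carrier A" using assms nA_carrier by blast
  have "\<sigma> a \<in> Aut_set G D" using nA_Aut_set[OF a] assms by simp
  then have "\<sigma> a m \<in> M" using M_stable assms by blast
  moreover have "a \<otimes>\<^bsub>A\<^esub> e m \<otimes>\<^bsub>A\<^esub> inv\<^bsub>A\<^esub> a = e (\<sigma> a m)"
    using \<sigma>_conj[OF a, of m] assms M_carrier by auto
  ultimately show thesis by (rule that)
qed

lemma mem_N: "x \<in> N \<longleftrightarrow> (\<exists>m\<in>M. \<exists>b\<in>nA. x = e m \<otimes>\<^bsub>A\<^esub> b)"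
  by (auto simp: N_def set_mult_def)

lemma subgroup_N: "subgroup N A"
proof
  have Mc: "m \<in> carrier G" if "m \<in> M" for m using that M_carrier by blast
  show "N \<subseteq> carrier A" using Mc nA_carrier by (auto simp: mem_N)
  have "\<one>\<^bsub>A\<^esub> = e \<one>\<^bsub>G\<^esub> \<otimes>\<^bsub>A\<^esub> \<one>\<^bsub>A\<^esub>" by simp
  then show "\<one>\<^bsub>A\<^esub> \<in> N"
    unfolding mem_N using subgroup.one_closed[OF subgroup_M] subgroup.one_closed[OF subgroup_nA] by blast
  fix x assume "x \<in> N"
  then obtain m b where x: "m \<in> M" "b \<in> nA" "x = e m \<otimes>\<^bsub>A\<^esub> b" by (auto simp: mem_N)
  have b: "b \<in> carrier A" "inv\<^bsub>A\<^esub> b \<in> nA"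
    using x nA_carrier subgroup.m_inv_closed[OF subgroup_nA] by auto
  have mi: "inv\<^bsub>G\<^esub> m \<in> M" using subgroup.m_inv_closed[OF subgroup_M x(1)] .
  obtain m' where m': "m' \<in> M" "inv\<^bsub>A\<^esub> b \<otimes>\<^bsub>A\<^esub> e (inv\<^bsub>G\<^esub> m) \<otimes>\<^bsub>A\<^esub> inv\<^bsub>A\<^esub> (inv\<^bsub>A\<^esub> b) = e m'"
    by (rule nA_conj_M[OF b(2) mi])
  have "inv\<^bsub>A\<^esub> x = inv\<^bsub>A\<^esub> b \<otimes>\<^bsub>A\<^esub> e (inv\<^bsub>G\<^esub> m)" using x b Mc by (simp add: A.inv_mult_group)
  also have "\<dots> = e m' \<otimes>\<^bsub>A\<^esub> inv\<^bsub>A\<^esub> b" unfolding m'(2)[symmetric] using b Mc x by (simp add: A.m_assoc)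
  finally show "inv\<^bsub>A\<^esub> x \<in> N" using m' b mem_N by blast
  fix y assume "y \<in> N"
  then obtain k c where y: "k \<in> M" "c \<in> nA" "y = e k \<otimes>\<^bsub>A\<^esub> c" by (auto simp: mem_N)
  obtain k' where k': "k' \<in> M" "b \<otimes>\<^bsub>A\<^esub> e k \<otimes>\<^bsub>A\<^esub> inv\<^bsub>A\<^esub> b = e k'" by (rule nA_conj_M[OF x(2) y(1)])
  have "x \<otimes>\<^bsub>A\<^esub> y = e m \<otimes>\<^bsub>A\<^esub> (b \<otimes>\<^bsub>A\<^esub> e k \<otimes>\<^bsub>A\<^esub> inv\<^bsub>A\<^esub> b) \<otimes>\<^bsub>A\<^esub> (b \<otimes>\<^bsub>A\<^esub> c)"
    using x y b Mc nA_carrier by (simp add: A.m_assoc A.mult_inv_cancel)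
  also have "\<dots> = e (m \<otimes>\<^bsub>G\<^esub> k') \<otimes>\<^bsub>A\<^esub> (b \<otimes>\<^bsub>A\<^esub> c)" using k' x y Mc by simp
  finally show "x \<otimes>\<^bsub>A\<^esub> y \<in> N"
    using x y k' mem_N subgroup.m_closed[OF subgroup_M x(1) k'(1)] subgroup.m_closed[OF subgroup_nA x(2) y(2)]
    by blast
qed

lemma e_M_N: "m \<in> M \<Longrightarrow> e m \<in> N"
proof -
  assume m: "m \<in> M"
  have "e m = e m \<otimes>\<^bsub>A\<^esub> \<one>\<^bsub>A\<^esub>" using m M_carrier by auto
  then show ?thesis using m mem_N subgroup.one_closed[OF subgroup_nA] by blast
qed

lemma nA_N: "nA \<subseteq> N"
proof
  fix b assume b: "b \<in> nA"
  have "b = e \<one>\<^bsub>G\<^esub> \<otimes>\<^bsub>A\<^esub> b" using b nA_carrier by simp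
  then show "b \<in> N" using b mem_N subgroup.one_closed[OF subgroup_M] by blast
qed

lemma center_N: "center A \<subseteq> N" using center_nA nA_N by blast

lemma N_carrier: "N \<subseteq> carrier A" using subgroup_N subgroup.subset by blast

text \<open>This identifies the quotient of \<open>N\<close> by the center of \<open>A\<close> with
  the group on which the second projective representation is required to live. The two factors are
  handled by \<open>\<sigma>_e\<close> and \<open>nA_Aut_set\<close>.\<close>

lemma \<sigma>_N: "\<sigma> ` N = (inner G ` M) <#>\<^bsub>AutoGroup G\<^esub> (Aut_set G D \<inter> Aut_char G \<chi>)"
proof (intro equalityI subsetI)
  fix x assume "x \<in> \<sigma> ` N"
  then obtain m b where x: "m \<in> M" "b \<in> nA" "x = \<sigma> (e m \<otimes>\<^bsub>A\<^esub> b)" by (auto simp: mem_N)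
  have "m \<in> carrier G" "b \<in> carrier A" using x M_carrier nA_carrier by auto
  then have "x = inner G m \<otimes>\<^bsub>AutoGroup G\<^esub> \<sigma> b" "\<sigma> b \<in> Aut_set G D \<inter> Aut_char G \<chi>"
    using x \<sigma>_mult \<sigma>_e nA_Aut_set \<sigma>_Aut_char by auto
  then show "x \<in> (inner G ` M) <#>\<^bsub>AutoGroup G\<^esub> (Aut_set G D \<inter> Aut_char G \<chi>)"
    using x(1) unfolding set_mult_def by blast
next
  fix x assume "x \<in> (inner G ` M) <#>\<^bsub>AutoGroup G\<^esub> (Aut_set G D \<inter> Aut_char G \<chi>)"
  then obtain m y where x: "m \<in> M" "y \<in> Aut_set G D" "y \<in> Aut_char G \<chi>"
    "x = inner G m \<otimes>\<^bsub>AutoGroup G\<^esub> y" by (auto simp: set_mult_def)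
  obtain b where b: "b \<in> carrier A" "\<sigma> b = y" using \<sigma>_surj[OF x(3)] .
  have "b \<in> nA" using nA_Aut_set b x by simp
  moreover have "x = \<sigma> (e m \<otimes>\<^bsub>A\<^esub> b)" using x b M_carrier \<sigma>_mult \<sigma>_e by auto
  ultimately show "x \<in> \<sigma> ` N" using x(1) mem_N by blast
qed

lemma \<sigma>_in_N: assumes "a \<in> carrier A" "\<sigma> a \<in> \<sigma> ` N" shows "a \<in> N"
proof -
  from assms(2) obtain b where b: "b \<in> N" "\<sigma> a = \<sigma> b" by blast
  then obtain z where "z \<in> center A" "a = z \<otimes>\<^bsub>A\<^esub> b" using \<sigma>_eq[OF assms(1)] N_carrier by blast
  then show ?thesis using b center_N subgroup.m_closed[OF subgroup_N] by blast
qed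

lemma subgroup_\<sigma>_N: "subgroup (\<sigma> ` N) (AutoGroup G)"
  using group_hom.subgroup_img_is_subgroup[OF \<sigma>_hom subgroup_N] .

lemma center_of_\<sigma>_one:
  assumes a: "a \<in> carrier A" and one: "\<sigma> a = \<one>\<^bsub>AutoGroup G\<^esub>" shows "a \<in> center A"
proof -
  have "a \<otimes>\<^bsub>A\<^esub> e g = e g \<otimes>\<^bsub>A\<^esub> a" if g: "g \<in> carrier G" for g
  proof -
    have "e g = a \<otimes>\<^bsub>A\<^esub> e g \<otimes>\<^bsub>A\<^esub> inv\<^bsub>A\<^esub> a"
      using \<sigma>_conj[OF a g] one g by (simp add: G.AutoGroup_one)
    then show ?thesis using a g by (metis A.inv_solve_right e.hom_closed A.m_closed)
  qed
  then have "a \<in> centralizer A (e ` carrier G)" using a by (auto simp: centralizer_def)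
  then show ?thesis using cent by simp
qed

text \<open>The preimage of the centralizer of \<open>a\<close> under \<open>e\<close>, in the role
  of the centralizer of \<open>a\<close> in \<open>G\<close>.\<close>

definition CG :: "'c \<Rightarrow> 'a set" where "CG a = {g \<in> carrier G. e g \<otimes>\<^bsub>A\<^esub> a \<otimes>\<^bsub>A\<^esub> inv\<^bsub>A\<^esub> e g = a}"

lemma CG_iff: "a \<in> carrier A \<Longrightarrow> g \<in> CG a \<longleftrightarrow> g \<in> carrier G \<and> e g \<otimes>\<^bsub>A\<^esub> a = a \<otimes>\<^bsub>A\<^esub> e g"
  unfolding CG_def using A.inv_solve_right' by auto

lemma subgroup_CG: assumes a: "a \<in> carrier A" shows "subgroup (CG a) G"
proof
  fix x y assume xy: "x \<in> CG a" "y \<in> CG a"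
  then have c: "x \<in> carrier G" "y \<in> carrier G" "e x \<otimes>\<^bsub>A\<^esub> a = a \<otimes>\<^bsub>A\<^esub> e x"
    "e y \<otimes>\<^bsub>A\<^esub> a = a \<otimes>\<^bsub>A\<^esub> e y" using CG_iff[OF a] by auto
  have "e (x \<otimes>\<^bsub>G\<^esub> y) \<otimes>\<^bsub>A\<^esub> a = e x \<otimes>\<^bsub>A\<^esub> (e y \<otimes>\<^bsub>A\<^esub> a)" using c(1,2) a by (simp add: A.m_assoc)
  also have "\<dots> = (e x \<otimes>\<^bsub>A\<^esub> a) \<otimes>\<^bsub>A\<^esub> e y" unfolding c(4) using c(1,2) a by (simp add: A.m_assoc)
  also have "\<dots> = a \<otimes>\<^bsub>A\<^esub> e (x \<otimes>\<^bsub>G\<^esub> y)" unfolding c(3) using c(1,2) a by (simp add: A.m_assoc)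
  finally show "x \<otimes>\<^bsub>G\<^esub> y \<in> CG a" using CG_iff[OF a] c by simp
next
  fix x assume "x \<in> CG a"
  then have c: "x \<in> carrier G" "e x \<otimes>\<^bsub>A\<^esub> a = a \<otimes>\<^bsub>A\<^esub> e x" using CG_iff[OF a] by auto
  have "inv\<^bsub>A\<^esub> e x \<otimes>\<^bsub>A\<^esub> a = inv\<^bsub>A\<^esub> e x \<otimes>\<^bsub>A\<^esub> (a \<otimes>\<^bsub>A\<^esub> e x) \<otimes>\<^bsub>A\<^esub> inv\<^bsub>A\<^esub> e x"
    using c(1) a by (simp add: A.m_assoc)
  also have "\<dots> = a \<otimes>\<^bsub>A\<^esub> inv\<^bsub>A\<^esub> e x"
    unfolding c(2)[symmetric] using c(1) a by (simp add: A.m_assoc A.mult_inv_cancel)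
  finally show "inv\<^bsub>G\<^esub> x \<in> CG a" using CG_iff[OF a] c by simp
qed (use a in \<open>auto simp: CG_def\<close>)

text \<open>The hypothesis on \<open>x\<close> in the projective condition, translated to a preimage of \<open>x\<close>.\<close>

lemma sylow_CG:
  assumes a: "a \<in> N"
    and reg: "l_regular l (AutoGroup G\<lparr>carrier := \<sigma> ` N\<rparr>) (\<sigma> a)"
    and syl: "sylow_subgroup l (AutoGroup G\<lparr>carrier := {s \<in> inner G ` carrier G.
        s \<otimes>\<^bsub>AutoGroup G\<^esub> \<sigma> a = \<sigma> a \<otimes>\<^bsub>AutoGroup G\<^esub> s}\<rparr>) (inner G ` (D <#>\<^bsub>G\<^esub> center G))"
  shows "D \<subseteq> CG a" "card D = l_part l (card (CG a))"
proof -
  interpret \<sigma>: group_hom A "AutoGroup G" \<sigma> by (rule \<sigma>_hom)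
  define CS where "CS = {s \<in> inner G ` carrier G. s \<otimes>\<^bsub>AutoGroup G\<^esub> \<sigma> a = \<sigma> a \<otimes>\<^bsub>AutoGroup G\<^esub> s}"
  have aA: "a \<in> carrier A" using a N_carrier by blast
  have sub: "inner G ` (D <#>\<^bsub>G\<^esub> center G) \<subseteq> CS"
    using syl subgroup.subset by (fastforce simp: sylow_subgroup_def CS_def)
  have card: "card (inner G ` (D <#>\<^bsub>G\<^esub> center G)) = l_part l (card CS)"
    using syl by (simp add: sylow_subgroup_def Coset.order_def CS_def)
  interpret Q: group "AutoGroup G\<lparr>carrier := \<sigma> ` N\<rparr>"
    using subgroup.subgroup_is_group[OF subgroup_\<sigma>_N G.AutoGroup] .
  define k where "k = group.ord (AutoGroup G\<lparr>carrier := \<sigma> ` N\<rparr>) (\<sigma> a)"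
  have k: "\<not> l dvd k" using reg by (simp add: l_regular_def k_def)
  have "\<sigma> a [^]\<^bsub>AutoGroup G\<lparr>carrier := \<sigma> ` N\<rparr>\<^esub> k = \<one>\<^bsub>AutoGroup G\<^esub>"
    using Q.pow_ord_eq_1[of "\<sigma> a"] a by (simp add: k_def)
  then have "\<sigma> (a [^]\<^bsub>A\<^esub> k) = \<one>\<^bsub>AutoGroup G\<^esub>"
    using \<sigma>.hom_nat_pow[OF aA, of k]
      monoid.nat_pow_consistent[OF group.is_monoid[OF G.AutoGroup], of "\<sigma> a" k "\<sigma> ` N"] by simp
  then have ak: "a [^]\<^bsub>A\<^esub> k \<in> center A" using center_of_\<sigma>_one aA by simp
  have DZ: "D \<subseteq> D <#>\<^bsub>G\<^esub> center G"
  proof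
    fix d assume "d \<in> D"
    then have "d = d \<otimes>\<^bsub>G\<^esub> \<one>\<^bsub>G\<^esub>" "\<one>\<^bsub>G\<^esub> \<in> center G"
      using D_carrier subgroup.one_closed[OF G.subgroup_center] by auto
    then show "d \<in> D <#>\<^bsub>G\<^esub> center G" using \<open>d \<in> D\<close> unfolding set_mult_def by blast
  qed
  show DC: "D \<subseteq> CG a"
  proof
    fix d assume d: "d \<in> D"
    then have dG: "d \<in> carrier G" using D_carrier by blast
    have "inner G d \<in> CS" using sub DZ d by blast
    then have "\<sigma> (e d \<otimes>\<^bsub>A\<^esub> a) = \<sigma> (a \<otimes>\<^bsub>A\<^esub> e d)"
      using \<sigma>_mult \<sigma>_e[OF dG] aA dG by (simp add: CS_def)
    \<comment> \<open>The automorphisms induced by \<open>d\<close> and \<open>a\<close> commute, so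
      the commutator of \<open>e d\<close> and \<open>a\<close> is a central element
      \<open>z\<close>. The aim is \<open>z = 1\<close>.\<close>
    then obtain z where z: "z \<in> center A" "e d \<otimes>\<^bsub>A\<^esub> a = z \<otimes>\<^bsub>A\<^esub> (a \<otimes>\<^bsub>A\<^esub> e d)"
      using \<sigma>_eq aA dG by (metis A.m_closed e.hom_closed)
    have zA: "z \<in> carrier A" using z(1) by (rule A.center_carrier)
    have zc: "z \<otimes>\<^bsub>A\<^esub> y = y \<otimes>\<^bsub>A\<^esub> z" if "y \<in> carrier A" for y using A.center_commute[OF z(1) that] .
    have zcp: "z [^]\<^bsub>A\<^esub> (j::nat) \<otimes>\<^bsub>A\<^esub> y = y \<otimes>\<^bsub>A\<^esub> z [^]\<^bsub>A\<^esub> j" if "y \<in> carrier A" for j y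
    proof (induction j)
      case (Suc j)
      have "z [^]\<^bsub>A\<^esub> Suc j \<otimes>\<^bsub>A\<^esub> y = z [^]\<^bsub>A\<^esub> j \<otimes>\<^bsub>A\<^esub> (z \<otimes>\<^bsub>A\<^esub> y)" using zA that by (simp add: A.m_assoc)
      also have "\<dots> = (z [^]\<^bsub>A\<^esub> j \<otimes>\<^bsub>A\<^esub> y) \<otimes>\<^bsub>A\<^esub> z" unfolding zc[OF that] using zA that by (simp add: A.m_assoc)
      finally show ?case unfolding Suc using zA that by (simp add: A.m_assoc)
    qed (use that in simp)
    have ed: "e d \<in> carrier A" using dG by simp
    \<comment> \<open>As \<open>z\<close> is central, powers of either argument come out as powers
      of \<open>z\<close>. The order of \<open>d\<close> then gives a power of \<open>l\<close> that
      kills \<open>z\<close>, and the central power \<open>a^k\<close> gives an exponent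
      \<open>k\<close> prime to \<open>l\<close>.\<close>
    have 1: "e d [^]\<^bsub>A\<^esub> (j::nat) \<otimes>\<^bsub>A\<^esub> a = z [^]\<^bsub>A\<^esub> j \<otimes>\<^bsub>A\<^esub> (a \<otimes>\<^bsub>A\<^esub> e d [^]\<^bsub>A\<^esub> j)" for j
    proof (induction j)
      case (Suc j)
      have "e d [^]\<^bsub>A\<^esub> Suc j \<otimes>\<^bsub>A\<^esub> a = e d [^]\<^bsub>A\<^esub> j \<otimes>\<^bsub>A\<^esub> (e d \<otimes>\<^bsub>A\<^esub> a)" using ed aA by (simp add: A.m_assoc)
      also have "\<dots> = e d [^]\<^bsub>A\<^esub> j \<otimes>\<^bsub>A\<^esub> (a \<otimes>\<^bsub>A\<^esub> e d \<otimes>\<^bsub>A\<^esub> z)" unfolding z(2) using zc ed aA by simp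
      also have "\<dots> = e d [^]\<^bsub>A\<^esub> j \<otimes>\<^bsub>A\<^esub> a \<otimes>\<^bsub>A\<^esub> (e d \<otimes>\<^bsub>A\<^esub> z)" using ed aA zA by (simp add: A.m_assoc)
      also have "\<dots> = z [^]\<^bsub>A\<^esub> j \<otimes>\<^bsub>A\<^esub> (a \<otimes>\<^bsub>A\<^esub> e d [^]\<^bsub>A\<^esub> Suc j) \<otimes>\<^bsub>A\<^esub> z" unfolding Suc using ed aA zA by (simp add: A.m_assoc)
      also have "\<dots> = z [^]\<^bsub>A\<^esub> j \<otimes>\<^bsub>A\<^esub> (z \<otimes>\<^bsub>A\<^esub> (a \<otimes>\<^bsub>A\<^esub> e d [^]\<^bsub>A\<^esub> Suc j))"
        using zc[of "a \<otimes>\<^bsub>A\<^esub> e d [^]\<^bsub>A\<^esub> Suc j"] ed aA zA by (simp add: A.m_assoc)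
      finally show ?case using ed aA zA by (simp add: A.m_assoc)
    qed (use aA in simp)
    have 2: "e d \<otimes>\<^bsub>A\<^esub> a [^]\<^bsub>A\<^esub> (j::nat) = z [^]\<^bsub>A\<^esub> j \<otimes>\<^bsub>A\<^esub> (a [^]\<^bsub>A\<^esub> j \<otimes>\<^bsub>A\<^esub> e d)" for j
    proof (induction j)
      case (Suc j)
      have "e d \<otimes>\<^bsub>A\<^esub> a [^]\<^bsub>A\<^esub> Suc j = (e d \<otimes>\<^bsub>A\<^esub> a [^]\<^bsub>A\<^esub> j) \<otimes>\<^bsub>A\<^esub> a" using ed aA by (simp add: A.m_assoc)
      also have "\<dots> = z [^]\<^bsub>A\<^esub> j \<otimes>\<^bsub>A\<^esub> (a [^]\<^bsub>A\<^esub> j \<otimes>\<^bsub>A\<^esub> (e d \<otimes>\<^bsub>A\<^esub> a))"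
        unfolding Suc using ed aA zA by (simp add: A.m_assoc)
      also have "\<dots> = z [^]\<^bsub>A\<^esub> j \<otimes>\<^bsub>A\<^esub> ((a [^]\<^bsub>A\<^esub> j \<otimes>\<^bsub>A\<^esub> z) \<otimes>\<^bsub>A\<^esub> (a \<otimes>\<^bsub>A\<^esub> e d))"
        unfolding z(2) using ed aA zA by (simp add: A.m_assoc)
      also have "a [^]\<^bsub>A\<^esub> j \<otimes>\<^bsub>A\<^esub> z = z \<otimes>\<^bsub>A\<^esub> a [^]\<^bsub>A\<^esub> j" using zc aA by simp
      finally show ?case using ed aA zA by (simp add: A.m_assoc)
    qed (use ed in simp)
    obtain r where r: "card D = l ^ r" by (rule card_D)
    have "e d [^]\<^bsub>A\<^esub> (l ^ r) = \<one>\<^bsub>A\<^esub>"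
      using e.hom_nat_pow[OF dG, of "l ^ r"] G.pow_card_subgroup[OF finG subgroup_D d] r by simp
    then have "a = z [^]\<^bsub>A\<^esub> (l ^ r) \<otimes>\<^bsub>A\<^esub> a" using 1[of "l ^ r"] aA by simp
    then have zl: "z [^]\<^bsub>A\<^esub> (l ^ r) = \<one>\<^bsub>A\<^esub>" using aA zA by (metis A.nat_pow_closed A.r_cancel_one')
    have "e d \<otimes>\<^bsub>A\<^esub> a [^]\<^bsub>A\<^esub> k = z [^]\<^bsub>A\<^esub> k \<otimes>\<^bsub>A\<^esub> (e d \<otimes>\<^bsub>A\<^esub> a [^]\<^bsub>A\<^esub> k)"
      using 2[of k] A.center_commute[OF ak ed] by simp
    then have zk: "z [^]\<^bsub>A\<^esub> k = \<one>\<^bsub>A\<^esub>"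
      using aA zA ed by (metis A.nat_pow_closed A.m_closed A.r_cancel_one')
    have "coprime (l ^ r) k" using l k by (simp add: prime_imp_coprime)
    moreover have "A.ord z dvd l ^ r" "A.ord z dvd k" using zl zk A.pow_eq_id[OF zA] by auto
    ultimately have "A.ord z = 1" by (metis coprime_common_divisor nat_dvd_1_iff_1)
    then have "z = \<one>\<^bsub>A\<^esub>" using A.ord_eq_1[OF zA] by simp
    then show "d \<in> CG a" using CG_iff[OF aA] z(2) aA ed dG by simp
  qed
  \<comment> \<open>\<open>U\<close> is the full preimage in \<open>G\<close> of the centralizer of
    \<open>\<sigma> a\<close> among the inner automorphisms. It contains \<open>CG a\<close>, and by
    the Sylow hypothesis its order has \<open>l\<close>-part \<open>card D\<close>, which bounds the
    \<open>l\<close>-part of \<open>card (CG a)\<close> from above.\<close>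
  define U where "U = {g \<in> carrier G. inner G g \<in> CS}"
  have U_im: "inner G ` U = CS" by (auto simp: U_def CS_def)
  have cU: "card U = card CS * card (center G)"
    unfolding U_im[symmetric]
  proof (rule G.card_inner_image[OF finG])
    fix u z assume u: "u \<in> U" and z: "z \<in> center G"
    then have uG: "u \<in> carrier G" by (simp add: U_def)
    have "z \<otimes>\<^bsub>G\<^esub> u \<in> center G #>\<^bsub>G\<^esub> u" using z by (auto simp: r_coset_def)
    then have "inner G (z \<otimes>\<^bsub>G\<^esub> u) = inner G u"
      using G.inner_eq_iff[OF _ uG] uG G.center_carrier[OF z] by simp
    then show "z \<otimes>\<^bsub>G\<^esub> u \<in> U" using u uG G.center_carrier[OF z] by (simp add: U_def)
  qed (auto simp: U_def)
  have DZs: "subgroup (D <#>\<^bsub>G\<^esub> center G) G" using G.subgroup_mult_center[OF subgroup_D] .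
  have cDZ: "card (D <#>\<^bsub>G\<^esub> center G) = card (inner G ` (D <#>\<^bsub>G\<^esub> center G)) * card (center G)"
  proof (rule G.card_inner_image[OF finG])
    fix u z assume u: "u \<in> D <#>\<^bsub>G\<^esub> center G" and z: "z \<in> center G"
    have "z = \<one>\<^bsub>G\<^esub> \<otimes>\<^bsub>G\<^esub> z" using G.center_carrier[OF z] by simp
    then have "z \<in> D <#>\<^bsub>G\<^esub> center G"
      using z subgroup.one_closed[OF subgroup_D] unfolding set_mult_def by blast
    then show "z \<otimes>\<^bsub>G\<^esub> u \<in> D <#>\<^bsub>G\<^esub> center G" using u subgroup.m_closed[OF DZs] by blast
  qed (rule subgroup.subset[OF DZs])
  have cZ: "card (center G) > 0" using G.card_subgroup_pos[OF finG G.subgroup_center] .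
  have "CS \<noteq> {}" using sub subgroup.one_closed[OF DZs] by blast
  moreover have "finite CS" using finG by (simp add: CS_def)
  ultimately have cCS: "card CS > 0" by (simp add: card_gt_0_iff)
  have lCS: "l_part l (l_part l (card CS)) = l_part l (card CS)"
    using l_part_power[OF l] by (metis l_part_def)
  have "l_part l (card U) = l_part l (card CS) * l_part l (card (center G))"
    unfolding cU using l_part_mult[OF l cCS cZ] .
  also have "\<dots> = l_part l (l_part l (card CS) * card (center G))"
    using l_part_mult[OF l l_part_pos[OF l] cZ] lCS by simp
  also have "\<dots> = card D"
    using G.l_part_card_mult_center[OF finG l D] cDZ card by simp
  finally have lU: "l_part l (card U) = card D" .
  have CU: "CG a \<subseteq> U"
  proof
    fix g assume g: "g \<in> CG a"
    then have "g \<in> carrier G" "e g \<otimes>\<^bsub>A\<^esub> a = a \<otimes>\<^bsub>A\<^esub> e g" using CG_iff[OF aA] by auto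
    then show "g \<in> U" using \<sigma>_mult[of "e g" a] \<sigma>_mult[of a "e g"] \<sigma>_e aA by (simp add: U_def CS_def)
  qed
  have "U \<subseteq> carrier G" by (auto simp: U_def)
  have Us: "subgroup U G"
  proof -
    interpret i: group_hom G "AutoGroup G" "inner G"
      using G.is_group G.AutoGroup G.inner_auto G.inner_mult
      by (auto simp: group_hom_def group_hom_axioms_def hom_def G.carrier_AutoGroup)
    have U_eq: "U = {g \<in> carrier G. inner G g \<in> centralizer (AutoGroup G) {\<sigma> a}}"
      using G.inner_auto by (auto simp: U_def CS_def centralizer_def G.carrier_AutoGroup)
    interpret C: subgroup "centralizer (AutoGroup G) {\<sigma> a}" "AutoGroup G"
      using group.subgroup_centralizer[OF G.AutoGroup, of "{\<sigma> a}"] aA by simp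
    show ?thesis unfolding U_eq by unfold_locales simp_all
  qed
  have "card D dvd card (CG a)" using G.card_subgroup_dvd[OF finG subgroup_D subgroup_CG[OF aA] DC] .
  moreover obtain r where r: "card D = l ^ r" by (rule card_D)
  ultimately have le: "card D \<le> l_part l (card (CG a))"
    using l_part_prime_dvd_le[OF l] G.card_subgroup_pos[OF finG subgroup_CG[OF aA]] by metis
  have "l_part l (card (CG a)) dvd card U"
    using l_part_dvd G.card_subgroup_dvd[OF finG subgroup_CG[OF aA] Us CU] dvd_trans by blast
  then have "l_part l (card (CG a)) \<le> l_part l (card U)"
    using l_part_prime_dvd_le[OF l, of "multiplicity l (card (CG a))" "card U", folded l_part_def]
      G.card_subgroup_pos[OF finG Us] by simp
  then show "card D = l_part l (card (CG a))" using le lU by simp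
qed

end

section \<open>The trace congruence\<close>

text \<open>Multiplication by \<open>a\<close> permutes the nonzero residues. This justifies the
  definite description in \<open>AM_epsilon\<close>.\<close>

lemma (in mod_red) congruence_scalar_unique:
  assumes a: "\<not> l dvd a" and b: "\<not> l dvd (b::nat)"
  shows "\<exists>!x. x \<in> {1..l - 1} \<and> (x * a) mod l = b mod l"
proof -
  have l0: "l > 0" using prime_gt_0_nat[OF prime_l] .
  have inj: "inj_on (\<lambda>x. (x * a) mod l) {1..l - 1}"
  proof (rule linorder_inj_onI)
    fix x y :: nat assume xy: "x < y" "x \<in> {1..l - 1}" "y \<in> {1..l - 1}"
    show "(x * a) mod l \<noteq> (y * a) mod l"
    proof
      assume "(x * a) mod l = (y * a) mod l"
      then have "l dvd y * a - x * a" using mod_eq_dvd_iff_nat[of "x * a" "y * a" l] xy(1) by simp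
      then have "l dvd (y - x) * a" by (simp add: diff_mult_distrib)
      then have "l dvd y - x" using a prime_dvd_mult_iff[OF prime_l] by blast
      then show False using xy by (auto dest!: dvd_imp_le)
    qed
  qed auto
  have "(\<lambda>x. (x * a) mod l) ` {1..l - 1} \<subseteq> {1..l - 1}"
  proof
    fix y assume "y \<in> (\<lambda>x. (x * a) mod l) ` {1..l - 1}"
    then obtain x where x: "x \<in> {1..l - 1}" "y = (x * a) mod l" by blast
    have "\<not> l dvd x" using x(1) by (auto dest!: dvd_imp_le)
    then have "\<not> l dvd x * a" using a prime_dvd_mult_iff[OF prime_l] by blast
    then have "y \<noteq> 0" using x(2) by (simp add: dvd_eq_mod_eq_0)
    moreover have "y < l" using x(2) l0 by simp
    ultimately show "y \<in> {1..l - 1}" by auto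
  qed
  then have "(\<lambda>x. (x * a) mod l) ` {1..l - 1} = {1..l - 1}"
    using endo_inj_surj inj by blast
  moreover have "b mod l \<in> {1..l - 1}"
  proof -
    have "b mod l \<noteq> 0" using b by (simp add: dvd_eq_mod_eq_0)
    moreover have "b mod l < l" using l0 by simp
    ultimately show ?thesis by auto
  qed
  ultimately obtain x where "x \<in> {1..l - 1}" "(x * a) mod l = b mod l" by (metis (no_types, lifting) imageE)
  then show ?thesis using inj by (auto simp: inj_on_def)
qed

lemma (in mod_red) of_nat_mod_eq:
  assumes "(a::nat) mod l = b mod l" shows "(of_nat a :: 'k) = of_nat b"
proof -
  have l0: "(of_nat l :: 'k) = 0" using of_nat_eq_0_iff_char_dvd[where 'a = 'k] char_k by simp
  have "of_nat m = (of_nat (m mod l) :: 'k)" for m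
  proof -
    have "(of_nat m :: 'k) = of_nat (l * (m div l) + m mod l)" by simp
    then show ?thesis by (simp only: of_nat_add of_nat_mult l0) simp
  qed
  then show ?thesis using assms by metis
qed

text \<open>The orbit lengths are \<open>r\<close> and \<open>r'\<close>, and \<open>c\<close> is the index of the stabilizers.\<close>

lemma (in mod_red) epsilon_congruence:
  fixes t t' :: complex
  assumes pos: "d > 0" "d' > 0" "r > 0" "r' > 0" "i > 0" "cM > 0"
    and md: "multiplicity l r = multiplicity l d" "multiplicity l r' = multiplicity l d'"
    and t: "t \<in> R" "t' \<in> R"
    and eq: "star (of_nat r * t / of_nat d) = star (of_nat r' * t' / of_nat d')"
    and c: "i * (r' * cM) = r * (c * cM)" "c mod l = 1"
    and \<epsilon>: "(\<epsilon> * l'_part l d) mod l = (l'_part l i * l'_part l d') mod l"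
  shows "of_nat \<epsilon> * star t = star t'"
proof -
  define k where "k = (\<lambda>m. of_nat (l'_part l m) :: 'k)"
  have nz: "k m \<noteq> 0" if "m > 0" for m
    using not_dvd_l'_part[OF prime_l that] star_of_nat_eq_0[of "l'_part l m"] star_of_nat[of "l'_part l m"]
    by (simp add: k_def)
  have "\<not> l dvd c"
  proof
    assume "l dvd c"
    then have "c mod l = 0" by simp
    then show False using c(2) by simp
  qed
  then have lc: "l'_part l c = c" "c > 0"
    using l_part_eq_1 by (auto simp: l'_part_def intro: gr0I)
  have "(of_nat c :: 'k) = of_nat 1"
    using c(2) prime_gt_1_nat[OF prime_l] by (intro of_nat_mod_eq) simp
  then have kc: "k c = 1" by (simp add: k_def lc)
  have "i * r' = c * r" using c(1) pos(6) by (simp add: mult_ac)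
  then have "l'_part l i * l'_part l r' = l'_part l c * l'_part l r"
    using l'_part_mult[OF prime_l pos(5,4)] l'_part_mult[OF prime_l lc(2) pos(3)] by simp
  then have ir: "k i * k r' = k r" using kc by (metis k_def of_nat_mult mult_1)
  have e: "of_nat \<epsilon> * k d = k i * k d'"
    using of_nat_mod_eq[OF \<epsilon>] by (simp add: k_def)
  define s where "s = star (of_nat r * t / of_nat d)"
  have 1: "k d * s = k r * star t"
    unfolding s_def k_def using star_scaled_quotient[OF md(1) pos(3,1) t(1)] .
  have 2: "k d' * s = k r' * star t'"
    unfolding s_def k_def eq using star_scaled_quotient[OF md(2) pos(4,2) t(2)] .
  \<comment> \<open>After multiplication by the nonzero element \<open>k d * k r'\<close>, both
    traces can be expressed through the common reduced value \<open>s\<close> of the two central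
    characters.\<close>
  have "(k d * k r') * (of_nat \<epsilon> * star t) = (of_nat \<epsilon> * k d) * k r' * star t" by (simp add: mult_ac)
  also have "\<dots> = k d' * (k i * k r') * star t" unfolding e by (simp add: mult_ac)
  also have "\<dots> = k d' * (k d * s)" unfolding ir 1 by (simp add: mult_ac)
  also have "\<dots> = k d * (k d' * s)" by (simp add: mult_ac)
  also have "\<dots> = (k d * k r') * star t'" unfolding 2 by (simp add: mult_ac)
  finally show ?thesis using nz[OF pos(1)] nz[OF pos(4)] by simp
qed

section \<open>Height zero and the representations affording the two extensions\<close>

lemma (in group) group_index_mult:
  assumes "subgroup C G" shows "group_index G C * card C = Coset.order G"
  unfolding group_index_def using lagrange[OF assms] .

text \<open>The height-zero condition multiplied by the order of \<open>D\<close>, so that it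
  compares with the order of \<open>H\<close> rather than with an index.\<close>

lemma Irr0_height:
  assumes H: "group H" and fin: "finite (carrier H)" and l: "Factorial_Ring.prime l"
    and D: "subgroup D H" and chi: "\<chi> \<in> Irr0 star l H D" and n: "\<chi> \<one>\<^bsub>H\<^esub> = of_nat n" "n > 0"
  shows "multiplicity l (n * card D) = multiplicity l (Coset.order H)"
proof -
  interpret group H by fact
  have "l_part l n = l_part l (group_index H D)"
    using chi char_degree_eq[of \<chi> H n] n by (simp add: Irr0_def)
  moreover have "group_index H D > 0"
    using group_index_mult[OF D] fin order_gt_0_iff_finite by (metis gr0I less_irrefl mult_0)
  ultimately have "l_part l (n * card D) = l_part l (group_index H D * card D)"
    using l_part_mult[OF l] n(2) card_subgroup_pos[OF fin D] by simp
  then show ?thesis using l_part_eq_iff[OF l] group_index_mult[OF D] by simp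
qed

text \<open>The characters of \<open>A\<close> and \<open>N\<close> are given through fixed
  representations, because the projective representations have to be built from matrices.
  Irreducibility is recorded both before and after restriction along \<open>e\<close>.\<close>

locale AM_characters = mod_red l R star K \<nu> + AM_overgroup G A l D M \<chi> e \<kappa>
  for l R and star :: "complex \<Rightarrow> 'k::field" and K \<nu> and G :: "'a monoid" and A :: "'c monoid"
    and D M \<chi> e \<kappa> +
  fixes \<chi>' :: "'a \<Rightarrow> complex" and n n' :: nat and \<rho> \<rho>' :: "'c \<Rightarrow> complex mat"
  assumes chi: "\<chi> \<in> Irr0 star l G D" and chi': "\<chi>' \<in> Irr0 star l (G\<lparr>carrier := M\<rparr>) D"
    and rho: "irreducible_rep A n \<rho>" and rho_G: "irreducible_rep G n (\<lambda>g. \<rho> (e g))"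
    and chi_eq: "\<chi> = (\<lambda>g\<in>carrier G. mat_trace (\<rho> (e g)))"
    and rho': "irreducible_rep (A\<lparr>carrier := N\<rparr>) n' \<rho>'"
    and rho'_M: "irreducible_rep (G\<lparr>carrier := M\<rparr>) n' (\<lambda>g. \<rho>' (e g))"
    and chi'_eq: "\<chi>' = (\<lambda>g\<in>M. mat_trace (\<rho>' (e g)))"
    and central: "Irr_under A (center A) (\<lambda>x\<in>carrier A. mat_trace (\<rho> x)) =
      Irr_under (A\<lparr>carrier := N\<rparr>) (center A) (\<lambda>x\<in>N. mat_trace (\<rho>' x))"
    and blocks: "subgroup J A \<Longrightarrow> e ` carrier G \<subseteq> J \<Longrightarrow>
      NJ = (e ` M) <#>\<^bsub>A\<^esub> normalizer (A\<lparr>carrier := J\<rparr>) (e ` D) \<Longrightarrow>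
      is_induced_block star (A\<lparr>carrier := J\<rparr>) NJ
        (bl star (A\<lparr>carrier := NJ\<rparr>) (restrict (\<lambda>x\<in>N. mat_trace (\<rho>' x)) NJ))
        (bl star (A\<lparr>carrier := J\<rparr>) (restrict (\<lambda>x\<in>carrier A. mat_trace (\<rho> x)) J))"
begin

sublocale r: representation A n \<rho>
  using irreducible_imp_representation[OF A.is_group rho] .

lemma group_N: "group (A\<lparr>carrier := N\<rparr>)"
  using subgroup.subgroup_is_group[OF subgroup_N A.is_group] .

sublocale r': representation "A\<lparr>carrier := N\<rparr>" n' \<rho>'
  using irreducible_imp_representation[OF group_N rho'] .

lemma group_GM: "group (G\<lparr>carrier := M\<rparr>)"
  using subgroup.subgroup_is_group[OF subgroup_M G.is_group] .

lemma center_AN: "z \<in> center A \<Longrightarrow> z \<in> center (A\<lparr>carrier := N\<rparr>)"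
  using center_N N_carrier by (auto simp: center_def)

lemma central_char_mult:
  assumes "z \<in> center A" "w \<in> center A"
  shows "mat_trace (\<rho> (z \<otimes>\<^bsub>A\<^esub> w)) / of_nat n = mat_trace (\<rho> z) / of_nat n * (mat_trace (\<rho> w) / of_nat n)"
    and "mat_trace (\<rho>' (z \<otimes>\<^bsub>A\<^esub> w)) / of_nat n' = mat_trace (\<rho>' z) / of_nat n' * (mat_trace (\<rho>' w) / of_nat n')"
proof -
  have w: "w \<in> carrier A" "w \<in> N" using assms center_N A.center_carrier by auto
  show "mat_trace (\<rho> (z \<otimes>\<^bsub>A\<^esub> w)) / of_nat n = mat_trace (\<rho> z) / of_nat n * (mat_trace (\<rho> w) / of_nat n)"
    using central_trace_mult[OF A.is_group rho assms(1) w(1)]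
      mat_trace_smult[OF r.rep_carrier[OF w(1)]] by simp
  show "mat_trace (\<rho>' (z \<otimes>\<^bsub>A\<^esub> w)) / of_nat n' = mat_trace (\<rho>' z) / of_nat n' * (mat_trace (\<rho>' w) / of_nat n')"
    using central_trace_mult[OF group_N rho' center_AN[OF assms(1)], of w] w(2)
      mat_trace_smult[OF r'.rep_carrier, of w] by simp
qed

lemma central_char_one:
  "mat_trace (\<rho> \<one>\<^bsub>A\<^esub>) / of_nat n = 1" "mat_trace (\<rho>' \<one>\<^bsub>A\<^esub>) / of_nat n' = 1"
  using r.trace_one r.rep_dim r'.trace_one r'.rep_dim by simp_all

lemma central_char_nonzero:
  assumes z: "z \<in> center A" shows "mat_trace (\<rho> z) / of_nat n \<noteq> 0"
proof -
  have "inv\<^bsub>A\<^esub> z \<in> center A" using subgroup.m_inv_closed[OF A.subgroup_center z] .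
  from central_char_mult(1)[OF z this] show ?thesis
    using central_char_one(1) A.center_carrier[OF z] by auto
qed

text \<open>On the center of \<open>A\<close> the two characters are multiples n \<phi> and n'
  \<phi>' of linear characters. The constituent \<phi> of the first is by \<open>central\<close> a
  constituent of the second, so \<phi> and \<phi>' are not orthogonal and coincide.\<close>

lemma central_chars_eq:
  assumes z: "z \<in> center A"
  shows "mat_trace (\<rho>' z) / of_nat n' = mat_trace (\<rho> z) / of_nat n"
proof -
  define Z where "Z = A\<lparr>carrier := center A\<rparr>"
  define \<phi> where "\<phi> = (\<lambda>z. mat_trace (\<rho> z) / of_nat n)"
  define \<phi>' where "\<phi>' = (\<lambda>z. mat_trace (\<rho>' z) / of_nat n')"
  have Z: "group Z"
    unfolding Z_def using subgroup.subgroup_is_group[OF A.subgroup_center A.is_group] .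
  interpret Z: group Z by fact
  have cZ: "carrier Z = center A" by (simp add: Z_def)
  have finZ: "finite (carrier Z)"
    using finA finite_subset[OF subgroup.subset[OF A.subgroup_center]] cZ by simp
  have mult: "\<phi> (x \<otimes>\<^bsub>Z\<^esub> y) = \<phi> x * \<phi> y" "\<phi>' (x \<otimes>\<^bsub>Z\<^esub> y) = \<phi>' x * \<phi>' y"
    if "x \<in> carrier Z" "y \<in> carrier Z" for x y
    using central_char_mult that unfolding cZ by (simp_all add: \<phi>_def \<phi>'_def Z_def)
  have one: "\<phi> \<one>\<^bsub>Z\<^esub> = 1" "\<phi>' \<one>\<^bsub>Z\<^esub> = 1" using central_char_one by (simp_all add: \<phi>_def \<phi>'_def Z_def)
  define \<mu> where "\<mu> = restrict \<phi> (center A)"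
  have \<mu>: "\<mu> \<in> Irr Z" using linear_character_Irr[OF Z mult(1) one(1)] by (simp add: \<mu>_def cZ)
  have unit: "\<phi> x * cnj (\<phi> x) = 1" if x: "x \<in> carrier Z" for x
  proof -
    have "\<phi> (x [^]\<^bsub>Z\<^esub> k) = \<phi> x ^ k" for k :: nat
      using x by (induction k) (auto simp: mult one mult.commute)
    then have "\<phi> x ^ Coset.order Z = 1" using Z.pow_order_eq_1[OF x] one by metis
    then show ?thesis using root_of_unity_cnj finZ Z.order_gt_0_iff_finite by blast
  qed
  have nZ: "(of_nat (card (center A)) :: complex) \<noteq> 0"
    using A.card_subgroup_pos[OF finA A.subgroup_center] by simp
  have tr: "mat_trace (\<rho> x) = of_nat n * \<phi> x" "mat_trace (\<rho>' x) = of_nat n' * \<phi>' x" for x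
    using r.rep_dim r'.rep_dim by (simp_all add: \<phi>_def \<phi>'_def)
  have "char_inner Z (restrict (\<lambda>x\<in>carrier A. mat_trace (\<rho> x)) (center A)) \<mu> =
      (\<Sum>x\<in>center A. of_nat n * (\<phi> x * cnj (\<phi> x))) / of_nat (card (center A))"
    unfolding char_inner_def cZ Coset.order_def
    by (intro arg_cong2[of _ _ _ _ "(/)"] sum.cong) (auto simp: \<mu>_def tr A.center_carrier)
  also have "\<dots> = of_nat n" using unit nZ by (simp add: cZ)
  also have "\<dots> \<noteq> 0" using r.rep_dim by simp
  finally have "\<mu> \<in> Irr_under A (center A) (\<lambda>x\<in>carrier A. mat_trace (\<rho> x))"
    using \<mu> by (simp add: Irr_under_def Z_def)
  then have "\<mu> \<in> Irr_under (A\<lparr>carrier := N\<rparr>) (center A) (\<lambda>x\<in>N. mat_trace (\<rho>' x))"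
    unfolding central .
  then have ne: "char_inner Z (restrict (\<lambda>x\<in>N. mat_trace (\<rho>' x)) (center A)) \<mu> \<noteq> 0"
    by (simp add: Irr_under_def Z_def)
  have "char_inner Z (restrict (\<lambda>x\<in>N. mat_trace (\<rho>' x)) (center A)) \<mu> =
      (\<Sum>x\<in>center A. of_nat n' * (\<phi>' x * cnj (\<phi> x))) / of_nat (card (center A))"
    unfolding char_inner_def cZ Coset.order_def
    by (intro arg_cong2[of _ _ _ _ "(/)"] sum.cong) (use center_N in \<open>auto simp: \<mu>_def tr\<close>)
  also have "\<dots> = of_nat n' * (\<Sum>x\<in>carrier Z. \<phi>' x * cnj (\<phi> x)) / of_nat (card (center A))"
    by (simp add: cZ sum_distrib_left)
  finally have "(\<Sum>x\<in>carrier Z. \<phi>' x * cnj (\<phi> x)) \<noteq> 0" using ne by auto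
  from linear_characters_eq[OF Z finZ mult(2) one(2) mult(1) one(1) this, of z]
  show ?thesis using z by (simp add: cZ \<phi>_def \<phi>'_def)
qed

lemma trace_one: "\<chi> \<one>\<^bsub>G\<^esub> = of_nat n" "\<chi>' \<one>\<^bsub>G\<^esub> = of_nat n'"
proof -
  show "\<chi> \<one>\<^bsub>G\<^esub> = of_nat n" using r.trace_one by (simp add: chi_eq)
  show "\<chi>' \<one>\<^bsub>G\<^esub> = of_nat n'"
    using r'.trace_one subgroup.one_closed[OF subgroup_M] by (simp add: chi'_eq)
qed

lemma subgroup_D_M: "subgroup D (G\<lparr>carrier := M\<rparr>)"
  using G.subgroup_incl[OF subgroup_D subgroup_M D_M] .

text \<open>Unfolds the defect group of the block of \<open>\<chi>'\<close> into a statement about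
  traces of \<open>\<rho>'\<close>, in the shape required by
  \<open>defect_group_stabilizes\<close>.\<close>

lemma defect_class:
  obtains u where "u \<in> M" "D \<subseteq> centralizer (G\<lparr>carrier := M\<rparr>) {u}"
    "card D = l_part l (card (centralizer (G\<lparr>carrier := M\<rparr>) {u}))"
    "star ((\<Sum>x\<in>conj_class (G\<lparr>carrier := M\<rparr>) u. mat_trace (\<rho>' (e x))) / of_nat n') \<noteq> 0"
proof -
  let ?M = "G\<lparr>carrier := M\<rparr>"
  interpret GM: group ?M by (rule group_GM)
  have finM: "finite (carrier ?M)" using finite_subset[OF M_carrier finG] by simp
  have Irr: "\<chi>' \<in> Irr ?M" "defect_group star l ?M (bl star ?M \<chi>') D"
    using chi' by (auto simp: Irr0_def Irr_defect_def)
  then obtain u where u: "u \<in> M"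
    "block_central_char star ?M (bl star ?M \<chi>') (\<lambda>y. if y \<in> conj_class ?M u then 1 else 0) \<noteq> 0"
    "sylow_subgroup l (?M\<lparr>carrier := centralizer ?M {u}\<rparr>) D"
    by (auto simp: defect_group_def)
  have uM: "u \<in> carrier ?M" using u(1) by simp
  note cc = conj_class_closed[OF GM.is_group uM]
  have "central_char star ?M \<chi>' (\<lambda>y. if y \<in> conj_class ?M u then 1 else 0) \<noteq> 0"
    using u(2) block_central_char_bl[OF Irr(1) indicator_center_group_algebra[OF GM.is_group cc],
        of star] by simp
  then have "star (omega ?M \<chi>' (conj_class ?M u)) \<noteq> 0"
    using central_char_class[OF GM.is_group finM uM, of star] by simp
  moreover have "omega ?M \<chi>' (conj_class ?M u) =
      (\<Sum>x\<in>conj_class ?M u. mat_trace (\<rho>' (e x))) / of_nat n'"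
    unfolding omega_def using cc(1) trace_one(2)
    by (intro arg_cong2[of _ _ _ _ "(/)"] sum.cong) (auto simp: chi'_eq)
  ultimately have "star ((\<Sum>x\<in>conj_class ?M u. mat_trace (\<rho>' (e x))) / of_nat n') \<noteq> 0" by simp
  moreover have "D \<subseteq> centralizer ?M {u}" "card D = l_part l (card (centralizer ?M {u}))"
    using u(3) subgroup.subset[of D "?M\<lparr>carrier := centralizer ?M {u}\<rparr>"]
    by (simp_all add: sylow_subgroup_def Coset.order_def)
  ultimately show thesis using that u(1) by blast
qed

lemma image_e_normal: "e ` carrier G \<lhd> A"
proof (rule A.normal_invI)
  show "subgroup (e ` carrier G) A"
    using e.subgroup_img_is_subgroup[OF G.subgroup_self] .
  fix x h assume x: "x \<in> carrier A" and "h \<in> e ` carrier G"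
  then obtain g where g: "g \<in> carrier G" "h = e g" by blast
  have "x \<otimes>\<^bsub>A\<^esub> h \<otimes>\<^bsub>A\<^esub> inv\<^bsub>A\<^esub> x = e (\<sigma> x g)" using \<sigma>_conj[OF x g(1)] g(2) by simp
  then show "x \<otimes>\<^bsub>A\<^esub> h \<otimes>\<^bsub>A\<^esub> inv\<^bsub>A\<^esub> x \<in> e ` carrier G"
    using G.autoD(1)[OF \<sigma>_auto[OF x] g(1)] by blast
qed

lemma representation_subgroup:
  assumes "subgroup J A" shows "representation (A\<lparr>carrier := J\<rparr>) n \<rho>"
proof -
  have "J \<subseteq> carrier A" using assms subgroup.subset by blast
  then have "\<rho> \<in> hom (A\<lparr>carrier := J\<rparr>) (GL n)" using r.rep_hom by (auto simp: hom_def)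
  then show ?thesis
    using subgroup.subgroup_is_group[OF assms A.is_group] r.rep_dim
    by (simp add: representation_def representation_axioms_def)
qed

lemma representation'_subgroup:
  assumes "subgroup J A" "J \<subseteq> N" shows "representation (A\<lparr>carrier := J\<rparr>) n' \<rho>'"
proof -
  have "\<rho>' \<in> hom (A\<lparr>carrier := J\<rparr>) (GL n')" using r'.rep_hom assms(2) by (auto simp: hom_def)
  then show ?thesis
    using subgroup.subgroup_is_group[OF assms(1) A.is_group] r'.rep_dim
    by (simp add: representation_def representation_axioms_def)
qed

lemma pulled_back_G:
  assumes "subgroup J A" "e ` carrier G \<subseteq> J"
  shows "pulled_back_rep l R star K \<nu> G (A\<lparr>carrier := J\<rparr>) n \<rho> e"
proof -
  have "e \<in> hom G (A\<lparr>carrier := J\<rparr>)" using e_hom assms(2) by (auto simp: hom_def)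
  moreover have "finite (carrier (A\<lparr>carrier := J\<rparr>))"
    using finite_subset[OF subgroup.subset[OF assms(1)] finA] by simp
  ultimately show ?thesis
    unfolding pulled_back_rep_def pulled_back_rep_axioms_def
    using mod_red_axioms G.is_group representation_subgroup[OF assms(1)] rho_G finG by blast
qed

lemma pulled_back_M:
  assumes "subgroup J A" "J \<subseteq> N" "e ` M \<subseteq> J"
  shows "pulled_back_rep l R star K \<nu> (G\<lparr>carrier := M\<rparr>) (A\<lparr>carrier := J\<rparr>) n' \<rho>' e"
proof -
  have "e \<in> hom (G\<lparr>carrier := M\<rparr>) (A\<lparr>carrier := J\<rparr>)"
    using e_hom assms(3) M_carrier by (auto simp: hom_def subset_iff)
  moreover have "finite (carrier (A\<lparr>carrier := J\<rparr>))"
    using finite_subset[OF subgroup.subset[OF assms(1)] finA] by simp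
  moreover have "finite (carrier (G\<lparr>carrier := M\<rparr>))"
    using finite_subset[OF M_carrier finG] by simp
  ultimately show ?thesis
    unfolding pulled_back_rep_def pulled_back_rep_axioms_def
    using mod_red_axioms group_GM representation'_subgroup[OF assms(1,2)] rho'_M by blast
qed

text \<open>In \<open>e(G) C\<^sub>A(a)\<close> the conjugacy class of \<open>a\<close> is just its orbit under \<open>G\<close>.\<close>

definition J :: "'c \<Rightarrow> 'c set" where
  "J a = (e ` carrier G) <#>\<^bsub>A\<^esub> centralizer A {a}"

lemma mem_J: "x \<in> J a \<longleftrightarrow>
    (\<exists>g\<in>carrier G. \<exists>c\<in>carrier A. c \<otimes>\<^bsub>A\<^esub> a = a \<otimes>\<^bsub>A\<^esub> c \<and> x = e g \<otimes>\<^bsub>A\<^esub> c)"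
  unfolding J_def set_mult_def centralizer_def by auto

lemma subgroup_J: "a \<in> carrier A \<Longrightarrow> subgroup (J a) A"
  unfolding J_def
  using A.mult_norm_subgroup[OF image_e_normal A.subgroup_centralizer[of "{a}"]] by simp

lemma J_carrier: "a \<in> carrier A \<Longrightarrow> J a \<subseteq> carrier A"
  using subgroup_J subgroup.subset by blast

lemma a_J: assumes "a \<in> carrier A" shows "a \<in> J a"
proof -
  have "a = e \<one>\<^bsub>G\<^esub> \<otimes>\<^bsub>A\<^esub> a" using assms by simp
  then show ?thesis using assms mem_J by blast
qed

lemma e_J: assumes "a \<in> carrier A" shows "e ` carrier G \<subseteq> J a"
proof
  fix x assume "x \<in> e ` carrier G"
  then obtain g where g: "g \<in> carrier G" "x = e g" by blast
  then have "x = e g \<otimes>\<^bsub>A\<^esub> \<one>\<^bsub>A\<^esub>" by simp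
  moreover have "\<one>\<^bsub>A\<^esub> \<otimes>\<^bsub>A\<^esub> a = a \<otimes>\<^bsub>A\<^esub> \<one>\<^bsub>A\<^esub>" using assms by simp
  ultimately show "x \<in> J a" using g(1) mem_J by blast
qed

lemma NJ_eq:
  assumes B: "subgroup B A" "e ` carrier G \<subseteq> B"
  shows "(e ` M) <#>\<^bsub>A\<^esub> normalizer (A\<lparr>carrier := B\<rparr>) (e ` D) = N \<inter> B"
proof -
  interpret AB: group "A\<lparr>carrier := B\<rparr>" using subgroup.subgroup_is_group[OF B(1) A.is_group] .
  have D: "e ` D \<subseteq> carrier (A\<lparr>carrier := B\<rparr>)" "finite (e ` D)"
    using B(2) D_carrier finite_subset[OF D_carrier finG] by auto
  have nor: "b \<in> normalizer (A\<lparr>carrier := B\<rparr>) (e ` D) \<longleftrightarrow> b \<in> nA \<and> b \<in> B" for b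
  proof -
    have "b \<in> B \<Longrightarrow> inv\<^bsub>A\<lparr>carrier := B\<rparr>\<^esub> b = inv\<^bsub>A\<^esub> b" using A.m_inv_consistent[OF B(1)] .
    then show ?thesis
      using AB.normalizer_iff[OF D] nA_iff[of b] subgroup.mem_carrier[OF B(1)] by auto
  qed
  show ?thesis
  proof (intro equalityI subsetI)
    fix x assume "x \<in> (e ` M) <#>\<^bsub>A\<^esub> normalizer (A\<lparr>carrier := B\<rparr>) (e ` D)"
    then obtain m b where x: "m \<in> M" "b \<in> nA" "b \<in> B" "x = e m \<otimes>\<^bsub>A\<^esub> b"
      unfolding set_mult_def using nor by blast
    have "e m \<in> B" using x(1) B(2) M_carrier by blast
    then show "x \<in> N \<inter> B" using x mem_N subgroup.m_closed[OF B(1)] by blast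
  next
    fix x assume "x \<in> N \<inter> B"
    then obtain m b where x: "m \<in> M" "b \<in> nA" "x = e m \<otimes>\<^bsub>A\<^esub> b" "x \<in> B" using mem_N by blast
    have em: "e m \<in> B" "e m \<in> carrier A" using x(1) B(2) M_carrier by auto
    have "b = inv\<^bsub>A\<^esub> e m \<otimes>\<^bsub>A\<^esub> x" using x em nA_carrier by (simp add: A.mult_inv_cancel)
    then have "b \<in> B" using subgroup.m_closed[OF B(1) subgroup.m_inv_closed[OF B(1) em(1)] x(4)] by simp
    then show "x \<in> (e ` M) <#>\<^bsub>A\<^esub> normalizer (A\<lparr>carrier := B\<rparr>) (e ` D)"
      using x nor unfolding set_mult_def by blast
  qed
qed

text \<open>By Sylow's theorem in the centralizer of \<open>a\<close>, the element \<open>g\<close> can be moved into \<open>N\<^sub>G(D)\<close>.\<close>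

lemma conjugate_centralized_by_D:
  assumes a: "a \<in> carrier A" and DC: "D \<subseteq> CG a" "card D = l_part l (card (CG a))"
    and g: "g \<in> carrier G" "D \<subseteq> CG (e g \<otimes>\<^bsub>A\<^esub> a \<otimes>\<^bsub>A\<^esub> inv\<^bsub>A\<^esub> e g)"
  obtains m where "m \<in> M" "e g \<otimes>\<^bsub>A\<^esub> a \<otimes>\<^bsub>A\<^esub> inv\<^bsub>A\<^esub> e g = e m \<otimes>\<^bsub>A\<^esub> a \<otimes>\<^bsub>A\<^esub> inv\<^bsub>A\<^esub> e m"
proof -
  \<comment> \<open>\<open>D\<close> centralizes the conjugate of \<open>a\<close> by
    \<open>g\<close>, so its conjugate by the inverse of \<open>g\<close> centralizes
    \<open>a\<close>; inside \<open>CG a\<close> it can be moved into the Sylow subgroup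
    \<open>D\<close>.\<close>
  define D' where "D' = inv\<^bsub>G\<^esub> g <#\<^bsub>G\<^esub> D #>\<^bsub>G\<^esub> g"
  have D'_eq: "D' = (\<lambda>d. inv\<^bsub>G\<^esub> g \<otimes>\<^bsub>G\<^esub> d \<otimes>\<^bsub>G\<^esub> g) ` D"
    by (auto simp: D'_def l_coset_def r_coset_def)
  have D': "subgroup D' G" unfolding D'_def using G.subgroup_conjugation_is_surj1[OF g(1) subgroup_D] .
  obtain r where r: "card D = l ^ r" by (rule card_D)
  have "inj_on (\<lambda>d. inv\<^bsub>G\<^esub> g \<otimes>\<^bsub>G\<^esub> d \<otimes>\<^bsub>G\<^esub> g) D"
    using g(1) D_carrier by (auto simp: inj_on_def subset_iff)
  then have cD': "card D' = l ^ r" unfolding D'_eq by (simp add: card_image r)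
  have D'C: "D' \<subseteq> CG a"
  proof
    fix x assume "x \<in> D'"
    then obtain d where d: "d \<in> D" "x = inv\<^bsub>G\<^esub> g \<otimes>\<^bsub>G\<^esub> d \<otimes>\<^bsub>G\<^esub> g" unfolding D'_eq by blast
    have dG: "d \<in> carrier G" using d(1) D_carrier by blast
    define v where "v = e g \<otimes>\<^bsub>A\<^esub> a \<otimes>\<^bsub>A\<^esub> inv\<^bsub>A\<^esub> e g"
    have vA: "v \<in> carrier A" using g(1) a by (simp add: v_def)
    have dv: "e d \<otimes>\<^bsub>A\<^esub> v = v \<otimes>\<^bsub>A\<^esub> e d" using d(1) g(2) CG_iff[OF vA] by (auto simp: v_def)
    have ga: "e g \<otimes>\<^bsub>A\<^esub> a = v \<otimes>\<^bsub>A\<^esub> e g" using g(1) a by (simp add: v_def A.m_assoc)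
    have eg: "e g \<in> carrier A" "e d \<in> carrier A" using g(1) dG by auto
    have "e x \<otimes>\<^bsub>A\<^esub> a = inv\<^bsub>A\<^esub> e g \<otimes>\<^bsub>A\<^esub> e d \<otimes>\<^bsub>A\<^esub> (e g \<otimes>\<^bsub>A\<^esub> a)"
      using d(2) dG g(1) a by (simp add: A.m_assoc)
    also have "\<dots> = inv\<^bsub>A\<^esub> e g \<otimes>\<^bsub>A\<^esub> (e d \<otimes>\<^bsub>A\<^esub> v) \<otimes>\<^bsub>A\<^esub> e g"
      unfolding ga using eg vA by (simp add: A.m_assoc)
    also have "\<dots> = inv\<^bsub>A\<^esub> e g \<otimes>\<^bsub>A\<^esub> v \<otimes>\<^bsub>A\<^esub> e d \<otimes>\<^bsub>A\<^esub> e g"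
      unfolding dv using eg vA by (simp add: A.m_assoc)
    also have "inv\<^bsub>A\<^esub> e g \<otimes>\<^bsub>A\<^esub> v = a \<otimes>\<^bsub>A\<^esub> inv\<^bsub>A\<^esub> e g"
      using g(1) a by (simp add: v_def A.m_assoc A.mult_inv_cancel)
    finally have "e x \<otimes>\<^bsub>A\<^esub> a = a \<otimes>\<^bsub>A\<^esub> e x"
      using d(2) dG g(1) a by (simp add: A.m_assoc)
    then show "x \<in> CG a" using CG_iff[OF a] d(2) dG g(1) by simp
  qed
  obtain c where c: "c \<in> CG a" "\<And>p. p \<in> D' \<Longrightarrow> c \<otimes>\<^bsub>G\<^esub> p \<otimes>\<^bsub>G\<^esub> inv\<^bsub>G\<^esub> c \<in> D"
    using G.sylow_conj[OF finG l subgroup_CG[OF a] subgroup_D DC D' D'C cD'] by blast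
  have cG: "c \<in> carrier G" using c(1) by (simp add: CG_def)
  \<comment> \<open>\<open>h\<close> normalizes \<open>D\<close> and so lies in \<open>M\<close>.
    Its inverse is \<open>g\<close> times an element of \<open>CG a\<close>, hence conjugates
    \<open>a\<close> to the same element as \<open>g\<close> does.\<close>
  define h where "h = c \<otimes>\<^bsub>G\<^esub> inv\<^bsub>G\<^esub> g"
  have hG: "h \<in> carrier G" using cG g(1) by (simp add: h_def)
  have "h \<otimes>\<^bsub>G\<^esub> d \<otimes>\<^bsub>G\<^esub> inv\<^bsub>G\<^esub> h \<in> D" if "d \<in> D" for d
  proof -
    have dG: "d \<in> carrier G" using that D_carrier by blast
    have "h \<otimes>\<^bsub>G\<^esub> d \<otimes>\<^bsub>G\<^esub> inv\<^bsub>G\<^esub> h = c \<otimes>\<^bsub>G\<^esub> (inv\<^bsub>G\<^esub> g \<otimes>\<^bsub>G\<^esub> d \<otimes>\<^bsub>G\<^esub> g) \<otimes>\<^bsub>G\<^esub> inv\<^bsub>G\<^esub> c"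
      using dG cG g(1) by (simp add: h_def G.m_assoc G.inv_mult_group)
    then show ?thesis using c(2) that unfolding D'_eq by simp
  qed
  then have "h \<in> M"
    using G.normalizer_iff[OF D_carrier finite_subset[OF D_carrier finG]] hG normalizer_le by blast
  then have m: "inv\<^bsub>G\<^esub> h \<in> M" using subgroup.m_inv_closed[OF subgroup_M] by simp
  have ci: "inv\<^bsub>G\<^esub> c \<in> CG a" using subgroup.m_inv_closed[OF subgroup_CG[OF a] c(1)] .
  have "inv\<^bsub>G\<^esub> h = g \<otimes>\<^bsub>G\<^esub> inv\<^bsub>G\<^esub> c" using cG g(1) by (simp add: h_def G.inv_mult_group)
  then have "e (inv\<^bsub>G\<^esub> h) \<otimes>\<^bsub>A\<^esub> a \<otimes>\<^bsub>A\<^esub> inv\<^bsub>A\<^esub> e (inv\<^bsub>G\<^esub> h) =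
      e g \<otimes>\<^bsub>A\<^esub> (e (inv\<^bsub>G\<^esub> c) \<otimes>\<^bsub>A\<^esub> a \<otimes>\<^bsub>A\<^esub> inv\<^bsub>A\<^esub> e (inv\<^bsub>G\<^esub> c)) \<otimes>\<^bsub>A\<^esub> inv\<^bsub>A\<^esub> e g"
    using cG g(1) a by (simp add: A.m_assoc A.inv_mult_group)
  also have "e (inv\<^bsub>G\<^esub> c) \<otimes>\<^bsub>A\<^esub> a \<otimes>\<^bsub>A\<^esub> inv\<^bsub>A\<^esub> e (inv\<^bsub>G\<^esub> c) = a" using ci unfolding CG_def by blast
  finally show thesis using that[OF m] by simp
qed

end

lemma (in pulled_back_rep) omega_eq_omg:
  assumes K: "invariant C" and \<psi>: "\<And>x. x \<in> carrier H \<Longrightarrow> \<psi> x = mat_trace (\<rho> x)"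
  shows "omega H \<psi> C = omg C"
proof -
  have "(\<Sum>x\<in>C. \<psi> x) = (\<Sum>x\<in>C. \<chi> x)"
    using invariant_subset[OF K] \<psi> by (intro sum.cong) (auto simp: \<chi>_def)
  then show ?thesis using \<psi>[of "\<one>\<^bsub>H\<^esub>"] H.trace_one by (simp add: omega_def omg_def)
qed

lemma (in pulled_back_rep) invariant_if_closed:
  assumes "C \<subseteq> carrier H" "\<And>y h. y \<in> C \<Longrightarrow> h \<in> carrier H \<Longrightarrow> h \<otimes>\<^bsub>H\<^esub> y \<otimes>\<^bsub>H\<^esub> inv\<^bsub>H\<^esub> h \<in> C"
  shows "invariant C"
  using assms by (auto simp: invariant_def act_def)

section \<open>The congruence at a fixed preimage \<open>a\<close>\<close>

context AM_characters
begin

lemma conj_J: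
  assumes a: "a \<in> carrier A" and h: "h \<in> J a"
  obtains g where "g \<in> carrier G" "h \<otimes>\<^bsub>A\<^esub> a \<otimes>\<^bsub>A\<^esub> inv\<^bsub>A\<^esub> h = e g \<otimes>\<^bsub>A\<^esub> a \<otimes>\<^bsub>A\<^esub> inv\<^bsub>A\<^esub> e g"
proof -
  obtain g c where gc: "g \<in> carrier G" "c \<in> carrier A" "c \<otimes>\<^bsub>A\<^esub> a = a \<otimes>\<^bsub>A\<^esub> c" "h = e g \<otimes>\<^bsub>A\<^esub> c"
    using h mem_J by blast
  have "h \<otimes>\<^bsub>A\<^esub> a \<otimes>\<^bsub>A\<^esub> inv\<^bsub>A\<^esub> h = e g \<otimes>\<^bsub>A\<^esub> (c \<otimes>\<^bsub>A\<^esub> a \<otimes>\<^bsub>A\<^esub> inv\<^bsub>A\<^esub> c) \<otimes>\<^bsub>A\<^esub> inv\<^bsub>A\<^esub> e g"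
    using gc(1,2) a unfolding gc(4) by (simp add: A.inv_mult_group A.m_assoc)
  also have "c \<otimes>\<^bsub>A\<^esub> a \<otimes>\<^bsub>A\<^esub> inv\<^bsub>A\<^esub> c = a" unfolding gc(3) using gc(2) a by (simp add: A.m_assoc)
  finally show thesis using that gc(1) by blast
qed

lemma trace_congruence:
  assumes a: "a \<in> N" and DC: "D \<subseteq> CG a" and cD: "card D = l_part l (card (CG a))"
  shows "mat_trace (\<rho> a) \<in> R" and "mat_trace (\<rho>' a) \<in> R"
    and "star (of_nat (AM_epsilon l G M \<chi> \<chi>')) * star (mat_trace (\<rho> a)) = star (mat_trace (\<rho>' a))"
proof -
  have aA: "a \<in> carrier A" using a N_carrier by blast
  let ?AJ = "A\<lparr>carrier := J a\<rparr>"
  let ?NJ = "A\<lparr>carrier := N \<inter> J a\<rparr>"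
  let ?M = "G\<lparr>carrier := M\<rparr>"
  note sJ = subgroup_J[OF aA]
  have sNJ: "subgroup (N \<inter> J a) A" using A.subgroups_Inter_pair[OF subgroup_N sJ] .
  have eM: "e ` M \<subseteq> N \<inter> J a" using e_M_N e_J[OF aA] M_carrier by blast
  interpret GJ: pulled_back_rep l R star K \<nu> G ?AJ n \<rho> e by (rule pulled_back_G[OF sJ e_J[OF aA]])
  interpret MJ: pulled_back_rep l R star K \<nu> ?M ?NJ n' \<rho>' e
    by (rule pulled_back_M[OF sNJ _ eM]) simp
  have aJ: "a \<in> carrier ?AJ" using a_J[OF aA] by simp
  have aNJ: "a \<in> carrier ?NJ" using a a_J[OF aA] by simp
  have invJ: "inv\<^bsub>?AJ\<^esub> x = inv\<^bsub>A\<^esub> x" if "x \<in> J a" for x using A.m_inv_consistent[OF sJ that] .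
  have invNJ: "inv\<^bsub>?NJ\<^esub> x = inv\<^bsub>A\<^esub> x" if "x \<in> N \<inter> J a" for x using A.m_inv_consistent[OF sNJ that] .
  have actG: "GJ.act g w = e g \<otimes>\<^bsub>A\<^esub> w \<otimes>\<^bsub>A\<^esub> inv\<^bsub>A\<^esub> e g" if "g \<in> carrier G" for g w
  proof -
    have "e g \<in> J a" using e_J[OF aA] that by blast
    from invJ[OF this] show ?thesis unfolding GJ.act_def by simp
  qed
  have actM: "MJ.act m w = e m \<otimes>\<^bsub>A\<^esub> w \<otimes>\<^bsub>A\<^esub> inv\<^bsub>A\<^esub> e m" if "m \<in> M" for m w
  proof -
    have "e m \<in> N \<inter> J a" using eM that by blast
    from invNJ[OF this] show ?thesis unfolding MJ.act_def by simp
  qed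
  define C where "C = conj_class ?AJ a"
  have C_orb: "C = GJ.orb a"
  proof (intro equalityI subsetI)
    fix x assume "x \<in> C"
    then obtain h where h: "h \<in> J a" "x = h \<otimes>\<^bsub>A\<^esub> a \<otimes>\<^bsub>A\<^esub> inv\<^bsub>A\<^esub> h"
      unfolding C_def conj_class_def using invJ by auto
    obtain g where g: "g \<in> carrier G" "x = e g \<otimes>\<^bsub>A\<^esub> a \<otimes>\<^bsub>A\<^esub> inv\<^bsub>A\<^esub> e g"
      using conj_J[OF aA h(1)] h(2) by metis
    have "x = GJ.act g a" using g(2) actG[OF g(1)] by metis
    then show "x \<in> GJ.orb a" unfolding GJ.orb_def using g(1) by blast
  next
    fix x assume "x \<in> GJ.orb a"
    then obtain g where g: "g \<in> carrier G" "x = GJ.act g a" by (auto simp: GJ.orb_def)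
    then have "e g \<in> carrier ?AJ" using e_J[OF aA] by auto
    then show "x \<in> C" using g(2) unfolding C_def conj_class_def GJ.act_def by blast
  qed
  note ccJ = conj_class_closed[OF GJ.H.is_group aJ, folded C_def]
  define \<psi> where "\<psi> = restrict (\<lambda>x. mat_trace (\<rho> x)) (J a)"
  define \<psi>' where "\<psi>' = restrict (\<lambda>x. mat_trace (\<rho>' x)) (N \<inter> J a)"
  have irrJ: "irreducible_rep ?AJ n \<rho>"
    using irreducible_rep_pullback[OF GJ.H.is_group GJ.e_hom GJ.H.rep_hom GJ.irr] .
  have \<psi>: "\<psi> \<in> Irr ?AJ" unfolding \<psi>_def using irreducible_imp_Irr[OF irrJ] by fastforce
  have irrNJ: "irreducible_rep ?NJ n' \<rho>'"
    using irreducible_rep_pullback[OF MJ.H.is_group MJ.e_hom MJ.H.rep_hom MJ.irr] .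
  have \<psi>': "\<psi>' \<in> Irr ?NJ" unfolding \<psi>'_def using irreducible_imp_Irr[OF irrNJ] by fastforce
  have ind: "is_induced_block star ?AJ (N \<inter> J a) (bl star ?NJ \<psi>') (bl star ?AJ \<psi>)"
  proof -
    have "N \<inter> (N \<inter> J a) = N \<inter> J a" "carrier A \<inter> J a = J a" using J_carrier[OF aA] by auto
    then show ?thesis
      unfolding \<psi>_def \<psi>'_def
      using blocks[OF sJ e_J[OF aA], of "N \<inter> J a"] NJ_eq[OF sJ e_J[OF aA]]
      by (simp only: restrict_restrict)
  qed
  have ind_C: "(\<lambda>x. if x \<in> C then 1 else 0) \<in> center_group_algebra ?AJ"
    by (rule indicator_center_group_algebra[OF GJ.H.is_group ccJ])
  have "block_central_char star ?AJ (bl star ?AJ \<psi>) (\<lambda>x. if x \<in> C then 1 else 0) =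
      induced_central_char star ?AJ (N \<inter> J a) (bl star ?NJ \<psi>') (\<lambda>x. if x \<in> C then 1 else 0)"
    using ind ind_C unfolding is_induced_block_def by blast
  moreover have "block_central_char star ?AJ (bl star ?AJ \<psi>) (\<lambda>x. if x \<in> C then 1 else 0) =
      star (omega ?AJ \<psi> C)"
    using block_central_char_bl[OF \<psi> ind_C, of star]
      central_char_class[OF GJ.H.is_group GJ.finH aJ, of star \<psi>] by (simp add: C_def)
  moreover have "omega ?AJ \<psi> C = GJ.omg (GJ.orb a)"
    unfolding C_orb using GJ.omega_eq_omg[OF GJ.invariant_orb[OF aJ], of \<psi>] by (simp add: \<psi>_def)
  moreover have "(\<lambda>x. if x \<in> N \<inter> J a then (if x \<in> C then 1 else 0) else 0) =
      (\<lambda>x. if x \<in> C \<inter> (N \<inter> J a) then 1 else (0::'k))" by auto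
  ultimately have LR: "star (GJ.omg (GJ.orb a)) =
      block_central_char star ?NJ (bl star ?NJ \<psi>') (\<lambda>x. if x \<in> C \<inter> (N \<inter> J a) then 1 else 0)"
    unfolding induced_central_char_def by simp
  \<comment> \<open>Brauer induction truncates the class sum of \<open>C\<close> to the subgroup.
    What remains is a union of classes of \<open>N \<inter> J a\<close>, and each of these is a
    union of \<open>M\<close>-orbits.\<close>
  define U where "U = C \<inter> (N \<inter> J a)"
  have U_sub: "U \<subseteq> carrier ?NJ" unfolding U_def by auto
  have U_closed: "h \<otimes>\<^bsub>?NJ\<^esub> y \<otimes>\<^bsub>?NJ\<^esub> inv\<^bsub>?NJ\<^esub> h \<in> U" if y: "y \<in> U" and h: "h \<in> carrier ?NJ" for y h
  proof -
    have "h \<otimes>\<^bsub>?NJ\<^esub> y \<otimes>\<^bsub>?NJ\<^esub> inv\<^bsub>?NJ\<^esub> h \<in> carrier ?NJ" using y h U_sub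
      by (intro MJ.H.m_closed MJ.H.inv_closed) auto
    moreover have "h \<otimes>\<^bsub>?NJ\<^esub> y \<otimes>\<^bsub>?NJ\<^esub> inv\<^bsub>?NJ\<^esub> h = h \<otimes>\<^bsub>?AJ\<^esub> y \<otimes>\<^bsub>?AJ\<^esub> inv\<^bsub>?AJ\<^esub> h"
      using invJ[of h] invNJ[of h] h by simp
    moreover have "h \<otimes>\<^bsub>?AJ\<^esub> y \<otimes>\<^bsub>?AJ\<^esub> inv\<^bsub>?AJ\<^esub> h \<in> C" using ccJ(2)[of y h] y h by (simp add: U_def)
    ultimately show ?thesis by (simp add: U_def)
  qed
  have "star (GJ.omg (GJ.orb a)) = central_char star ?NJ \<psi>' (\<lambda>x. if x \<in> U then 1 else 0)"
    unfolding LR U_def[symmetric]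
    using block_central_char_bl[OF \<psi>' indicator_center_group_algebra[OF MJ.H.is_group U_sub U_closed], of star] .
  also have "\<dots> = (\<Sum>B\<in>{B \<in> conj_classes ?NJ. B \<subseteq> U}. star (omega ?NJ \<psi>' B))"
    by (rule central_char_indicator[OF MJ.H.is_group MJ.finH U_closed])
  also have "\<dots> = (\<Sum>B\<in>{B \<in> conj_classes ?NJ. B \<subseteq> U}. if a \<in> B then star (MJ.omg (MJ.orb a)) else 0)"
  proof (intro sum.cong refl)
    fix B assume B: "B \<in> {B \<in> conj_classes ?NJ. B \<subseteq> U}"
    then obtain b where b: "b \<in> carrier ?NJ" "B = conj_class ?NJ b" by (auto simp: conj_classes_def)
    have invB: "MJ.invariant B"
      unfolding b(2) by (rule MJ.invariant_if_closed[OF conj_class_closed[OF MJ.H.is_group b(1)]])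
    \<comment> \<open>An orbit that survives reduction contains an element \<open>v\<close>
      centralized by \<open>D\<close>. Being in \<open>C\<close>, it is a conjugate of
      \<open>a\<close> under \<open>G\<close>, hence under \<open>M\<close> by
      \<open>conjugate_centralized_by_D\<close>.\<close>
    have "w \<in> MJ.orb a" if w: "w \<in> B" "star (MJ.omg (MJ.orb w)) \<noteq> 0" for w
    proof -
      have wNJ: "w \<in> carrier ?NJ" using MJ.invariant_subset[OF invB] w(1) by blast
      obtain u where u: "u \<in> M" "D \<subseteq> centralizer ?M {u}" "card D = l_part l (card (centralizer ?M {u}))"
        "star ((\<Sum>x\<in>conj_class ?M u. mat_trace (\<rho>' (e x))) / of_nat n') \<noteq> 0"
        by (rule defect_class)
      have finM: "finite (carrier ?M)" by (rule MJ.finY)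
      have ht: "multiplicity l (n' * card D) = multiplicity l (Coset.order ?M)"
        using Irr0_height[OF group_GM finM l subgroup_D_M chi', of n'] trace_one(2) r'.rep_dim by simp
      have uM: "u \<in> carrier ?M" using u(1) by simp
      have df: "star ((\<Sum>x\<in>conj_class ?M u. MJ.\<chi> (e x)) / of_nat n') \<noteq> 0"
        using u(4) by (simp add: MJ.\<chi>_def)
      obtain v where v: "v \<in> MJ.orb w" "D \<subseteq> MJ.stab v"
        by (rule MJ.defect_group_stabilizes[OF uM subgroup_D_M u(2,3) df ht wNJ w(2)])
      have "v \<in> B" using v(1) MJ.invariant_act[OF invB _ w(1)] by (auto simp: MJ.orb_def)
      then have "v \<in> GJ.orb a" using B by (auto simp: U_def C_orb)
      then obtain g where g: "g \<in> carrier G" "v = e g \<otimes>\<^bsub>A\<^esub> a \<otimes>\<^bsub>A\<^esub> inv\<^bsub>A\<^esub> e g"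
        using actG by (auto simp: GJ.orb_def)
      have "D \<subseteq> CG v" using v(2) D_carrier actM D_M by (auto simp: MJ.stab_def CG_def)
      then obtain m where m: "m \<in> M" "v = e m \<otimes>\<^bsub>A\<^esub> a \<otimes>\<^bsub>A\<^esub> inv\<^bsub>A\<^esub> e m"
        using conjugate_centralized_by_D[OF aA DC cD g(1)] g(2) by metis
      then have "v = MJ.act m a" using actM by simp
      then have "v \<in> MJ.orb a" using m(1) by (auto simp: MJ.orb_def)
      then show ?thesis
        using MJ.orb_eq[OF aNJ] MJ.orb_eq[OF wNJ v(1)] MJ.mem_orb[OF wNJ] by metis
    qed
    then have "star (MJ.omg B) = (if a \<in> B then star (MJ.omg (MJ.orb a)) else 0)"
      by (intro MJ.star_omg_invariant[OF invB aNJ])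
    moreover have "omega ?NJ \<psi>' B = MJ.omg B"
      using MJ.omega_eq_omg[OF invB, of \<psi>'] by (simp add: \<psi>'_def)
    ultimately show "star (omega ?NJ \<psi>' B) = (if a \<in> B then star (MJ.omg (MJ.orb a)) else 0)" by simp
  qed
  \<comment> \<open>Classes are disjoint, so \<open>a\<close> lies in exactly one of them, and that
    one is contained in \<open>U\<close>.\<close>
  also have "\<dots> = (\<Sum>B\<in>{conj_class ?NJ a}. star (MJ.omg (MJ.orb a)))"
  proof (rule sum.mono_neutral_cong_right)
    show "finite {B \<in> conj_classes ?NJ. B \<subseteq> U}" using MJ.finH by (simp add: conj_classes_def)
    have aU: "a \<in> U" using aNJ GJ.mem_orb[OF aJ] by (simp add: U_def C_orb)
    then have "conj_class ?NJ a \<subseteq> U" unfolding conj_class_def using U_closed[OF aU] by auto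
    then show "{conj_class ?NJ a} \<subseteq> {B \<in> conj_classes ?NJ. B \<subseteq> U}" using aNJ by (auto simp: conj_classes_def)
    show "\<forall>B\<in>{B \<in> conj_classes ?NJ. B \<subseteq> U} - {conj_class ?NJ a}.
        (if a \<in> B then star (MJ.omg (MJ.orb a)) else 0) = 0"
      using conj_classes_disjoint(1)[OF MJ.H.is_group] by auto
    show "(if a \<in> B then star (MJ.omg (MJ.orb a)) else 0) = star (MJ.omg (MJ.orb a))"
      if "B \<in> {conj_class ?NJ a}" for B
      using that MJ.H.mem_conj_class[OF aNJ] by simp
  qed
  finally have main: "star (GJ.omg (GJ.orb a)) = star (MJ.omg (MJ.orb a))" by simp
  show tR: "mat_trace (\<rho> a) \<in> R" using GJ.\<chi>_R[OF aJ] by (simp add: GJ.\<chi>_def)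
  show t'R: "mat_trace (\<rho>' a) \<in> R" using MJ.\<chi>_R[OF aNJ] by (simp add: MJ.\<chi>_def)
  \<comment> \<open>By the orbit-stabilizer theorem \<open>s\<close> and \<open>s'\<close> are the
    indices of \<open>CG a\<close> in \<open>G\<close> and of \<open>CG a \<inter> M\<close> in
    \<open>M\<close>.\<close>
  define s where "s = card (GJ.orb a)"
  define s' where "s' = card (MJ.orb a)"
  have stG: "GJ.stab a = CG a" using actG by (auto simp: GJ.stab_def CG_def)
  have stM: "MJ.stab a = CG a \<inter> M" using actM M_carrier by (auto simp: MJ.stab_def CG_def)
  have oG: "s * card (CG a) = card (carrier G)"
    using GJ.card_orb[OF aJ] by (simp add: s_def stG Coset.order_def)
  have oM: "s' * card (CG a \<inter> M) = card M"
    using MJ.card_orb[OF aNJ] by (simp add: s'_def stM Coset.order_def)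
  have sCG: "subgroup (CG a) G" by (rule subgroup_CG[OF aA])
  have sCM: "subgroup (CG a \<inter> M) G" using G.subgroups_Inter_pair[OF sCG subgroup_M] .
  note cpos = G.card_subgroup_pos[OF finG]
  have G0: "card (carrier G) > 0" using cpos[OF G.subgroup_self] .
  have pos: "s > 0" "s' > 0"     using oG oM G0 cpos[OF subgroup_M] by (cases s; cases s'; simp)+
  obtain c where c: "card (CG a) = c * card (CG a \<inter> M)" "c mod l = 1"
    using G.index_mod_of_normalizer_le[OF finG l sCG subgroup_M subgroup_D DC D_M cD normalizer_le] .
  have i: "group_index G M * card M = card (carrier G)"
    using G.group_index_mult[OF subgroup_M] by (simp add: Coset.order_def)
  then have i0: "group_index G M > 0" using G0 by (cases "group_index G M") simp_all
  have c0: "c > 0" using c(1) cpos[OF sCG] by (cases c) simp_all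
  have mD: "multiplicity l (card D) = multiplicity l (card (CG a))"
    using cD l_part_power[OF l] l_part_eq_iff[OF l] by (metis l_part_def)
  have lc: "\<not> l dvd c"
  proof
    assume "l dvd c"
    then have "c mod l = 0" by simp
    then show False using c(2) by simp
  qed
  note mm = prime_elem_multiplicity_mult_distrib[OF prime_imp_prime_elem[OF l]]
  have mCM: "multiplicity l (card (CG a)) = multiplicity l (card (CG a \<inter> M))"
    unfolding c(1) using mm[of c "card (CG a \<inter> M)"] c0 cpos[OF sCM] not_dvd_imp_multiplicity_0[OF lc] by simp
  have htG: "multiplicity l (n * card D) = multiplicity l (card (carrier G))"
    using Irr0_height[OF G.is_group finG l subgroup_D chi, of n] trace_one(1) r.rep_dim
    by (simp add: Coset.order_def)
  have htM: "multiplicity l (n' * card D) = multiplicity l (card M)"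
    using Irr0_height[OF group_GM MJ.finY l subgroup_D_M chi', of n'] trace_one(2) r'.rep_dim
    by (simp add: Coset.order_def)
  \<comment> \<open>Both \<open>n * card D\<close> and \<open>s * card (CG a)\<close> have the
    \<open>l\<close>-part of the order of \<open>G\<close>, and \<open>D\<close> accounts for the
    \<open>l\<close>-part of \<open>CG a\<close>. The same holds in \<open>M\<close>, since
    \<open>c\<close> is prime to \<open>l\<close>.\<close>
  have mG: "multiplicity l s = multiplicity l n"
    using htG mm[of n "card D"] mm[of s "card (CG a)"] oG mD r.rep_dim pos cpos[OF subgroup_D] cpos[OF sCG]
    by simp
  have mM: "multiplicity l s' = multiplicity l n'"
    using htM mm[of n' "card D"] mm[of s' "card (CG a \<inter> M)"] oM mD mCM r'.rep_dim pos
      cpos[OF subgroup_D] cpos[OF sCM] by simp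
  have eq: "star (of_nat s * mat_trace (\<rho> a) / of_nat n) = star (of_nat s' * mat_trace (\<rho>' a) / of_nat n')"
    using main unfolding GJ.omg_orb[OF aJ] MJ.omg_orb[OF aNJ] s_def s'_def GJ.\<chi>_def MJ.\<chi>_def .
  \<comment> \<open>Both sides are the order of \<open>G\<close>, counted through \<open>M\<close>
    and through \<open>CG a\<close>.\<close>
  have cc: "group_index G M * (s' * card (CG a \<inter> M)) = s * (c * card (CG a \<inter> M))"
    using i oG oM c(1) by simp
  have deg: "char_degree G \<chi> = n" "char_degree ?M \<chi>' = n'"
    using char_degree_eq[of \<chi> G n] char_degree_eq[of \<chi>' ?M n'] trace_one by auto
  have nd: "\<not> l dvd l'_part l n" "\<not> l dvd l'_part l (group_index G M) * l'_part l n'"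
    using not_dvd_l'_part[OF l] r.rep_dim r'.rep_dim i0 prime_dvd_mult_iff[OF l] by auto
  have "(AM_epsilon l G M \<chi> \<chi>' * l'_part l n) mod l = (l'_part l (group_index G M) * l'_part l n') mod l"
    using theI'[OF congruence_scalar_unique[OF nd]] unfolding AM_epsilon_def deg by blast
  from epsilon_congruence[OF r.rep_dim r'.rep_dim pos i0 cpos[OF sCM] mG mM tR t'R eq cc c(2) this]
  show "star (of_nat (AM_epsilon l G M \<chi> \<chi>')) * star (mat_trace (\<rho> a)) = star (mat_trace (\<rho>' a))"
    using star_of_nat by simp
qed

section \<open>The projective representations\<close>

text \<open>The identity is treated separately because a section has to send it to the
  identity.\<close>

definition rep :: "('a \<Rightarrow> 'a) \<Rightarrow> 'a" where
  "rep s = (if s = \<one>\<^bsub>AutoGroup G\<^esub> then \<one>\<^bsub>G\<^esub> else SOME g. g \<in> carrier G \<and> inner G g = s)"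

text \<open>On inner automorphisms the preimage in \<open>A\<close> is taken from
  \<open>rep\<close>, so that the projective representations restrict there to a linear
  representation composed with \<open>rep\<close>. That \<open>e (rep x)\<close> is indeed a
  preimage of \<open>x\<close> is \<open>\<sigma>_e\<close>.\<close>

definition repA :: "('a \<Rightarrow> 'a) \<Rightarrow> 'c" where
  "repA x = (if x \<in> inner G ` carrier G then e (rep x) else SOME a. a \<in> carrier A \<and> \<sigma> a = x)"

lemma rep: "s \<in> inner G ` carrier G \<Longrightarrow> rep s \<in> carrier G \<and> inner G (rep s) = s"
proof (cases "s = \<one>\<^bsub>AutoGroup G\<^esub>")
  case True
  have "inner G \<one>\<^bsub>G\<^esub> = \<one>\<^bsub>AutoGroup G\<^esub>" by (auto simp: inner_def G.AutoGroup_one)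
  then show ?thesis using True by (simp add: rep_def)
next
  case False
  assume "s \<in> inner G ` carrier G"
  then have "\<exists>g. g \<in> carrier G \<and> inner G g = s" by auto
  from someI_ex[OF this] show ?thesis using False by (simp add: rep_def)
qed

lemma repA: assumes "x \<in> Aut_char G \<chi>" shows "repA x \<in> carrier A" "\<sigma> (repA x) = x"
proof -
  have "repA x \<in> carrier A \<and> \<sigma> (repA x) = x"
  proof (cases "x \<in> inner G ` carrier G")
    case True
    then show ?thesis using rep[OF True] \<sigma>_e[of "rep x"] by (simp add: repA_def)
  next
    case False
    have "\<exists>a. a \<in> carrier A \<and> \<sigma> a = x" using \<sigma>_surj[OF assms] by metis
    from someI_ex[OF this] show ?thesis using False by (simp add: repA_def)
  qed
  then show "repA x \<in> carrier A" "\<sigma> (repA x) = x" by auto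
qed

text \<open>The factor set of the central extension \<open>A\<close> of
  \<open>Aut_char G \<chi>\<close>, with values in the center of \<open>A\<close>.\<close>

definition cocycle :: "('a \<Rightarrow> 'a) \<Rightarrow> ('a \<Rightarrow> 'a) \<Rightarrow> 'c" where
  "cocycle x y = repA x \<otimes>\<^bsub>A\<^esub> repA y \<otimes>\<^bsub>A\<^esub> inv\<^bsub>A\<^esub> repA (x \<otimes>\<^bsub>AutoGroup G\<^esub> y)"

lemma Aut_char_mult:
  assumes "x \<in> Aut_char G \<chi>" "y \<in> Aut_char G \<chi>"
  shows "x \<otimes>\<^bsub>AutoGroup G\<^esub> y \<in> Aut_char G \<chi>"
  using \<sigma>_mult[OF repA(1)[OF assms(1)] repA(1)[OF assms(2)]] repA(2)[OF assms(1)] repA(2)[OF assms(2)]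
    \<sigma>_Aut_char[OF A.m_closed[OF repA(1)[OF assms(1)] repA(1)[OF assms(2)]]] by simp

lemma cocycle:
  assumes x: "x \<in> Aut_char G \<chi>" and y: "y \<in> Aut_char G \<chi>"
  shows "cocycle x y \<in> center A"
    and "repA x \<otimes>\<^bsub>A\<^esub> repA y = cocycle x y \<otimes>\<^bsub>A\<^esub> repA (x \<otimes>\<^bsub>AutoGroup G\<^esub> y)"
proof -
  note xy = Aut_char_mult[OF x y]
  note c = repA(1)[OF x] repA(1)[OF y] repA(1)[OF xy]
  have "\<sigma> (repA x \<otimes>\<^bsub>A\<^esub> repA y) = \<sigma> (repA (x \<otimes>\<^bsub>AutoGroup G\<^esub> y))"
    using \<sigma>_mult[OF c(1,2)] repA(2)[OF x] repA(2)[OF y] repA(2)[OF xy] by simp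
  then obtain z where z: "z \<in> center A"
    "repA x \<otimes>\<^bsub>A\<^esub> repA y = z \<otimes>\<^bsub>A\<^esub> repA (x \<otimes>\<^bsub>AutoGroup G\<^esub> y)"
    using \<sigma>_eq[OF A.m_closed[OF c(1,2)] c(3)] by blast
  have "cocycle x y = z" unfolding cocycle_def z(2) using A.center_carrier[OF z(1)] c by (simp add: A.m_assoc)
  then show "cocycle x y \<in> center A"
    "repA x \<otimes>\<^bsub>A\<^esub> repA y = cocycle x y \<otimes>\<^bsub>A\<^esub> repA (x \<otimes>\<^bsub>AutoGroup G\<^esub> y)" using z by auto
qed

lemma repA_N: assumes "x \<in> \<sigma> ` N" shows "repA x \<in> N" "x \<in> Aut_char G \<chi>" "\<sigma> (repA x) = x"
proof -
  from assms obtain b where b: "b \<in> N" "x = \<sigma> b" by blast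
  then show x: "x \<in> Aut_char G \<chi>" using \<sigma>_Aut_char N_carrier by blast
  show "\<sigma> (repA x) = x" using repA(2)[OF x] .
  then show "repA x \<in> N" using \<sigma>_in_N[OF repA(1)[OF x]] assms by simp
qed

lemma GL_repr: "a \<in> carrier A \<Longrightarrow> \<rho> a \<in> carrier (GL n)" and GL_repr': "a \<in> N \<Longrightarrow> \<rho>' a \<in> carrier (GL n')"
  using r.rep_hom r'.rep_hom by (auto simp: hom_def)

lemma AM_projective: "AM_projective R star l G D M \<chi> \<chi>'"
proof -
  \<comment> \<open>The central character of \<open>\<rho>\<close> evaluated on the cocycle. By
    \<open>central_chars_eq\<close> the one of \<open>\<rho>'\<close> gives the same values, so a
    single factor set serves both projective representations.\<close>
  define \<alpha> where "\<alpha> = (\<lambda>x y. mat_trace (\<rho> (cocycle x y)) / of_nat n)"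
  have nz: "\<alpha> x y \<noteq> 0" if "x \<in> Aut_char G \<chi>" "y \<in> Aut_char G \<chi>" for x y
    unfolding \<alpha>_def using central_char_nonzero[OF cocycle(1)[OF that]] .
  let ?Q = "AutoGroup G\<lparr>carrier := Aut_char G \<chi>\<rparr>"
  let ?Q' = "AutoGroup G\<lparr>carrier := (inner G ` M) <#>\<^bsub>AutoGroup G\<^esub> (Aut_set G D \<inter> Aut_char G \<chi>)\<rparr>"
  have P: "projective_rep ?Q n (\<lambda>x. \<rho> (repA x)) \<alpha>"
    unfolding projective_rep_def
  proof (intro conjI ballI)
    fix x y assume "x \<in> carrier ?Q" "y \<in> carrier ?Q"
    then have xy: "x \<in> Aut_char G \<chi>" "y \<in> Aut_char G \<chi>" by simp_all
    show "\<alpha> x y \<noteq> 0" using nz[OF xy] .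
    have "\<rho> (repA x) * \<rho> (repA y) = \<rho> (repA x \<otimes>\<^bsub>A\<^esub> repA y)" using r.rep_mult repA(1) xy by simp
    also have "\<dots> = \<alpha> x y \<cdot>\<^sub>m \<rho> (repA (x \<otimes>\<^bsub>AutoGroup G\<^esub> y))"
      unfolding cocycle(2)[OF xy] \<alpha>_def
      using central_trace_mult[OF A.is_group rho cocycle(1)[OF xy] repA(1)[OF Aut_char_mult[OF xy]]] .
    finally show "\<rho> (repA x) * \<rho> (repA y) = \<alpha> x y \<cdot>\<^sub>m \<rho> (repA (x \<otimes>\<^bsub>?Q\<^esub> y))" by simp
  qed (use r.rep_dim GL_repr repA(1) in auto)
  have Q': "carrier ?Q' = \<sigma> ` N" using \<sigma>_N by simp
  have P': "projective_rep ?Q' n' (\<lambda>x. \<rho>' (repA x)) \<alpha>"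
    unfolding projective_rep_def Q'
  proof (intro conjI ballI)
    fix x y assume xy': "x \<in> \<sigma> ` N" "y \<in> \<sigma> ` N"
    note xN = repA_N[OF xy'(1)] and yN = repA_N[OF xy'(2)]
    show "\<alpha> x y \<noteq> 0" using nz[OF xN(2) yN(2)] .
    have "x \<otimes>\<^bsub>AutoGroup G\<^esub> y \<in> \<sigma> ` N" using subgroup.m_closed[OF subgroup_\<sigma>_N xy'] .
    note xyN = repA_N[OF this]
    have "\<rho>' (repA x) * \<rho>' (repA y) = \<rho>' (repA x \<otimes>\<^bsub>A\<^esub> repA y)"
      using r'.rep_mult[of "repA x" "repA y"] xN(1) yN(1) by simp
    also have "\<dots> = (mat_trace (\<rho>' (cocycle x y)) / of_nat n') \<cdot>\<^sub>m \<rho>' (repA (x \<otimes>\<^bsub>AutoGroup G\<^esub> y))"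
      unfolding cocycle(2)[OF xN(2) yN(2)]
      using central_trace_mult[OF group_N rho' center_AN[OF cocycle(1)[OF xN(2) yN(2)]], of
          "repA (x \<otimes>\<^bsub>AutoGroup G\<^esub> y)"] xyN(1) by simp
    also have "mat_trace (\<rho>' (cocycle x y)) / of_nat n' = \<alpha> x y"
      unfolding \<alpha>_def using central_chars_eq[OF cocycle(1)[OF xN(2) yN(2)]] .
    finally show "\<rho>' (repA x) * \<rho>' (repA y) = \<alpha> x y \<cdot>\<^sub>m \<rho>' (repA (x \<otimes>\<^bsub>?Q'\<^esub> y))" by simp
  qed (use r'.rep_dim GL_repr' repA_N(1) in auto)
  have cs: "center_section G rep"
    unfolding center_section_def using rep by (auto simp: rep_def)
  have repA_inner: "repA s = e (rep s)" if "s \<in> inner G ` carrier G" for s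
    using that by (simp add: repA_def)
  have ob: "obtained_using G (carrier G) \<chi> rep n (\<lambda>x. \<rho> (repA x))"
    unfolding obtained_using_def
  proof (intro exI[of _ "\<lambda>g. \<rho> (e g)"] conjI ballI)
    show "(\<lambda>g. \<rho> (e g)) \<in> hom (G\<lparr>carrier := carrier G\<rparr>) (GL n)"
      using rho_G by (simp add: irreducible_rep_def)
    show "affords (G\<lparr>carrier := carrier G\<rparr>) (\<lambda>g. \<rho> (e g)) \<chi>"
      by (simp add: affords_def chi_eq)
  qed (simp add: repA_inner)
  have ob': "obtained_using G M \<chi>' rep n' (\<lambda>x. \<rho>' (repA x))"
    unfolding obtained_using_def
  proof (intro exI[of _ "\<lambda>g. \<rho>' (e g)"] conjI ballI)
    show "(\<lambda>g. \<rho>' (e g)) \<in> hom (G\<lparr>carrier := M\<rparr>) (GL n')"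
      using rho'_M by (simp add: irreducible_rep_def)
    show "affords (G\<lparr>carrier := M\<rparr>) (\<lambda>g. \<rho>' (e g)) \<chi>'"
      by (simp add: affords_def chi'_eq)
    fix s assume "s \<in> inner G ` M"
    then have "s \<in> inner G ` carrier G" using M_carrier by blast
    then show "\<rho>' (repA s) = \<rho>' (e (rep s))" by (simp add: repA_inner)
  qed
  have tr: "mat_trace (\<rho> (repA x)) \<in> R \<and> mat_trace (\<rho>' (repA x)) \<in> R \<and>
      star (of_nat (AM_epsilon l G M \<chi> \<chi>')) * star (mat_trace (\<rho> (repA x))) =
        star (mat_trace (\<rho>' (repA x)))"
    if x: "l_regular l ?Q' x"
      "sylow_subgroup l (AutoGroup G\<lparr>carrier := {s \<in> inner G ` carrier G.
          s \<otimes>\<^bsub>AutoGroup G\<^esub> x = x \<otimes>\<^bsub>AutoGroup G\<^esub> s}\<rparr>) (inner G ` (D <#>\<^bsub>G\<^esub> center G))" for x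
  proof -
    have "x \<in> \<sigma> ` N" using x(1) Q' by (simp add: l_regular_def)
    note xN = repA_N[OF this]
    have "D \<subseteq> CG (repA x)" "card D = l_part l (card (CG (repA x)))"
      using sylow_CG[OF xN(1)] x unfolding xN(3) \<sigma>_N by blast+
    then show ?thesis using trace_congruence[OF xN(1)] by blast
  qed
  show ?thesis
    unfolding AM_projective_def Let_def
    by (intro exI conjI) (rule cs, rule P, rule P', rule ob, rule ob', simp, use tr in blast)
qed

end

section \<open>The main result\<close>

text \<open>\<open>i\<close> is injective on the quotient, so the kernel of the composition is
  contained in \<open>Z\<close> and therefore central.\<close>

lemma quotient_embedding:
  assumes G: "group G" and A: "group A" and Z: "subgroup Z G" "Z \<subseteq> center G"
    and i: "i \<in> mon (G Mod Z) A"
  shows "(\<lambda>g. i (Z #>\<^bsub>G\<^esub> g)) \<in> hom G A"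
    and "\<And>g. g \<in> carrier G \<Longrightarrow> i (Z #>\<^bsub>G\<^esub> g) = \<one>\<^bsub>A\<^esub> \<Longrightarrow> g \<in> center G"
proof -
  interpret G: group G by fact
  have N: "Z \<lhd> G"
  proof (rule G.normal_invI[OF Z(1)])
    fix x h assume x: "x \<in> carrier G" and h: "h \<in> Z"
    then have hZ: "h \<in> center G" using Z(2) by blast
    have hG: "h \<in> carrier G" using hZ by (rule G.center_carrier)
    have "x \<otimes>\<^bsub>G\<^esub> h \<otimes>\<^bsub>G\<^esub> inv\<^bsub>G\<^esub> x = h \<otimes>\<^bsub>G\<^esub> x \<otimes>\<^bsub>G\<^esub> inv\<^bsub>G\<^esub> x"
      using G.center_commute[OF hZ x] by simp
    then show "x \<otimes>\<^bsub>G\<^esub> h \<otimes>\<^bsub>G\<^esub> inv\<^bsub>G\<^esub> x \<in> Z" using h hG x by (simp add: G.m_assoc)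
  qed
  interpret N: normal Z G by fact
  interpret Q: group "G Mod Z" by (rule N.factorgroup_is_group)
  have hom: "i \<in> hom (G Mod Z) A" "inj_on i (carrier (G Mod Z))" using i by (auto simp: mon_def)
  have car: "Z #>\<^bsub>G\<^esub> g \<in> carrier (G Mod Z)" if "g \<in> carrier G" for g
    using that by (auto simp: FactGroup_def RCOSETS_def)
  show "(\<lambda>g. i (Z #>\<^bsub>G\<^esub> g)) \<in> hom G A"
  proof (rule homI)
    fix x y assume xy: "x \<in> carrier G" "y \<in> carrier G"
    show "i (Z #>\<^bsub>G\<^esub> (x \<otimes>\<^bsub>G\<^esub> y)) = i (Z #>\<^bsub>G\<^esub> x) \<otimes>\<^bsub>A\<^esub> i (Z #>\<^bsub>G\<^esub> y)"
      using hom_mult[OF hom(1) car[OF xy(1)] car[OF xy(2)]] N.rcos_sum[OF xy] by (simp add: FactGroup_def)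
  qed (use car hom(1) in \<open>auto simp: hom_def\<close>)
  fix g assume g: "g \<in> carrier G" "i (Z #>\<^bsub>G\<^esub> g) = \<one>\<^bsub>A\<^esub>"
  have "i \<one>\<^bsub>G Mod Z\<^esub> = \<one>\<^bsub>A\<^esub>" using hom_one[OF hom(1) Q.is_group A] .
  then have "Z #>\<^bsub>G\<^esub> g = \<one>\<^bsub>G Mod Z\<^esub>"
    using hom(2) car[OF g(1)] Q.one_closed g(2) by (metis inj_onD)
  then have "Z #>\<^bsub>G\<^esub> g = Z" by (simp add: FactGroup_def)
  then show "g \<in> center G" using G.rcos_self[OF g(1) Z(1)] Z(2) by blast
qed

text \<open>The extension hypotheses only say that a restricted character agrees with a given
  irreducible one. Here this equality of traces is turned into irreducibility of the restricted
  representation.\<close>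

lemma pullback_same_trace:
  assumes Y: "group Y" and fin: "finite (carrier Y)" and \<psi>: "\<psi> \<in> Irr Y"
    and H: "group H" and irr: "irreducible_rep H n \<rho>" and e: "e \<in> hom Y H"
    and tr: "\<And>y. y \<in> carrier Y \<Longrightarrow> mat_trace (\<rho> (e y)) = \<psi> y"
  shows "irreducible_rep Y n (\<lambda>y. \<rho> (e y))" and "\<psi> = (\<lambda>y\<in>carrier Y. mat_trace (\<rho> (e y)))"
proof -
  from \<psi> obtain m \<tau> where \<tau>: "irreducible_rep Y m \<tau>" "\<And>y. y \<in> carrier Y \<Longrightarrow> \<psi> y = mat_trace (\<tau> y)"
    "\<psi> = (\<lambda>y\<in>carrier Y. mat_trace (\<tau> y))" by (elim IrrE) blast
  have "\<rho> \<in> hom H (GL n)" using irr by (simp add: irreducible_rep_def)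
  from Group.hom_compose[OF e this] have "representation Y n (\<lambda>y. \<rho> (e y))"
    using Y irr by (simp add: representation_def representation_axioms_def irreducible_rep_def comp_def)
  then show "irreducible_rep Y n (\<lambda>y. \<rho> (e y))"
    using irreducible_rep_of_same_trace(1)[OF Y fin \<tau>(1)] tr \<tau>(2) by simp
  show "\<psi> = (\<lambda>y\<in>carrier Y. mat_trace (\<rho> (e y)))"
    using \<tau>(2,3) tr by (auto simp: fun_eq_iff restrict_def)
qed

lemma (in mod_red) AM_extensions_imp_AM_projective:
  fixes G :: "'a monoid"
  assumes G: "group G" and finG: "finite (carrier G)" and perfect: "derived G (carrier G) = carrier G"
    and D: "radical_subgroup l G D" and M: "AM_subgroup G D M"
    and chi: "\<chi> \<in> Irr0 star l G D" and chi': "\<chi>' \<in> Irr0 star l (G\<lparr>carrier := M\<rparr>) D"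
    and ext: "AM_extensions star G D M \<chi> \<chi>'"
  shows "AM_projective R star l G D M \<chi> \<chi>'"
proof -
  let ?Z = "char_kernel G \<chi> \<inter> center G"
  let ?e = "\<lambda>(i :: 'a set \<Rightarrow> nat) g. i (?Z #>\<^bsub>G\<^esub> g)"
  have IrrG: "\<chi> \<in> Irr G" and IrrM: "\<chi>' \<in> Irr (G\<lparr>carrier := M\<rparr>)"
    using chi chi' by (auto simp: Irr0_def Irr_defect_def)
  have sM: "subgroup M G" using M by (simp add: AM_subgroup_def)
  show ?thesis
    using ext unfolding AM_extensions_def Let_def
  proof (elim exE conjE bexE)
    fix A :: "nat monoid" and i \<kappa> \<chi>t \<chi>t' \<chi>b \<chi>b'
    assume A: "group A" and finA: "finite (carrier A)" and i: "i \<in> mon (G Mod ?Z) A"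
      and cent: "centralizer A (?e i ` carrier G) = center A"
      and \<kappa>: "\<kappa> \<in> iso (A Mod center A) (AutoGroup G\<lparr>carrier := Aut_char G \<chi>\<rparr>)"
      and conj: "\<forall>a\<in>carrier A. \<forall>g\<in>carrier G.
        ?e i (\<kappa> (center A #>\<^bsub>A\<^esub> a) g) = a \<otimes>\<^bsub>A\<^esub> ?e i g \<otimes>\<^bsub>A\<^esub> inv\<^bsub>A\<^esub> a"
      and \<chi>t: "\<chi>t \<in> Irr A"
      and \<chi>b: "\<forall>g\<in>carrier G. \<chi>b (?e i g) = \<chi> g" "restrict \<chi>t (?e i ` carrier G) = \<chi>b"
      and \<chi>t': "\<chi>t' \<in> Irr (A\<lparr>carrier := (?e i ` M) <#>\<^bsub>A\<^esub> normalizer A (?e i ` D)\<rparr>)"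
      and \<chi>b': "\<forall>g\<in>M. \<chi>b' (?e i g) = \<chi>' g" "restrict \<chi>t' (?e i ` M) = \<chi>b'"
      and blocks: "\<forall>J. subgroup J A \<and> ?e i ` carrier G \<subseteq> J \<longrightarrow>
        is_induced_block star (A\<lparr>carrier := J\<rparr>)
          ((?e i ` M) <#>\<^bsub>A\<^esub> normalizer (A\<lparr>carrier := J\<rparr>) (?e i ` D))
          (bl star (A\<lparr>carrier := (?e i ` M) <#>\<^bsub>A\<^esub> normalizer (A\<lparr>carrier := J\<rparr>) (?e i ` D)\<rparr>)
            (restrict \<chi>t' ((?e i ` M) <#>\<^bsub>A\<^esub> normalizer (A\<lparr>carrier := J\<rparr>) (?e i ` D))))
          (bl star (A\<lparr>carrier := J\<rparr>) (restrict \<chi>t J))"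
      and central: "Irr_under A (center A) \<chi>t =
        Irr_under (A\<lparr>carrier := (?e i ` M) <#>\<^bsub>A\<^esub> normalizer A (?e i ` D)\<rparr>) (center A) \<chi>t'"
    define e where "e = ?e i"
    note Z = subgroup_char_kernel_center[OF G IrrG]
    note q = quotient_embedding[OF G A Z _ i, simplified, folded e_def]
    have e_hom: "e \<in> hom G A" using q(1) by (simp add: e_def)
    have e_ker: "g \<in> center G" if "g \<in> carrier G" "e g = \<one>\<^bsub>A\<^esub>" for g
      using q(2)[OF that(1)] that(2) by (simp add: e_def)
    have ov: "AM_overgroup G A l D M \<chi> e \<kappa>"
      unfolding AM_overgroup_def AM_overgroup_axioms_def
      using G A finG finA perfect prime_l D M e_hom e_ker cent \<kappa> conj by (simp add: e_def)
    interpret ov: AM_overgroup G A l D M \<chi> e \<kappa> by fact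
    have N: "ov.N = (e ` M) <#>\<^bsub>A\<^esub> normalizer A (e ` D)" by (simp add: ov.N_def ov.nA_def)
    from \<chi>t obtain n \<rho> where \<rho>: "irreducible_rep A n \<rho>"
      "\<chi>t = (\<lambda>x\<in>carrier A. mat_trace (\<rho> x))" by (elim IrrE) blast
    from \<chi>t' obtain n' \<rho>' where \<rho>': "irreducible_rep (A\<lparr>carrier := ov.N\<rparr>) n' \<rho>'"
      "\<chi>t' = (\<lambda>x\<in>ov.N. mat_trace (\<rho>' x))" unfolding e_def[symmetric] N[symmetric] by (elim IrrE) auto
    have gN: "group (A\<lparr>carrier := ov.N\<rparr>)"
      using subgroup.subgroup_is_group[OF ov.subgroup_N A] .
    have gM: "group (G\<lparr>carrier := M\<rparr>)" using subgroup.subgroup_is_group[OF sM G] .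
    have finM: "finite (carrier (G\<lparr>carrier := M\<rparr>))" using finite_subset[OF ov.M_carrier finG] by simp
    have eM: "e \<in> hom (G\<lparr>carrier := M\<rparr>) (A\<lparr>carrier := ov.N\<rparr>)"
      using e_hom ov.e_M_N ov.M_carrier by (auto simp: hom_def subset_iff)
    have tr: "mat_trace (\<rho> (e g)) = \<chi> g" if g: "g \<in> carrier G" for g
    proof -
      have "e g \<in> e ` carrier G" "e g \<in> carrier A" using g by auto
      then have "\<chi>b (e g) = mat_trace (\<rho> (e g))" unfolding \<chi>b(2)[symmetric] \<rho>(2) e_def[symmetric] by simp
      then show ?thesis using \<chi>b(1) g by (simp add: e_def)
    qed
    have tr': "mat_trace (\<rho>' (e m)) = \<chi>' m" if m: "m \<in> carrier (G\<lparr>carrier := M\<rparr>)" for m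
    proof -
      have "e m \<in> e ` M" "e m \<in> ov.N" using m ov.e_M_N by auto
      then have "\<chi>b' (e m) = mat_trace (\<rho>' (e m))" unfolding \<chi>b'(2)[symmetric] \<rho>'(2) e_def[symmetric] by simp
      then show ?thesis using \<chi>b'(1) m by (simp add: e_def)
    qed
    have pG: "irreducible_rep G n (\<lambda>g. \<rho> (e g))" "\<chi> = (\<lambda>g\<in>carrier G. mat_trace (\<rho> (e g)))"
      by (rule pullback_same_trace[OF G finG IrrG A \<rho>(1) e_hom], erule tr)+
    have pM: "irreducible_rep (G\<lparr>carrier := M\<rparr>) n' (\<lambda>g. \<rho>' (e g))"
      "\<chi>' = (\<lambda>g\<in>carrier (G\<lparr>carrier := M\<rparr>). mat_trace (\<rho>' (e g)))"
      by (rule pullback_same_trace[OF gM finM IrrM gN \<rho>'(1) eM], erule tr')+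
    have "AM_characters_axioms l star G A D M \<chi> e \<chi>' n n' \<rho> \<rho>'"
    proof (rule AM_characters_axioms.intro)
      show "\<chi> \<in> Irr0 star l G D" "\<chi>' \<in> Irr0 star l (G\<lparr>carrier := M\<rparr>) D" by fact+
      show "irreducible_rep A n \<rho>" "irreducible_rep (A\<lparr>carrier := ov.N\<rparr>) n' \<rho>'" by fact+
      show "irreducible_rep G n (\<lambda>g. \<rho> (e g))" by (rule pG(1))
      show "\<chi> = (\<lambda>g\<in>carrier G. mat_trace (\<rho> (e g)))" by (rule pG(2))
      show "irreducible_rep (G\<lparr>carrier := M\<rparr>) n' (\<lambda>g. \<rho>' (e g))" by (rule pM(1))
      show "\<chi>' = (\<lambda>g\<in>M. mat_trace (\<rho>' (e g)))" using pM(2) by simp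
      show "Irr_under A (center A) (\<lambda>x\<in>carrier A. mat_trace (\<rho> x)) =
          Irr_under (A\<lparr>carrier := ov.N\<rparr>) (center A) (\<lambda>x\<in>ov.N. mat_trace (\<rho>' x))"
        using central unfolding e_def[symmetric] N[symmetric] \<rho>(2)[symmetric] \<rho>'(2)[symmetric] .
      fix B NB
      assume "subgroup B A" "e ` carrier G \<subseteq> B"
        and NB: "NB = (e ` M) <#>\<^bsub>A\<^esub> normalizer (A\<lparr>carrier := B\<rparr>) (e ` D)"
      then show "is_induced_block star (A\<lparr>carrier := B\<rparr>) NB
          (bl star (A\<lparr>carrier := NB\<rparr>) (restrict (\<lambda>x\<in>ov.N. mat_trace (\<rho>' x)) NB))
          (bl star (A\<lparr>carrier := B\<rparr>) (restrict (\<lambda>x\<in>carrier A. mat_trace (\<rho> x)) B))"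
        using blocks unfolding e_def[symmetric] \<rho>(2)[symmetric] \<rho>'(2)[symmetric] NB by blast
    qed
    then show "AM_projective R star l G D M \<chi> \<chi>'"
      using AM_characters.AM_projective[OF AM_characters.intro[OF mod_red_axioms ov]] by blast
  qed
qed

theorem proposition2p2:
  fixes S :: "'s monoid" and G :: "'a monoid" and p :: "'a \<Rightarrow> 's" and l :: nat
    and R :: "complex set" and star :: "complex \<Rightarrow> 'k::alg_closed_field"
  assumes "simple_group S" and "finite (carrier S)" and "\<not> comm_group S"
    and "universal_covering_group G p S"
    and "Factorial_Ring.prime l"
    and "modular_reduction l R star"
    and "\<And>D. noncentral_radical l G D \<Longrightarrow> relative_inductive_AM star l G D"
  shows "inductive_AM_projective R star l G"
proof -
  have G: "group G" "finite (carrier G)" "derived G (carrier G) = carrier G"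
    using assms(4) by (auto simp: universal_covering_group_def central_extension_def)
  obtain K \<nu> where "mod_red l R star K \<nu>"
    using modular_reductionE[OF assms(6,5)] .
  then interpret mod_red l R star K \<nu> .
  show ?thesis
    unfolding inductive_AM_projective_def
  proof (intro allI impI)
    fix D assume D: "noncentral_radical l G D"
    then have rad: "radical_subgroup l G D" by (simp add: noncentral_radical_def)
    from assms(7)[OF D] obtain M \<Omega> where M: "AM_subgroup G D M" and \<Omega>: "AM_bijection star l G D M \<Omega>"
      and ext: "\<And>\<chi>. \<chi> \<in> Irr0 star l G D \<Longrightarrow> AM_extensions star G D M \<chi> (\<Omega> \<chi>)"
      unfolding relative_inductive_AM_def by blast
    have "AM_projective R star l G D M \<chi> (\<Omega> \<chi>)" if \<chi>: "\<chi> \<in> Irr0 star l G D" for \<chi>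
    proof -
      have "\<Omega> \<chi> \<in> Irr0 star l (G\<lparr>carrier := M\<rparr>) D"
        using \<Omega> \<chi> unfolding AM_bijection_def by (blast dest: bij_betwE)
      then show ?thesis
        using AM_extensions_imp_AM_projective[OF G rad M \<chi> _ ext[OF \<chi>]] by blast
    qed
    then show "\<exists>M \<Omega>. AM_subgroup G D M \<and> AM_bijection star l G D M \<Omega> \<and>
        (\<forall>\<chi>\<in>Irr0 star l G D. AM_projective R star l G D M \<chi> (\<Omega> \<chi>))"
      using M \<Omega> by blast
  qed
qed

end
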